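(* Let $X$ be a transient Borel right process (not necessarily symmetric) with state space $\mathbb N$ and strictly positive potential density $U=\{U_{j,k}\}_{j,k\in\mathbb N}$. Assume that $$\inf_jU_{j,j}>0,\qquad \sup_j\sum_{k=1}^\infty U_{j,k}<\infty,\qquad\text{and}\qquad \sup_k\sum_{j=1}^\infty U_{j,k}<\infty.$$ Let $f\in\ell_\infty$ be such that $$f_k=\sum_{j=1}^\infty h_jU_{j,k},\quad k\in\mathbb N,\qquad\text{for some } h\in\ell_1^+,$$ and let $\widetilde U=\{\widetilde U_{j,k}\}_{j,k\in\mathbb N}$ where $\widetilde U_{j,k}=U_{j,k}+f_k$, $j,k\in\mathbb N$. Then for any $\alpha>0$, $\widetilde U$ is the kernel of an $\alpha$-permanental sequence $\widetilde X_\alpha=\{\widetilde X_{\alpha,n}\}_{n\in\mathbb N}$ and $$\limsup_{n\to\infty}\frac{\widetilde X_{\alpha,n}}{U_{n,n}\log n}=1\quad\text{a.s.}$$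
   Context: $\mathbb N=\{1,2,\dots\}$; $\ell_1^+$ is the set of non-negative summable sequences. Permanental sequences: for $\alpha>0$ and a matrix $K=\{K_{j,k}\}_{j,k\in\mathbb N}$, an $\alpha$-permanental sequence with kernel $K$ is a sequence $\{Z_j\}_{j\in\mathbb N}$ of non-negative random variables such that for all $n$, all distinct $i_1,\dots,i_n\in\mathbb N$ and all $s_1,\dots,s_n>0$, $E\exp(-\sum_{m=1}^n s_mZ_{i_m})=\det(I+K'S)^{-\alpha}$, where $K'=\{K_{i_p,i_q}\}_{p,q=1}^n$ and $S=\mathrm{diag}(s_1,\dots,s_n)$. Processes: a Borel right process $X$ on the countable discrete space $\mathbb N$ is a continuous-time right-continuous strong Markov process (possibly sent to a cemetery state at a finite lifetime) with transition functions $p_t(j,k)$. Its potential density (with respect to counting measure) is $U_{j,k}=\int_0^\infty p_t(j,k)\,dt$; $X$ is transient if these are finite. *)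

theory Defs
  imports "HOL-Probability.Probability" "Jordan_Normal_Form.Determinant"
begin

text \<open>
  The state space is \<open>{1..} :: nat set\<close>. The natural number 0, which is not a state, plays the
  role of the cemetery, so that a process with values in the state space and the cemetery is a
  process with values in \<^typ>\<open>nat\<close>. The discrete topology of \<^typ>\<open>nat\<close> is the one intended.
\<close>

definition transition_function ::
    "(nat \<Rightarrow> 'w measure) \<Rightarrow> (real \<Rightarrow> 'w \<Rightarrow> nat) \<Rightarrow> real \<Rightarrow> nat \<Rightarrow> nat \<Rightarrow> real"
  where "transition_function P X t j k = measure (P j) {\<omega> \<in> space (P j). X t \<omega> = k}"

text \<open>
  \<open>P j\<close> is the law of the process started at the state \<open>j\<close>, and \<open>X t\<close> is relevant for \<open>t \<ge> 0\<close>
  only. The filtration is indexed by \<open>[0, \<infinity>]\<close>, so that stopping times may be infinite. In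
  \<open>strong_markov\<close> the case \<open>X\<^sub>T = 0\<close> is left out: there the conditional probability vanishes
  because the cemetery is absorbing.
\<close>

locale borel_right_process =
  filtration \<Omega> F for \<Omega> :: "'w set" and F :: "ennreal \<Rightarrow> 'w measure" +
  fixes P :: "nat \<Rightarrow> 'w measure" and X :: "real \<Rightarrow> 'w \<Rightarrow> nat"
  assumes prob_space_P: "\<And>j. 1 \<le> j \<Longrightarrow> prob_space (P j)"
    and subalgebra_F: "\<And>j. 1 \<le> j \<Longrightarrow> subalgebra (P j) (F \<infinity>)"
    and adapted: "\<And>t. 0 \<le> t \<Longrightarrow> X t \<in> F (ennreal t) \<rightarrow>\<^sub>M count_space UNIV"
    and start: "\<And>j. 1 \<le> j \<Longrightarrow> AE \<omega> in P j. X 0 \<omega> = j"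
    and right_continuous:
      "\<And>\<omega> t. \<omega> \<in> \<Omega> \<Longrightarrow> 0 \<le> t \<Longrightarrow> continuous (at_right t) (\<lambda>r. X r \<omega>)"
    and cemetery_absorbing:
      "\<And>\<omega> s t. \<omega> \<in> \<Omega> \<Longrightarrow> 0 \<le> s \<Longrightarrow> s \<le> t \<Longrightarrow> X s \<omega> = 0 \<Longrightarrow> X t \<omega> = 0"
    and strong_markov:
      "\<And>j k s T. 1 \<le> j \<Longrightarrow> 1 \<le> k \<Longrightarrow> 0 \<le> s \<Longrightarrow> stopping_time F T \<Longrightarrow>
        AE \<omega> in P j. T \<omega> < \<infinity> \<and> X (enn2real (T \<omega>)) \<omega> \<noteq> 0 \<longrightarrow>
          real_cond_exp (P j) (pre_sigma T)
            (indicator {\<omega>' \<in> \<Omega>. T \<omega>' < \<infinity> \<and> X (enn2real (T \<omega>') + s) \<omega>' = k}) \<omega>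
          = transition_function P X s (X (enn2real (T \<omega>)) \<omega>) k"

definition potential_density ::
    "(nat \<Rightarrow> 'w measure) \<Rightarrow> (real \<Rightarrow> 'w \<Rightarrow> nat) \<Rightarrow> nat \<Rightarrow> nat \<Rightarrow> ennreal"
  where "potential_density P X j k =
    (\<integral>\<^sup>+t\<in>{0..}. ennreal (transition_function P X t j k) \<partial>lborel)"

definition transient :: "(nat \<Rightarrow> 'w measure) \<Rightarrow> (real \<Rightarrow> 'w \<Rightarrow> nat) \<Rightarrow> bool"
  where "transient P X \<longleftrightarrow> (\<forall>j\<ge>1. \<forall>k\<ge>1. potential_density P X j k < \<infinity>)"

text \<open>
  Sequences and kernels are indexed by \<open>{1..}\<close>; their values at the index 0 are irrelevant.
  The expectation below is positive and the determinant is a polynomial in \<open>s\<close> that equals 1 at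
  \<open>s = 0\<close>; hence the required identity forces the determinant to be positive, and \<open>powr\<close> is only
  ever used with a positive base.
\<close>

definition permanental_sequence ::
    "'b measure \<Rightarrow> real \<Rightarrow> (nat \<Rightarrow> nat \<Rightarrow> real) \<Rightarrow> (nat \<Rightarrow> 'b \<Rightarrow> real) \<Rightarrow> bool"
  where "permanental_sequence M \<alpha> K Z \<longleftrightarrow>
    prob_space M \<and>
    (\<forall>j\<ge>1. Z j \<in> borel_measurable M \<and> (\<forall>\<omega>\<in>space M. 0 \<le> Z j \<omega>)) \<and>
    (\<forall>n i s. inj_on i {..<n} \<and> i ` {..<n} \<subseteq> {1..} \<and> (\<forall>m<n. 0 < s m) \<longrightarrow>
      integral\<^sup>L M (\<lambda>\<omega>. exp (- (\<Sum>m<n. s m * Z (i m) \<omega>))) =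
      Determinant.det (1\<^sub>m n + Matrix.mat n n (\<lambda>(p, q). K (i p) (i q)) * mat_diag n s)
        powr (- \<alpha>))"

end

theory Submission
  imports Defs "HOL-Real_Asymp.Real_Asymp"
begin

text \<open>
  The maximum principle for the potential \<open>U\<close> shows that every finite section of \<open>U\<close> has an inverse
  with nonpositive off-diagonal entries and nonnegative row sums, and by the Sherman--Morrison formula
  the corresponding section of \<open>U + 1 f\<close> has an inverse with nonpositive off-diagonal entries and a
  smaller diagonal. For a kernel \<open>K\<close> with such an inverse \<open>A\<close>, Gaussian elimination writes
  \<open>det (I + K S) powr (- \<alpha>)\<close> as the Laplace transform of \<open>\<Gamma> + Y\<close> with independent gamma variables
  \<open>\<Gamma>\<^sub>i\<close> of rate \<open>A i i\<close> and an independent nonnegative \<open>Y\<close>; the permanental sequence itself comes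
  from Kolmogorov's extension theorem.

  Each coordinate is a gamma variable of scale \<open>U n n + f n\<close>, where \<open>f\<close> tends to 0, so the first
  Borel--Cantelli lemma gives the upper bound. For the lower bound, the row and column sums of \<open>U\<close> being bounded,
  a positive fraction of the indices below \<open>N\<close> can be chosen such that all off-diagonal entries
  between them are at most \<open>\<eta>\<close>. Then \<open>A i i \<le> 1 / (U i i - \<eta>)\<close> for the chosen indices, and the
  coordinates dominate independent gamma variables whose maximum is almost of order \<open>U i i * ln N\<close>.
\<close>

section \<open>Maximum principles for potentials\<close>

text \<open>What is left is one-sided: as \<open>Y\<close> is nonnegative, the probability that all
  coordinates are small is at most a product of gamma probabilities. This bound is used for every
  \<open>N\<close> on one fixed event, that no exceedance occurs from a given index on, and shows
  that this event is null.

  The rank-one term is harmless on both sides. As \<open>f = h U\<close> with \<open>h\<close>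
  nonnegative, the row vector \<open>f A\<close> is nonnegative on every finite section, so the
  correction can only lower the entries of the inverse, which enlarges the gamma variables. As
  \<open>h\<close> is summable and the row sums of \<open>U\<close> are bounded, \<open>f\<close> is
  summable; since the diagonal of \<open>U\<close> is bounded below, \<open>U n n + f n\<close> and
  \<open>U n n\<close> are asymptotically equal.

  The potential theory is done with resolvents. The uniform bound on \<open>U 1\<close> yields a
  strict contraction, which takes the place of arguments with hitting times.\<close>

lemma has_sum_sum:
  fixes f :: "'i \<Rightarrow> 'a \<Rightarrow> real"
  assumes "finite F" "\<And>k. k \<in> F \<Longrightarrow> (f k has_sum s k) A"
  shows "((\<lambda>x. \<Sum>k\<in>F. f k x) has_sum (\<Sum>k\<in>F. s k)) A"
  using assms by (induction F rule: finite_induct) (auto intro!: has_sum_add)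

lemma has_sum_diff:
  fixes f :: "'a \<Rightarrow> real"
  assumes "(f has_sum a) A" "(g has_sum b) A"
  shows "((\<lambda>x. f x - g x) has_sum (a - b)) A"
  using has_sum_add[OF assms(1), of "\<lambda>x. - g x" "- b"] assms(2) by (simp add: has_sum_uminus)

text \<open>\<open>U\<close> is the potential of a sub-Markov semigroup on \<open>S\<close> and \<open>Q r\<close> is \<open>r\<close> times its \<open>r\<close>-resolvent.\<close>

locale potential_kernel =
  fixes S :: "'a set" and U :: "'a \<Rightarrow> 'a \<Rightarrow> real" and Q :: "real \<Rightarrow> 'a \<Rightarrow> 'a \<Rightarrow> real" and C :: real
  assumes U_nonneg: "j \<in> S \<Longrightarrow> k \<in> S \<Longrightarrow> 0 \<le> U j k"
    and U_summable: "j \<in> S \<Longrightarrow> U j summable_on S"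
    and U_row_bound: "j \<in> S \<Longrightarrow> infsum (U j) S \<le> C"
    and Q_nonneg: "0 < r \<Longrightarrow> j \<in> S \<Longrightarrow> k \<in> S \<Longrightarrow> 0 \<le> Q r j k"
    and Q_summable: "0 < r \<Longrightarrow> j \<in> S \<Longrightarrow> Q r j summable_on S"
    and Q_row_bound: "0 < r \<Longrightarrow> j \<in> S \<Longrightarrow> infsum (Q r j) S \<le> 1"
    and resolvent_eq: "0 < r \<Longrightarrow> j \<in> S \<Longrightarrow> k \<in> S \<Longrightarrow>
      ((\<lambda>i. Q r j i * U i k) has_sum (U j k - Q r j k / r)) S"
    and resolvent_row: "0 < r \<Longrightarrow> j \<in> S \<Longrightarrow>
      ((\<lambda>i. Q r j i * infsum (U i) S) has_sum (infsum (U j) S - infsum (Q r j) S / r)) S"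
    and Q_limit: "j \<in> S \<Longrightarrow> k \<in> S \<Longrightarrow> (\<lambda>n. Q (real n) j k) \<longlonglongrightarrow> of_bool (j = k)"
begin

text \<open>The function \<open>w = U 1 + 1 / r\<close> satisfies \<open>Q w \<le> \<rho> w\<close> with \<open>\<rho> < 1\<close>, so a lower bound
  \<open>- c w\<close> for \<open>k\<close> improves to \<open>- c \<rho>\<^sup>n w\<close> for every \<open>n\<close>.\<close>

lemma comparison:
  assumes l: "0 < r" and B: "\<And>i. i \<in> S \<Longrightarrow> - B \<le> k i"
    and pos: "\<And>i. i \<in> F \<Longrightarrow> 0 \<le> k i"
    and super: "\<And>j. j \<in> S \<Longrightarrow> j \<notin> F \<Longrightarrow> \<exists>x. ((\<lambda>i. Q r j i * k i) has_sum x) S \<and> x \<le> k j"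
    and i: "i \<in> S"
  shows "0 \<le> k i"
proof -
  define u where "u = (\<lambda>j. infsum (U j) S)"
  define w where "w j = u j + 1 / r" for j
  \<comment> \<open>The ratio \<open>u / w = u / (u + 1 / r)\<close> increases with
    \<open>u\<close>, and \<open>u \<le> C\<close> gives its largest value
    \<open>r * C / (r * C + 1)\<close>.\<close>
  define \<rho> where "\<rho> = 1 - 1 / (r * C + 1)"
  \<comment> \<open>As \<open>w \<ge> 1 / r\<close>, this makes \<open>- c * w\<close> a lower bound
    for \<open>k\<close> and starts the induction.\<close>
  define c where "c = \<bar>B\<bar> * r"
  have u0: "0 \<le> u j" if "j \<in> S" for j
    unfolding u_def using that by (intro infsum_nonneg U_nonneg)
  have uC: "u j \<le> C" if "j \<in> S" for j using U_row_bound[OF that] by (simp add: u_def)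
  have C: "0 \<le> C" using u0[OF i] uC[OF i] by simp
  have l1: "0 < r * C + 1" using C l by (simp add: add_nonneg_pos)
  have \<rho>: "0 \<le> \<rho>" "\<rho> < 1" using C l l1 by (auto simp: \<rho>_def field_simps)
  have c: "0 \<le> c" using l by (simp add: c_def)
  have w: "1 / r \<le> w j" "u j \<le> \<rho> * w j" if "j \<in> S" for j
  proof -
    show "1 / r \<le> w j" using u0[OF that] by (simp add: w_def)
    have "w j * r \<le> r * C + 1"
      using uC[OF that] l by (simp add: w_def field_simps)
    then have "w j / (r * C + 1) \<le> 1 / r" using l l1 by (simp add: field_simps)
    then show "u j \<le> \<rho> * w j" by (simp add: \<rho>_def w_def left_diff_distrib)
  qed
  \<comment> \<open>The row identity gives \<open>Q u = u - Q 1 / r\<close>, and the constant part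
    of \<open>w\<close> contributes exactly the missing \<open>Q 1 / r\<close>.\<close>
  have Qw: "((\<lambda>i. Q r j i * w i) has_sum u j) S" if "j \<in> S" for j
  proof -
    have "((\<lambda>i. Q r j i * u i + Q r j i * (1 / r)) has_sum
        (u j - infsum (Q r j) S / r + infsum (Q r j) S * (1 / r))) S"
      using resolvent_row[OF l that] unfolding u_def
      by (intro has_sum_add has_sum_cmult_left has_sum_infsum Q_summable l that) auto
    then show ?thesis by (simp add: w_def distrib_left)
  qed
  have step: "- c * \<rho> ^ n * w j \<le> k j" if "j \<in> S" for n j
    using that
  proof (induction n arbitrary: j)
    case 0
    have "- c * w j \<le> - c * (1 / r)"
      using mult_left_mono[OF w(1)[OF 0] c] by simp
    also have "\<dots> = - \<bar>B\<bar>" using l by (simp add: c_def)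
    also have "\<dots> \<le> k j" using B[OF 0] by simp
    finally show ?case by simp
  next
    case (Suc n)
    have cw: "0 \<le> c * \<rho> ^ Suc n * w j"
      using c \<rho> w(1)[OF Suc.prems] l by (intro mult_nonneg_nonneg zero_le_power order_trans[OF _ w(1)[OF Suc.prems]]) auto
    show ?case
    proof (cases "j \<in> F")
      case True
      then show ?thesis using pos[OF True] cw by simp
    next
      case False
      obtain x where x: "((\<lambda>i. Q r j i * k i) has_sum x) S" "x \<le> k j"
        using super[OF Suc.prems False] by auto
      have "((\<lambda>i. - c * \<rho> ^ n * (Q r j i * w i)) has_sum (- c * \<rho> ^ n * u j)) S"
        by (intro has_sum_cmult_right Qw Suc.prems)
      then have "- c * \<rho> ^ n * u j \<le> x"
      proof (rule has_sum_mono[OF _ x(1)])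
        fix i assume "i \<in> S"
        then have "Q r j i * (- c * \<rho> ^ n * w i) \<le> Q r j i * k i"
          by (intro mult_left_mono Suc.IH Q_nonneg l Suc.prems)
        then show "- c * \<rho> ^ n * (Q r j i * w i) \<le> Q r j i * k i"
          by (simp add: algebra_simps)
      qed
      moreover have "c * \<rho> ^ n * u j \<le> c * \<rho> ^ n * (\<rho> * w j)"
        using c \<rho> by (intro mult_left_mono w(2) Suc.prems) auto
      ultimately show ?thesis using x(2) by (simp add: algebra_simps)
    qed
  qed
  have "(\<lambda>n. - c * \<rho> ^ n * w i) \<longlonglongrightarrow> - c * 0 * w i"
    using \<rho> by (intro tendsto_intros LIMSEQ_realpow_zero) auto
  then show ?thesis
    using step[OF i] by (intro LIMSEQ_le_const2[of _ "- c * 0 * w i" "k i", simplified]) auto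
qed

text \<open>For \<open>g = U v\<close> with \<open>v\<close> carried by \<open>F\<close>, the
  resolvent equations of the columns add up to \<open>g - Q g = Q v / r\<close>. Both maximum
  principles rest on this identity.\<close>

lemma potential_upper:
  assumes F: "finite F" "F \<subseteq> S" and l: "0 < r" and j: "j \<in> S"
  shows "((\<lambda>i. Q r j i * (\<Sum>k\<in>F. v k * U i k)) has_sum
    ((\<Sum>k\<in>F. v k * U j k) - (\<Sum>k\<in>F. Q r j k * v k) / r)) S"
proof -
  have "((\<lambda>i. \<Sum>k\<in>F. v k * (Q r j i * U i k)) has_sum (\<Sum>k\<in>F. v k * (U j k - Q r j k / r))) S"
    using F j by (intro has_sum_sum has_sum_cmult_right resolvent_eq l) auto
  moreover have "(\<Sum>k\<in>F. v k * (U j k - Q r j k / r)) =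
      (\<Sum>k\<in>F. v k * U j k) - (\<Sum>k\<in>F. Q r j k * v k) / r"
    by (simp add: sum_subtractf right_diff_distrib sum_divide_distrib mult.commute)
  ultimately show ?thesis by (simp add: sum_distrib_left mult.left_commute)
qed

text \<open>Apply the comparison lemma to \<open>m + V / r - (g + v / r)\<close>, where \<open>g + v / r\<close> solves
  \<open>x = v / r + Q x\<close>, and let \<open>r\<close> tend to infinity.\<close>

lemma maximum_principle:
  assumes F: "finite F" "F \<subseteq> S" and m: "0 \<le> m"
    and le: "\<And>j. j \<in> F \<Longrightarrow> (\<Sum>k\<in>F. v k * U j k) \<le> m" and j: "j \<in> S"
  shows "(\<Sum>k\<in>F. v k * U j k) \<le> m"
proof -
  define g where "g j = (\<Sum>k\<in>F. v k * U j k)" for j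
  define V where "V = (\<Sum>k\<in>F. \<bar>v k\<bar>)"
  have V: "v i \<le> V" if "i \<in> F" for i
    using member_le_sum[of i F "\<lambda>k. \<bar>v k\<bar>"] that F by (force simp: V_def)
  have V0: "0 \<le> V" by (simp add: V_def sum_nonneg)
  \<comment> \<open>\<open>comparison\<close> asks for a lower bound on its function, hence for an
    upper bound on \<open>g\<close>; an entry of \<open>U\<close> is at most its row sum.\<close>
  have gC: "g i \<le> V * C" if i: "i \<in> S" for i
  proof -
    have "U i k \<le> C" if "k \<in> F" for k
    proof -
      have "sum (U i) {k} \<le> infsum (U i) S"
        using that F i by (intro finite_sum_le_infsum U_summable U_nonneg) auto
      then show ?thesis using U_row_bound[OF i] by simp
    qed
    moreover have "0 \<le> U i k" if "k \<in> F" for k using U_nonneg[OF i] that F by auto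
    ultimately have "v k * U i k \<le> \<bar>v k\<bar> * C" if "k \<in> F" for k
      using that by (intro mult_mono) auto
    then show ?thesis unfolding g_def V_def sum_distrib_right by (intro sum_mono)
  qed
  have bound: "g j \<le> m + V / r" if l: "0 < r" "j \<notin> F" for r
  proof -
    \<comment> \<open>On \<open>F\<close> the slack \<open>V / r\<close> absorbs the added
      \<open>v / r\<close>. Off \<open>F\<close> the terms with \<open>Q v / r\<close> cancel, and
      \<open>Q h \<le> h\<close> follows from row sums of \<open>Q\<close> being at most 1.\<close>
    define h where "h i = m + V / r - g i - (if i \<in> F then v i / r else 0)" for i
    have "0 \<le> h j"
    proof (rule comparison[OF l(1), where B = "V * C" and F = F])
      show "0 \<le> h i" if "i \<in> F" for i
        using le[OF that] V[OF that] l(1) that divide_right_mono[of "v i" V r]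
        by (simp add: h_def g_def)
      show "- (V * C) \<le> h i" if "i \<in> S" for i
      proof (cases "i \<in> F")
        case True
        then have "v i / r \<le> V / r" using V l by (intro divide_right_mono) auto
        then show ?thesis using gC[OF that] m True by (simp add: h_def)
      next
        case False
        moreover have "0 \<le> V / r" using V0 l by simp
          ultimately show ?thesis using gC[OF that] m by (simp add: h_def)
      qed
    next
      fix i assume i: "i \<in> S" "i \<notin> F"
      let ?q = "infsum (Q r i) S"
      have "((\<lambda>k. Q r i k * (if k \<in> F then v k / r else 0)) has_sum (\<Sum>k\<in>F. Q r i k * (v k / r))) S"
        using F by (intro has_sum_finite_neutralI) auto
      then have s: "((\<lambda>k. Q r i k * (m + V / r) - Q r i k * g k - Q r i k * (if k \<in> F then v k / r else 0))
          has_sum (?q * (m + V / r) - (g i - (\<Sum>k\<in>F. Q r i k * v k) / r) - (\<Sum>k\<in>F. Q r i k * (v k / r)))) S"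
        unfolding g_def using F l i
        by (intro has_sum_diff has_sum_cmult_left potential_upper has_sum_infsum Q_summable) auto
      have e: "?q * (m + V / r) - (g i - (\<Sum>k\<in>F. Q r i k * v k) / r) - (\<Sum>k\<in>F. Q r i k * (v k / r))
          = ?q * (m + V / r) - g i"
        by (simp add: sum_divide_distrib)
      have "?q * (m + V / r) \<le> 1 * (m + V / r)"
        using m V0 l i by (intro mult_right_mono Q_row_bound) auto
      then show "\<exists>x. ((\<lambda>k. Q r i k * h k) has_sum x) S \<and> x \<le> h i"
        using s i unfolding e
        by (intro exI[of _ "?q * (m + V / r) - g i"]) (simp add: h_def algebra_simps)
    qed (use j in auto)
    then show ?thesis using l by (simp add: h_def)
  qed
  show ?thesis
  proof (cases "j \<in> F")
    case False
    have "((\<lambda>r. m + V / r) \<longlongrightarrow> m + 0) at_top"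
      by (intro tendsto_intros tendsto_divide_0[OF tendsto_const] filterlim_at_top_imp_at_infinity filterlim_ident)
    then have "g j \<le> m + 0"
      using bound False
      by (intro tendsto_lowerbound) (auto intro!: eventually_mono[OF eventually_gt_at_top[of 0]])
    then show ?thesis by (simp add: g_def)
  qed (rule le)
qed

text \<open>\<open>r (g - Q g) (i) = Q v (i)\<close> is nonnegative at a maximum of \<open>g\<close> and tends to \<open>v i\<close>.\<close>

lemma complete_maximum_principle:
  assumes F: "finite F" "F \<subseteq> S" and i: "i \<in> F"
    and pos: "0 \<le> (\<Sum>k\<in>F. v k * U i k)"
    and max: "\<And>j. j \<in> F \<Longrightarrow> (\<Sum>k\<in>F. v k * U j k) \<le> (\<Sum>k\<in>F. v k * U i k)"
  shows "0 \<le> v i"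
proof -
  define g where "g j = (\<Sum>k\<in>F. v k * U j k)" for j
  have iS: "i \<in> S" using F i by auto
  \<comment> \<open>A maximum over \<open>F\<close> is a maximum over \<open>S\<close>: the
    preceding principle with \<open>m\<close> equal to the value at \<open>i\<close>.\<close>
  have gi: "g j \<le> g i" if "j \<in> S" for j
    unfolding g_def by (rule maximum_principle[OF F pos max that])
  have "0 \<le> (\<Sum>k\<in>F. Q r i k * v k)" if l: "0 < r" for r
  proof -
    have "((\<lambda>k. Q r i k * g k) has_sum (g i - (\<Sum>k\<in>F. Q r i k * v k) / r)) S"
      unfolding g_def by (rule potential_upper[OF F l iS])
    moreover have "((\<lambda>k. Q r i k * g i) has_sum (infsum (Q r i) S * g i)) S"
      by (intro has_sum_cmult_left has_sum_infsum Q_summable l iS)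
    ultimately have "g i - (\<Sum>k\<in>F. Q r i k * v k) / r \<le> infsum (Q r i) S * g i"
      by (rule has_sum_mono) (intro mult_left_mono gi Q_nonneg l iS)
    \<comment> \<open>The rows of \<open>Q\<close> may have mass below 1, hence the assumption that
      the maximal value is nonnegative.\<close>
    also have "\<dots> \<le> 1 * g i"
      using pos by (intro mult_right_mono Q_row_bound l iS) (simp add: g_def)
    finally show ?thesis using l by (simp add: field_simps)
  qed
  moreover have "(\<lambda>n. \<Sum>k\<in>F. Q (real n) i k * v k) \<longlonglongrightarrow> (\<Sum>k\<in>F. of_bool (i = k) * v k)"
    using F iS by (intro tendsto_intros Q_limit) auto
  moreover have "(\<Sum>k\<in>F. of_bool (i = k) * v k) = v i"
    using F i by (simp add: of_bool_def if_distrib[of "\<lambda>x. x * _"] cong: if_cong)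
  ultimately show ?thesis
    by (intro tendsto_lowerbound[of _ "v i" sequentially 0]) (auto intro!: eventually_mono[OF eventually_gt_at_top[of 0]])
qed

end

section \<open>Inverses of potential matrices\<close>

text \<open>Plain functions of indices instead of matrices, so that sections
  \<open>K (i p) (i q)\<close> can be formed freely. The right inverse makes columns of
  \<open>A\<close> solutions of linear systems; the left inverse turns \<open>A (I + K S)\<close>
  into \<open>A + S\<close>.\<close>

definition inverse_kernels :: "nat \<Rightarrow> (nat \<Rightarrow> nat \<Rightarrow> real) \<Rightarrow> (nat \<Rightarrow> nat \<Rightarrow> real) \<Rightarrow> bool"
  where "inverse_kernels n K A \<longleftrightarrow> (\<forall>p<n. \<forall>q<n. (\<Sum>l<n. A p l * K l q) = of_bool (p = q) \<and>
    (\<Sum>l<n. K p l * A l q) = of_bool (p = q))"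

lemma inverse_kernelsD:
  assumes "inverse_kernels n K A" "p < n" "q < n"
  shows "(\<Sum>l<n. A p l * K l q) = of_bool (p = q)" "(\<Sum>l<n. K p l * A l q) = of_bool (p = q)"
  using assms by (auto simp: inverse_kernels_def)

lemma injective_imp_inverse_kernels:
  fixes K :: "nat \<Rightarrow> nat \<Rightarrow> real"
  assumes inj: "\<And>v p. (\<And>p. p < n \<Longrightarrow> (\<Sum>q<n. K p q * v q) = 0) \<Longrightarrow> p < n \<Longrightarrow> v p = 0"
  obtains A where "inverse_kernels n K A"
proof -
  define M where "M = Matrix.mat n n (\<lambda>(p, q). K p q)"
  have M: "M \<in> carrier_mat n n" by (simp add: M_def)
  have "Determinant.det M \<noteq> 0"
  proof
    assume "Determinant.det M = 0"
    then obtain w where w: "w \<in> carrier_vec n" "w \<noteq> 0\<^sub>v n" "M *\<^sub>v w = 0\<^sub>v n"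
      using det_0_iff_vec_prod_zero[OF M] by auto
    have "(\<Sum>q<n. K p q * vec_index w q) = 0" if "p < n" for p
    proof -
      have "vec_index (M *\<^sub>v w) p = 0" using w(3) that by simp
      then show ?thesis using that w(1)
        by (simp add: M_def scalar_prod_def atLeast0LessThan)
    qed
    from inj[of "vec_index w", OF this] have "w = 0\<^sub>v n" using w(1) by auto
    with w(2) show False by simp
  qed
  then have "M \<in> Units (ring_mat TYPE(real) n ())" using det_non_zero_imp_unit[OF M] by simp
  then obtain B where B: "B \<in> carrier_mat n n" "B * M = 1\<^sub>m n" "M * B = 1\<^sub>m n"
    by (auto simp: Units_def ring_mat_def)
  show ?thesis
  proof (rule that[of "\<lambda>p q. B $$ (p, q)"], unfold inverse_kernels_def, intro allI impI conjI)
    fix p q assume pq: "p < n" "q < n"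
    have "(B * M) $$ (p, q) = of_bool (p = q)" "(M * B) $$ (p, q) = of_bool (p = q)"
      using B(2,3) pq by simp_all
    then show "(\<Sum>l<n. B $$ (p, l) * K l q) = of_bool (p = q)" "(\<Sum>l<n. K p l * B $$ (l, q)) = of_bool (p = q)"
      using pq B(1) by (simp_all add: M_def scalar_prod_def atLeast0LessThan)
  qed
qed

text \<open>The Sherman--Morrison formula.\<close>

lemma rank_one_inverse:
  fixes K A :: "nat \<Rightarrow> nat \<Rightarrow> real" and f :: "nat \<Rightarrow> real"
  assumes inv: "inverse_kernels n K A"
    and row: "\<And>p. p < n \<Longrightarrow> 0 \<le> (\<Sum>q<n. A p q)"
    and f: "\<And>q. q < n \<Longrightarrow> 0 \<le> (\<Sum>l<n. f l * A l q)"
  obtains A' where "inverse_kernels n (\<lambda>p q. K p q + f q) A'" "\<And>p q. p < n \<Longrightarrow> q < n \<Longrightarrow> A' p q \<le> A p q"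
proof -
  \<comment> \<open>\<open>r\<close>, \<open>c\<close> and \<open>d\<close> are \<open>A 1\<close>,
    \<open>f A\<close> and \<open>1 + f A 1\<close>. The entries of \<open>c\<close> add up to
    \<open>d - 1\<close>, so their nonnegativity keeps the denominator at least 1.\<close>
  define r where "r p = (\<Sum>q<n. A p q)" for p
  define c where "c q = (\<Sum>l<n. f l * A l q)" for q
  define d where "d = 1 + (\<Sum>l<n. f l * r l)"
  have sc: "(\<Sum>q<n. c q) = d - 1"
    unfolding c_def d_def r_def by (subst sum.swap) (simp add: sum_distrib_left)
  have "0 \<le> (\<Sum>q<n. c q)" using f by (intro sum_nonneg) (simp add: c_def)
  with sc have d: "1 \<le> d" by simp
  have cK: "(\<Sum>l<n. c l * K l q) = f q" if "q < n" for q
  proof -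
    have "(\<Sum>l<n. c l * K l q) = (\<Sum>m<n. f m * (\<Sum>l<n. A m l * K l q))"
      unfolding c_def sum_distrib_right sum_distrib_left by (subst sum.swap) (simp add: mult.assoc)
    also have "\<dots> = (\<Sum>m<n. f m * of_bool (m = q))"
      by (intro sum.cong refl) (simp add: inverse_kernelsD(1)[OF inv _ that])
    also have "\<dots> = f q" using that by (simp add: of_bool_def if_distrib[of "(*) _"] cong: if_cong)
    finally show ?thesis .
  qed
  have Kr: "(\<Sum>l<n. K p l * r l) = 1" if "p < n" for p
  proof -
    have "(\<Sum>l<n. K p l * r l) = (\<Sum>m<n. \<Sum>l<n. K p l * A l m)"
      unfolding r_def sum_distrib_left by (subst sum.swap) simp
    also have "\<dots> = (\<Sum>m<n. of_bool (p = m))"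
      by (intro sum.cong refl) (simp add: inverse_kernelsD(2)[OF inv that])
    also have "\<dots> = 1" using that by (simp add: of_bool_def)
    finally show ?thesis .
  qed
  define A' where "A' p q = A p q - r p * c q / d" for p q
  have "inverse_kernels n (\<lambda>p q. K p q + f q) A'"
    unfolding inverse_kernels_def
  proof (intro allI impI conjI)
    fix p q assume pq: "p < n" "q < n"
    have "(\<Sum>l<n. A' p l * (K l q + f q)) = (\<Sum>l<n. A p l * K l q + A p l * f q -
        (r p / d * (c l * K l q) + r p / d * (c l * f q)))"
      by (intro sum.cong refl) (simp add: A'_def algebra_simps add_divide_distrib)
    also have "\<dots> = (\<Sum>l<n. A p l * K l q) + r p * f q - r p / d * ((\<Sum>l<n. c l * K l q) + (\<Sum>l<n. c l) * f q)"
      by (simp only: sum.distrib sum_subtractf sum_distrib_left[symmetric] sum_distrib_right[symmetric] distrib_left r_def)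
    also have "\<dots> = of_bool (p = q)"
      unfolding inverse_kernelsD(1)[OF inv pq] cK[OF pq(2)] sc using d by (simp add: field_simps)
    finally show "(\<Sum>l<n. A' p l * (K l q + f q)) = of_bool (p = q)" .
    have "(\<Sum>l<n. (K p l + f l) * A' l q) = (\<Sum>l<n. K p l * A l q + f l * A l q -
        (c q / d * (K p l * r l) + c q / d * (f l * r l)))"
      by (intro sum.cong refl) (simp add: A'_def algebra_simps add_divide_distrib)
    also have "\<dots> = (\<Sum>l<n. K p l * A l q) + c q - c q / d * ((\<Sum>l<n. K p l * r l) + (\<Sum>l<n. f l * r l))"
      by (simp only: sum.distrib sum_subtractf sum_distrib_left[symmetric] sum_distrib_right[symmetric] distrib_left c_def)
    also have "\<dots> = of_bool (p = q)"
      unfolding inverse_kernelsD(2)[OF inv pq] Kr[OF pq(1)] d_def[symmetric] using d by simp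
    finally show "(\<Sum>l<n. (K p l + f l) * A' l q) = of_bool (p = q)" .
  qed
  moreover have "A' p q \<le> A p q" if "p < n" "q < n" for p q
    using row[OF that(1)] f[OF that(2)] d by (simp add: A'_def r_def c_def)
  ultimately show ?thesis by (rule that)
qed

context potential_kernel
begin

text \<open>Each sign is a maximum principle for a vector whose potential on the section is known.
  Minus the \<open>q\<close>-th column of \<open>A\<close> has potential 0 at
  \<open>p \<noteq> q\<close>, which is its maximum there, so its \<open>p\<close>-th entry is
  nonnegative. The row sums form a vector with potential 1 on the section. For the last claim, a
  potential that is nonnegative on the section is nonnegative at every state.\<close>

lemma potential_inverse:
  assumes i: "inj_on i {..<n}" "i ` {..<n} \<subseteq> S"
  obtains A where "inverse_kernels n (\<lambda>p q. U (i p) (i q)) A"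
    "\<And>p q. p < n \<Longrightarrow> q < n \<Longrightarrow> p \<noteq> q \<Longrightarrow> A p q \<le> 0"
    "\<And>p. p < n \<Longrightarrow> 0 \<le> (\<Sum>q<n. A p q)"
    "\<And>j q. j \<in> S \<Longrightarrow> q < n \<Longrightarrow> 0 \<le> (\<Sum>l<n. U j (i l) * A l q)"
proof -
  \<comment> \<open>Coefficients indexed by positions become coefficients indexed by states, as the
    maximum principles speak of finite sets of states.\<close>
  define v' where "v' v k = v (inv_into {..<n} i k)" for v :: "nat \<Rightarrow> real" and k
  have v': "v' v (i p) = v p" if "p < n" for v p
    using i(1) that by (simp add: v'_def)
  have F: "finite (i ` {..<n})" "i ` {..<n} \<subseteq> S" using i by auto
  have sum: "(\<Sum>k\<in>i ` {..<n}. v' v k * U j k) = (\<Sum>q<n. U j (i q) * v q)" for v j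
    using i(1) by (simp add: sum.reindex v' mult.commute)
  have cmp: "0 \<le> v p" if p: "p < n" "0 \<le> (\<Sum>q<n. U (i p) (i q) * v q)"
    and r: "\<And>r. r < n \<Longrightarrow> (\<Sum>q<n. U (i r) (i q) * v q) \<le> (\<Sum>q<n. U (i p) (i q) * v q)" for v p
  proof -
    have "0 \<le> v' v (i p)"
      by (rule complete_maximum_principle[OF F], unfold sum) (use p r in auto)
    then show ?thesis by (simp add: v' p)
  qed
  have mp: "0 \<le> (\<Sum>q<n. U j (i q) * v q)" if j: "j \<in> S"
    and r: "\<And>r. r < n \<Longrightarrow> 0 \<le> (\<Sum>q<n. U (i r) (i q) * v q)" for v j
  proof -
    have "(\<Sum>k\<in>i ` {..<n}. v' (\<lambda>q. - v q) k * U j k) \<le> 0"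
      by (rule maximum_principle[OF F order_refl _ j], unfold sum) (use r in \<open>auto simp: sum_negf\<close>)
    then show ?thesis unfolding sum by (simp add: sum_negf)
  qed
  \<comment> \<open>A zero potential is maximal at every index, and so is its negative; both signs
    of \<open>v p\<close> follow.\<close>
  have "v p = 0" if "\<And>p. p < n \<Longrightarrow> (\<Sum>q<n. U (i p) (i q) * v q) = 0" "p < n" for v p
    using cmp[of p v] cmp[of p "\<lambda>q. - v q"] that by (simp add: sum_negf)
  then obtain A where A: "inverse_kernels n (\<lambda>p q. U (i p) (i q)) A"
    by (rule injective_imp_inverse_kernels[of n "\<lambda>p q. U (i p) (i q)"])
  note Ar = inverse_kernelsD(2)[OF A]
  show ?thesis
  proof (rule that[OF A])
    fix p q assume pq: "p < n" "q < n" "p \<noteq> q"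
    show "A p q \<le> 0"
      using cmp[of p "\<lambda>l. - A l q"] pq by (auto simp: sum_negf Ar)
  next
    fix p assume p: "p < n"
    have "(\<Sum>q<n. U (i r) (i q) * (\<Sum>m<n. A q m)) = 1" if "r < n" for r
    proof -
      have "(\<Sum>q<n. U (i r) (i q) * (\<Sum>m<n. A q m)) = (\<Sum>m<n. \<Sum>q<n. U (i r) (i q) * A q m)"
        unfolding sum_distrib_left by (rule sum.swap)
      also have "\<dots> = (\<Sum>m<n. of_bool (r = m))" using that by (intro sum.cong refl) (simp add: Ar)
      finally show ?thesis using that by (simp add: of_bool_def)
    qed
    then show "0 \<le> (\<Sum>q<n. A p q)" using cmp[of p "\<lambda>q. \<Sum>m<n. A q m"] p by auto
  next
    fix j q assume jq: "j \<in> S" "q < n"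
    show "0 \<le> (\<Sum>l<n. U j (i l) * A l q)" by (rule mp[OF jq(1)]) (simp add: Ar jq)
  qed
qed

end

section \<open>The resolvent of a Borel right process\<close>

lemma has_sum_of_nn_integral_count_space:
  fixes f :: "'a \<Rightarrow> real"
  assumes f: "\<And>x. x \<in> S \<Longrightarrow> 0 \<le> f x" and c: "0 \<le> c"
    and eq: "(\<integral>\<^sup>+x. ennreal (f x) \<partial>count_space S) = ennreal c"
  shows "(f has_sum c) S"
proof -
  have i: "integrable (count_space S) f"
    using f eq by (intro integrableI_nonneg) (auto simp: AE_count_space)
  then have "integral\<^sup>L (count_space S) f = c"
    using f c eq by (intro integral_eq_nn_integral[THEN trans]) (auto simp: AE_count_space)
  moreover have abs: "Infinite_Set_Sum.abs_summable_on f S"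
    using i by (simp add: abs_summable_on_def)
  ultimately have "infsum f S = c"
    using infsetsum_infsum[OF abs] by (simp add: infsetsum_def)
  moreover have "f summable_on S"
    using abs abs_summable_equivalent abs_summable_summable by blast
  ultimately show ?thesis by (metis has_sum_infsum)
qed

lemma nn_integral_exp_Icc:
  fixes r v :: real
  assumes r: "0 < r" and v: "0 \<le> v"
  shows "(\<integral>\<^sup>+s. ennreal (exp (- (r * s))) * indicator {0..v} s \<partial>lborel) = ennreal ((1 - exp (- (r * v))) / r)"
proof -
  have "(\<integral>\<^sup>+s. ennreal (exp (- (r * s))) * indicator {0..v} s \<partial>lborel) =
      ennreal (- exp (- (r * v)) / r - (- exp (- (r * 0)) / r))"
    using r v by (intro nn_integral_FTC_Icc[where F = "\<lambda>s. - exp (- (r * s)) / r"])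
      (auto intro!: derivative_eq_intros)
  then show ?thesis using r by (simp add: diff_divide_distrib)
qed

lemma nn_integral_exp_Ici:
  fixes r :: real
  assumes r: "0 < r"
  shows "(\<integral>\<^sup>+s. ennreal (exp (- (r * s))) * indicator {0..} s \<partial>lborel) = ennreal (1 / r)"
proof -
  have "(\<integral>\<^sup>+s. ennreal (exp (- (r * s))) * indicator {0..} s \<partial>lborel) =
      ennreal (0 - (- exp (- (r * 0)) / r))"
  proof (intro nn_integral_FTC_atLeast[where F = "\<lambda>s. - exp (- (r * s)) / r"])
    have "filterlim (\<lambda>s. r * s) at_top at_top"
      using r by (intro filterlim_tendsto_pos_mult_at_top[OF tendsto_const] filterlim_ident)
    then have "((\<lambda>s. exp (- (r * s))) \<longlongrightarrow> 0) at_top"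
      by (intro filterlim_compose[OF exp_at_bot]) (simp add: filterlim_uminus_at_bot)
    from tendsto_divide[OF tendsto_minus[OF this] tendsto_const[of r]]
    show "((\<lambda>s. - exp (- (r * s)) / r) \<longlongrightarrow> 0) at_top" using r by simp
  qed (use r in \<open>auto intro!: derivative_eq_intros\<close>)
  then show ?thesis by simp
qed

section \<open>Transition probabilities and the resolvent equation\<close>

context borel_right_process
begin

lemma space_P: "1 \<le> j \<Longrightarrow> space (P j) = \<Omega>"
  using subalgebra_F[of j] space_F[of \<infinity>] by (auto simp: subalgebra_def)

lemma sets_F_subset_P: "1 \<le> j \<Longrightarrow> sets (F t) \<subseteq> sets (P j)"
  using subalgebra_F[of j] sets_F_mono[of t \<infinity>] by (auto simp: subalgebra_def)

lemma event_in_F: "0 \<le> t \<Longrightarrow> {w \<in> \<Omega>. X t w = k} \<in> sets (F (ennreal t))"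
  using measurable_sets[OF adapted[of t], of "{k}"] space_F[of "ennreal t"]
  by (simp add: vimage_def Int_def conj_commute)

lemma event_in_P: "1 \<le> j \<Longrightarrow> 0 \<le> t \<Longrightarrow> {w \<in> \<Omega>. X t w = k} \<in> sets (P j)"
  using event_in_F sets_F_subset_P by blast

abbreviation (input) "p \<equiv> transition_function P X"

lemma emeasure_event:
  assumes "1 \<le> j"
  shows "emeasure (P j) {w \<in> \<Omega>. X t w = k} = ennreal (p t j k)"
proof -
  interpret prob_space "P j" by (rule prob_space_P[OF assms])
  show ?thesis by (simp add: transition_function_def space_P[OF assms] emeasure_eq_measure)
qed

lemma transition_function_eq: "1 \<le> j \<Longrightarrow> p t j k = measure (P j) {w \<in> \<Omega>. X t w = k}"
  by (simp add: transition_function_def space_P[of j])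

lemma transition_function_le_1: "1 \<le> j \<Longrightarrow> p t j k \<le> 1"
  unfolding transition_function_def by (rule prob_space.prob_le_1[OF prob_space_P])

lemma transition_function_nonneg: "0 \<le> p t j k"
  by (simp add: transition_function_def)

lemma sub_markov:
  assumes j: "1 \<le> j" and t: "0 \<le> t"
  shows "(\<integral>\<^sup>+k. ennreal (p t j k) \<partial>count_space {1..}) \<le> 1"
proof -
  interpret prob_space "P j" by (rule prob_space_P[OF j])
  have "(\<integral>\<^sup>+k. emeasure (P j) {w \<in> \<Omega>. X t w = k} \<partial>count_space {1..}) =
      emeasure (P j) (\<Union>k\<in>{1..}. {w \<in> \<Omega>. X t w = k})"
    by (intro emeasure_UN_countable[symmetric] event_in_P j t) (auto simp: disjoint_family_on_def)
  also have "\<dots> \<le> 1" by (rule emeasure_le_1)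
  finally show ?thesis by (simp add: emeasure_event[OF j])
qed

text \<open>The strong Markov property at the constant time \<open>t\<close>, integrated over the
  event that the process is at \<open>i\<close> at that time and summed over the states
  \<open>i\<close>.\<close>

lemma chapman_kolmogorov:
  assumes j: "1 \<le> j" and k: "1 \<le> k" and s: "0 \<le> s" and t: "0 \<le> t"
  shows "(\<integral>\<^sup>+i. ennreal (p t j i) * ennreal (p s i k) \<partial>count_space {1..}) = ennreal (p (t + s) j k)"
proof -
  interpret prob_space "P j" by (rule prob_space_P[OF j])
  let ?T = "\<lambda>_ :: 'w. ennreal t"
  let ?E = "\<lambda>i. {w \<in> \<Omega>. X t w = i}"
  let ?B = "{w \<in> \<Omega>. X (t + s) w = k}"
  have T: "stopping_time F ?T" by (rule stopping_time_const)
  have sub: "subalgebra (P j) (pre_sigma ?T)"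
    unfolding subalgebra_def
  proof
    show "sets (pre_sigma ?T) \<subseteq> sets (P j)"
    proof
      fix A assume "A \<in> sets (pre_sigma ?T)"
      then have "{w \<in> A. ?T w \<le> ennreal t} \<in> sets (F (ennreal t))" by (rule sets_pre_sigmaD[OF T])
      then show "A \<in> sets (P j)" using sets_F_subset_P[OF j] by auto
    qed
  qed (simp add: space_pre_sigma space_P[OF j])
  interpret fms: finite_measure_subalgebra "P j" "pre_sigma ?T" by unfold_locales (rule sub)
  have E: "?E i \<in> sets (pre_sigma ?T)" for i
  proof (rule sets_pre_sigmaI[OF T])
    fix u
    show "{w \<in> ?E i. ?T w \<le> u} \<in> sets (F u)"
      using event_in_F[OF t, of i] sets_F_mono[of "ennreal t" u] by (cases "ennreal t \<le> u") auto
  qed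
  have B: "?B \<in> sets (P j)" by (rule event_in_P) (use j s t in auto)
  have AE: "AE w in P j. X t w \<noteq> 0 \<longrightarrow>
      real_cond_exp (P j) (pre_sigma ?T) (indicator ?B) w = p s (X t w) k"
    using strong_markov[OF j k s T] t by simp
  have int: "integrable (P j) (indicator ?B :: _ \<Rightarrow> real)"
    by (intro integrable_real_indicator B) (simp add: emeasure_eq_measure)
  have eq: "emeasure (P j) (?B \<inter> ?E i) = ennreal (p t j i) * ennreal (p s i k)" if i: "1 \<le> i" for i
  proof -
    have "measure (P j) (?B \<inter> ?E i) = (\<integral>w\<in>?E i. indicator ?B w \<partial>P j)"
      using B event_in_P[OF j t, of i]
      by (simp add: set_lebesgue_integral_def indicator_inter_arith[symmetric] Int_commute)
    also have "\<dots> = (\<integral>w\<in>?E i. real_cond_exp (P j) (pre_sigma ?T) (indicator ?B) w \<partial>P j)"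
      by (rule fms.real_cond_exp_intA[OF int E])
    also have "\<dots> = (\<integral>w\<in>?E i. p s i k \<partial>P j)"
      unfolding set_lebesgue_integral_def
    proof (rule integral_cong_AE)
      show "AE w in P j. indicat_real (?E i) w *\<^sub>R real_cond_exp (P j) (pre_sigma ?T) (indicator ?B) w =
          indicat_real (?E i) w *\<^sub>R p s i k"
        using AE by eventually_elim (use i in \<open>auto split: split_indicator\<close>)
    qed (use event_in_P[OF j t, of i] in measurable)
    also have "\<dots> = p t j i * p s i k"
      using sets.Int_space_eq2[OF event_in_P[OF j t, of i]]
      by (simp add: set_lebesgue_integral_def transition_function_def space_P[OF j])
    finally show ?thesis
      by (simp add: emeasure_eq_measure ennreal_mult transition_function_nonneg)
  qed
  \<comment> \<open>The cemetery is absorbing: a path that is at the state \<open>k\<close> at time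
    \<open>t + s\<close> was at a state at time \<open>t\<close>.\<close>
  have "?B = (\<Union>i\<in>{1..}. ?B \<inter> ?E i)"
  proof (intro Set.set_eqI iffI)
    fix w assume w: "w \<in> ?B"
    have "X t w \<noteq> 0"
      using cemetery_absorbing[of w t "t + s"] w k s t by auto
    then show "w \<in> (\<Union>i\<in>{1..}. ?B \<inter> ?E i)" using w by auto
  qed auto
  then have "ennreal (p (t + s) j k) = emeasure (P j) (\<Union>i\<in>{1..}. ?B \<inter> ?E i)"
    using emeasure_event[OF j, of "t + s" k] by simp
  also have "\<dots> = (\<integral>\<^sup>+i. emeasure (P j) (?B \<inter> ?E i) \<partial>count_space {1..})"
    using B event_in_P[OF j t] by (intro emeasure_UN_countable) (auto simp: disjoint_family_on_def)
  also have "\<dots> = (\<integral>\<^sup>+i. ennreal (p t j i) * ennreal (p s i k) \<partial>count_space {1..})"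
    by (intro nn_integral_cong) (simp add: eq)
  finally show ?thesis by simp
qed

text \<open>In a discrete space a right-continuous path is constant on some interval after
  \<open>t\<close>, so the indicators converge pointwise and dominated convergence applies. The
  approximating times may equal \<open>t\<close>.\<close>

lemma transition_function_right_continuous:
  assumes j: "1 \<le> j" and t: "0 \<le> t" and ge: "\<And>n. t \<le> \<tau> n" and lim: "\<tau> \<longlonglongrightarrow> t"
  shows "(\<lambda>n. p (\<tau> n) j k) \<longlonglongrightarrow> p t j k"
proof -
  let ?ind = "\<lambda>t. indicat_real {w \<in> \<Omega>. X t w = k}"
  interpret prob_space "P j" by (rule prob_space_P[OF j])
  have m: "{w \<in> \<Omega>. X (\<tau> n) w = k} \<in> sets (P j)" for n
    using ge[of n] t by (intro event_in_P j) auto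
  have "(\<lambda>n. integral\<^sup>L (P j) (?ind (\<tau> n))) \<longlonglongrightarrow>
      integral\<^sup>L (P j) (?ind t)"
  proof (rule integral_dominated_convergence[where w = "\<lambda>_. 1"])
    show "AE w in P j. (\<lambda>n. ?ind (\<tau> n) w) \<longlonglongrightarrow> ?ind t w"
    proof (rule AE_I2)
      fix w assume "w \<in> space (P j)"
      then have w: "w \<in> \<Omega>" by (simp add: space_P[OF j])
      have "((\<lambda>r. X r w) \<longlongrightarrow> X t w) (at_right t)"
        using right_continuous[OF w t] by (simp add: continuous_within)
      then have "eventually (\<lambda>r. X r w = X t w) (at_right t)"
        by (simp add: tendsto_discrete)
      then obtain b where b: "t < b" "\<And>r. t < r \<Longrightarrow> r < b \<Longrightarrow> X r w = X t w"
        unfolding eventually_at_right_field by blast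
      have "eventually (\<lambda>n. \<tau> n < b) sequentially"
        using lim b(1) by (rule order_tendstoD)
      then have "eventually (\<lambda>n. X (\<tau> n) w = X t w) sequentially"
      proof eventually_elim
        case (elim n)
        then show ?case using b(2)[of "\<tau> n"] ge[of n] by (cases "\<tau> n = t") auto
      qed
      then have "eventually (\<lambda>n. ?ind (\<tau> n) w = ?ind t w) sequentially"
        by eventually_elim (simp add: indicator_def)
      then show "(\<lambda>n. ?ind (\<tau> n) w) \<longlonglongrightarrow> ?ind t w"
        by (rule tendsto_eventually)
    qed
  qed (use m event_in_P[OF j t, of k] in auto)
  moreover have "integral\<^sup>L (P j) (?ind r) = p r j k" for r
  proof -
    have "{w \<in> \<Omega>. X r w = k} \<inter> space (P j) = {w \<in> \<Omega>. X r w = k}" by (auto simp: space_P[OF j])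
    then show ?thesis by (simp add: transition_function_eq[OF j])
  qed
  ultimately show ?thesis by simp
qed

lemma transition_function_0:
  assumes j: "1 \<le> j"
  shows "p 0 j k = of_bool (j = k)"
proof -
  interpret prob_space "P j" by (rule prob_space_P[OF j])
  show ?thesis
  proof (cases "j = k")
    case True
    have "AE w in P j. w \<in> {w \<in> \<Omega>. X 0 w = k}"
      using start[OF j] AE_space[of "P j"] by eventually_elim (use True space_P[OF j] in auto)
    then have "prob {w \<in> \<Omega>. X 0 w = k} = 1"
      using event_in_P[OF j, of 0 k] by (subst prob_eq_1) auto
    then show ?thesis using True transition_function_eq[OF j] by simp
  next
    case False
    have "AE w in P j. w \<notin> {w \<in> \<Omega>. X 0 w = k}"
      using start[OF j] by eventually_elim (use False in auto)
    then show ?thesis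
      using False event_in_P[OF j, of 0 k] by (simp add: transition_function_eq[OF j] prob_eq_0)
  qed
qed

text \<open>The transition function, set to 0 at negative times so that all integrals run over \<open>lborel\<close>.\<close>

definition q :: "nat \<Rightarrow> nat \<Rightarrow> real \<Rightarrow> real"
  where "q j k t = (if t < 0 then 0 else p t j k)"

lemma q_nonneg: "0 \<le> q j k t"
  by (simp add: q_def transition_function_nonneg)

text \<open>By right continuity, \<open>q j k\<close> is a limit of functions that look at a time
  slightly to the right of \<open>t\<close>. Each of them depends on \<open>t\<close> only through
  an integer and is therefore measurable whatever \<open>p\<close> is.\<close>

lemma q_measurable[measurable]:
  assumes j: "1 \<le> j"
  shows "q j k \<in> borel_measurable borel"
proof (rule borel_measurable_LIMSEQ_real)
  let ?t = "\<lambda>n t. real_of_int (\<lfloor>real (Suc n) * t\<rfloor> + 1) / real (Suc n)"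
  show "(\<lambda>n. if t < 0 then 0 else p (?t n t) j k) \<longlonglongrightarrow> q j k t" if "t \<in> space borel" for t
  proof (cases "t < 0")
    case False
    have ge: "t \<le> ?t n t" for n
    proof -
      have "real (Suc n) * t \<le> real_of_int (\<lfloor>real (Suc n) * t\<rfloor> + 1)" by linarith
      then show ?thesis by (simp add: field_simps)
    qed
    have le: "?t n t \<le> t + 1 / real (Suc n)" for n
    proof -
      have "real_of_int (\<lfloor>real (Suc n) * t\<rfloor> + 1) / real (Suc n) \<le> (real (Suc n) * t + 1) / real (Suc n)"
        by (intro divide_right_mono) linarith+
      also have "\<dots> = t + 1 / real (Suc n)" by (simp add: add_divide_distrib del: of_nat_Suc)
      finally show ?thesis .
    qed
    have "(\<lambda>n. t + 1 / real (Suc n)) \<longlonglongrightarrow> t + 0"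
      by (intro tendsto_intros LIMSEQ_inverse_real_of_nat[unfolded inverse_eq_divide])
    then have "(\<lambda>n. ?t n t) \<longlonglongrightarrow> t"
      using ge le by (intro tendsto_sandwich[of "\<lambda>_. t" "\<lambda>n. ?t n t" _ "\<lambda>n. t + 1 / real (Suc n)"]) auto
    then show ?thesis
      using False ge by (simp only: q_def if_False) (intro transition_function_right_continuous j, auto)
  qed (simp add: q_def)
  show "(\<lambda>t. if t < 0 then 0 else p (?t n t) j k) \<in> borel_measurable borel" for n
  proof -
    have "(\<lambda>t. (\<lambda>z::int. p (real_of_int (z + 1) / real (Suc n)) j k) \<lfloor>real (Suc n) * t\<rfloor>) \<in> borel_measurable borel"
      by (rule measurable_compose[of _ _ "count_space UNIV"]) measurable
    then show ?thesis by measurable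
  qed
qed

lemma potential_density_eq: "potential_density P X j k = (\<integral>\<^sup>+t. ennreal (q j k t) \<partial>lborel)"
  unfolding potential_density_def by (intro nn_integral_cong) (auto simp: q_def split: split_indicator)

text \<open>The right side carries indicators because \<open>s + t\<close> can be nonnegative when
  one of the two times is negative.\<close>

lemma q_semigroup:
  assumes "1 \<le> j" "1 \<le> k"
  shows "(\<integral>\<^sup>+i. ennreal (q j i s) * ennreal (q i k t) \<partial>count_space {1..}) =
    ennreal (q j k (s + t)) * indicator {0..} s * indicator {0..} t"
  using chapman_kolmogorov[of j k t s] assms by (auto simp: q_def split: split_indicator)

definition resolvent :: "real \<Rightarrow> nat \<Rightarrow> nat \<Rightarrow> ennreal"
  where "resolvent r j k = (\<integral>\<^sup>+t. ennreal (exp (- (r * t)) * q j k t) \<partial>lborel)"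

text \<open>The resolvent equation for the parameters \<open>r\<close> and 0, free of subtraction
  since the values are extended nonnegative numbers. By the semigroup property, the product is a
  double integral of \<open>exp (- (r * s)) * q j k (s + t)\<close>; in the coordinates
  \<open>s\<close> and \<open>v = s + t\<close>, the integral over \<open>0 \<le> s \<le> v\<close>
  is \<open>(1 - exp (- (r * v))) / r\<close>.\<close>

lemma resolvent_equation:
  assumes j: "1 \<le> j" and k: "1 \<le> k" and r: "0 < r"
  shows "resolvent r j k + ennreal r * (\<integral>\<^sup>+i. resolvent r j i * potential_density P X i k \<partial>count_space {1..}) =
    potential_density P X j k"
proof -
  let ?g = "\<lambda>i s t. ennreal (exp (- (r * s))) * (ennreal (q j i s) * ennreal (q i k t))"
  let ?I = "\<integral>\<^sup>+i. resolvent r j i * potential_density P X i k \<partial>count_space {1..}"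
  note [measurable] = q_measurable
  define W where "W s v = (if 0 \<le> s \<and> s \<le> v then ennreal (exp (- (r * s))) * ennreal (q j k v) else 0)" for s v
  have [measurable]: "case_prod W \<in> borel_measurable (lborel \<Otimes>\<^sub>M lborel)"
    unfolding W_def using j by measurable
  have "?I =
     (\<integral>\<^sup>+i. \<integral>\<^sup>+s. \<integral>\<^sup>+t. ?g i s t \<partial>lborel \<partial>lborel \<partial>count_space {1..})"
    unfolding resolvent_def potential_density_eq
  proof (intro nn_integral_cong)
    fix i :: nat assume "i \<in> space (count_space {1..})"
    then have i: "1 \<le> i" by simp
    show "(\<integral>\<^sup>+ t. ennreal (exp (- (r * t)) * q j i t) \<partial>lborel) * (\<integral>\<^sup>+ t. ennreal (q i k t) \<partial>lborel) =
      (\<integral>\<^sup>+s. \<integral>\<^sup>+t. ?g i s t \<partial>lborel \<partial>lborel)"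
      using i j by (simp add: nn_integral_cmult nn_integral_multc[symmetric] ennreal_mult q_nonneg mult.assoc[symmetric])
  qed
  also have "\<dots> = (\<integral>\<^sup>+s. \<integral>\<^sup>+i. \<integral>\<^sup>+t. ?g i s t \<partial>lborel \<partial>count_space {1..} \<partial>lborel)"
    using j by (intro nn_integral_count_space_nn_integral[symmetric]) auto
  also have "\<dots> = (\<integral>\<^sup>+s. \<integral>\<^sup>+t. \<integral>\<^sup>+i. ?g i s t \<partial>count_space {1..} \<partial>lborel \<partial>lborel)"
    using j by (intro nn_integral_cong nn_integral_count_space_nn_integral[symmetric]) auto
  also have "\<dots> = (\<integral>\<^sup>+s. \<integral>\<^sup>+t. ennreal (exp (- (r * s))) * (ennreal (q j k (s + t)) * indicator {0..} s * indicator {0..} t) \<partial>lborel \<partial>lborel)"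
    by (intro nn_integral_cong) (simp add: nn_integral_cmult q_semigroup[OF j k, unfolded One_nat_def])
  also have "\<dots> = (\<integral>\<^sup>+s. \<integral>\<^sup>+v. W s v \<partial>lborel \<partial>lborel)"
  proof (rule nn_integral_cong)
    fix s
    have "(\<integral>\<^sup>+v. W s v \<partial>lborel) = (\<integral>\<^sup>+t. W s (s + t) \<partial>lborel)"
      by (subst nn_integral_real_affine[where c = 1 and t = s]) auto
    then show "(\<integral>\<^sup>+t. ennreal (exp (- (r * s))) * (ennreal (q j k (s + t)) * indicator {0..} s * indicator {0..} t) \<partial>lborel) =
      (\<integral>\<^sup>+v. W s v \<partial>lborel)"
      by (simp only:) (intro nn_integral_cong, auto simp: W_def split: split_indicator)
  qed
  also have "\<dots> = (\<integral>\<^sup>+v. \<integral>\<^sup>+s. W s v \<partial>lborel \<partial>lborel)"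
    by (intro lborel_pair.Fubini') auto
  also have "\<dots> = (\<integral>\<^sup>+v. ennreal (q j k v * ((1 - exp (- (r * v))) / r)) \<partial>lborel)"
  proof (intro nn_integral_cong)
    fix v
    show "(\<integral>\<^sup>+s. W s v \<partial>lborel) = ennreal (q j k v * ((1 - exp (- (r * v))) / r))"
    proof (cases "v < 0")
      case True
      then have "W s v = 0" for s by (simp add: W_def)
      then show ?thesis using True by (simp add: q_def)
    next
      case False
      have "(\<integral>\<^sup>+s. W s v \<partial>lborel) =
        (\<integral>\<^sup>+s. ennreal (q j k v) * (ennreal (exp (- (r * s))) * indicator {0..v} s) \<partial>lborel)"
        by (intro nn_integral_cong) (auto simp: W_def mult.commute)
      also have "\<dots> = ennreal (q j k v) * ennreal ((1 - exp (- (r * v))) / r)"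
        using False r by (subst nn_integral_cmult) (auto simp: nn_integral_exp_Icc)
      finally show ?thesis by (simp only: ennreal_mult'[OF q_nonneg])
    qed
  qed
  finally have "ennreal r * ?I =
      (\<integral>\<^sup>+v. ennreal r * ennreal (q j k v * ((1 - exp (- (r * v))) / r)) \<partial>lborel)"
    using j by (simp only:) (rule nn_integral_cmult[symmetric], measurable)
  also have "\<dots> = (\<integral>\<^sup>+v. ennreal (q j k v * (1 - exp (- (r * v)))) \<partial>lborel)"
    using r by (intro nn_integral_cong) (simp add: ennreal_mult'[symmetric] del: ennreal_mult')
  finally have "resolvent r j k + ennreal r * ?I =
     (\<integral>\<^sup>+v. ennreal (exp (- (r * v)) * q j k v) + ennreal (q j k v * (1 - exp (- (r * v)))) \<partial>lborel)"
    using j unfolding resolvent_def by (simp add: nn_integral_add)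
  also have "\<dots> = potential_density P X j k"
    unfolding potential_density_eq
  proof (intro nn_integral_cong)
    fix v
    show "ennreal (exp (- (r * v)) * q j k v) + ennreal (q j k v * (1 - exp (- (r * v)))) = ennreal (q j k v)"
    proof (cases "v < 0")
      case False
      then have "0 \<le> 1 - exp (- (r * v))" using r by simp
      then have "ennreal (exp (- (r * v)) * q j k v) + ennreal (q j k v * (1 - exp (- (r * v)))) =
          ennreal (exp (- (r * v)) * q j k v + q j k v * (1 - exp (- (r * v))))"
        by (intro ennreal_plus[symmetric] mult_nonneg_nonneg q_nonneg) auto
      then show ?thesis by (simp add: algebra_simps)
    qed (simp add: q_def)
  qed
  finally show ?thesis .
qed

lemma resolvent_row:
  assumes j: "1 \<le> j" and r: "0 < r"
  shows "(\<integral>\<^sup>+k. resolvent r j k \<partial>count_space {1..}) \<le> ennreal (1 / r)"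
proof -
  note [measurable] = q_measurable
  have "(\<integral>\<^sup>+k. resolvent r j k \<partial>count_space {1..}) =
      (\<integral>\<^sup>+t. \<integral>\<^sup>+k. ennreal (exp (- (r * t)) * q j k t) \<partial>count_space {1..} \<partial>lborel)"
    unfolding resolvent_def using j by (intro nn_integral_count_space_nn_integral[symmetric]) auto
  also have "\<dots> \<le> (\<integral>\<^sup>+t. ennreal (exp (- (r * t))) * indicator {0..} t \<partial>lborel)"
  proof (intro nn_integral_mono)
    fix t
    have "(\<integral>\<^sup>+k. ennreal (exp (- (r * t)) * q j k t) \<partial>count_space {1..}) =
      ennreal (exp (- (r * t))) * (\<integral>\<^sup>+k. ennreal (q j k t) \<partial>count_space {1..})"
      by (simp add: nn_integral_cmult ennreal_mult q_nonneg)
    also have "\<dots> \<le> ennreal (exp (- (r * t))) * indicator {0..} t"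
      using sub_markov[OF j, of t] by (intro mult_left_mono) (auto simp: q_def split: split_indicator)
    finally show "(\<integral>\<^sup>+k. ennreal (exp (- (r * t)) * q j k t) \<partial>count_space {1..}) \<le> \<dots>" .
  qed
  finally show ?thesis using nn_integral_exp_Ici[OF r] by simp
qed

text \<open>With \<open>u = n * t\<close> this is the integral of
  \<open>exp (- u) * p (u / n) j k\<close> over \<open>u \<ge> 0\<close>, and
  \<open>p (u / n)\<close> tends to \<open>p 0\<close>, the identity.\<close>

lemma resolvent_limit:
  assumes j: "1 \<le> j"
  shows "(\<lambda>n. real n * enn2real (resolvent (real n) j k)) \<longlonglongrightarrow> of_bool (j = k)"
proof -
  note [measurable] = q_measurable
  have int: "integrable lborel (\<lambda>u::real. exp (- u) * indicator {0..} u)"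
    using nn_integral_exp_Ici[of 1]
    by (intro integrableI_nonneg) (auto simp: ennreal_mult ennreal_indicator)
  have e: "integral\<^sup>L lborel (\<lambda>u::real. exp (- u) * indicator {0..} u) = 1"
    using nn_integral_exp_Ici[of 1]
    by (intro integral_eq_nn_integral[THEN trans]) (auto simp: ennreal_mult ennreal_indicator)
  have lim: "(\<lambda>n. integral\<^sup>L lborel (\<lambda>u. exp (- u) * q j k (u / real (Suc n)))) \<longlonglongrightarrow>
      integral\<^sup>L lborel (\<lambda>u. exp (- u) * indicator {0..} u * of_bool (j = k))"
  proof (rule integral_dominated_convergence[where w = "\<lambda>u. exp (- u) * indicator {0..} u"])
    show "AE u in lborel. (\<lambda>n. exp (- u) * q j k (u / real (Suc n))) \<longlonglongrightarrow> exp (- u) * indicator {0..} u * of_bool (j = k)"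
    proof (rule AE_I2)
      fix u :: real
      show "(\<lambda>n. exp (- u) * q j k (u / real (Suc n))) \<longlonglongrightarrow> exp (- u) * indicator {0..} u * of_bool (j = k)"
      proof (cases "u < 0")
        case True
        then show ?thesis by (simp add: q_def divide_neg_pos)
      next
        case False
        then have "(\<lambda>n. p (u / real (Suc n)) j k) \<longlonglongrightarrow> p 0 j k"
          using tendsto_mult[OF tendsto_const[of u] LIMSEQ_inverse_real_of_nat]
          by (intro transition_function_right_continuous j) (simp_all add: divide_inverse)
        then have "(\<lambda>n. exp (- u) * p (u / real (Suc n)) j k) \<longlonglongrightarrow> exp (- u) * of_bool (j = k)"
          unfolding transition_function_0[OF j] by (intro tendsto_intros)
        moreover have "\<not> u / real (Suc n) < 0" for n using False by (simp add: field_simps)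
        ultimately show ?thesis using False by (simp add: q_def)
      qed
    qed
    show "AE u in lborel. norm (exp (- u) * q j k (u / real (Suc n))) \<le> exp (- u) * indicator {0..} u" for n
      using j by (intro AE_I2) (auto simp: q_def divide_neg_pos transition_function_nonneg transition_function_le_1 split: split_indicator)
  qed (use int j in auto)
  have eq: "real (Suc n) * enn2real (resolvent (real (Suc n)) j k) =
      integral\<^sup>L lborel (\<lambda>u. exp (- u) * q j k (u / real (Suc n)))" for n
  proof -
    have "ennreal (real (Suc n)) * resolvent (real (Suc n)) j k =
      (\<integral>\<^sup>+u. ennreal (exp (- u) * q j k (u / real (Suc n))) \<partial>lborel)"
      unfolding resolvent_def using j
      by (subst (2) nn_integral_real_affine[where c = "real (Suc n)" and t = 0]) (auto simp del: of_nat_Suc)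
    then have "enn2real (ennreal (real (Suc n)) * resolvent (real (Suc n)) j k) =
      integral\<^sup>L lborel (\<lambda>u. exp (- u) * q j k (u / real (Suc n)))"
      using j by (subst integral_eq_nn_integral) (auto simp: q_nonneg)
    then show ?thesis by (simp add: enn2real_mult del: of_nat_Suc)
  qed
  have "(\<lambda>n. real (Suc n) * enn2real (resolvent (real (Suc n)) j k)) \<longlonglongrightarrow> of_bool (j = k)"
    unfolding eq using lim by (simp add: e)
  then show ?thesis by (rule LIMSEQ_imp_Suc)
qed

end

section \<open>From extended nonnegative sums to real sums\<close>

lemma nn_integral_count_space_of_summable:
  fixes f :: "'a \<Rightarrow> real"
  assumes f: "\<And>x. x \<in> S \<Longrightarrow> 0 \<le> f x" and s: "f summable_on S"
  shows "(\<integral>\<^sup>+x. ennreal (f x) \<partial>count_space S) = ennreal (infsum f S)"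
proof -
  have "(\<lambda>x. norm (f x)) summable_on S"
    using s by (rule summable_on_cong[THEN iffD1, rotated]) (use f in auto)
  then have abs: "Infinite_Set_Sum.abs_summable_on f S"
    using abs_summable_equivalent by blast
  then have "(\<integral>\<^sup>+x. ennreal (f x) \<partial>count_space S) = ennreal (integral\<^sup>L (count_space S) f)"
    using f by (intro nn_integral_eq_integral) (auto simp: abs_summable_on_def AE_count_space)
  then show ?thesis using infsetsum_infsum[OF abs] by (simp add: infsetsum_def)
qed

lemma summable_of_infsum_ennreal:
  fixes f :: "'a \<Rightarrow> real"
  assumes f: "\<And>x. x \<in> S \<Longrightarrow> 0 \<le> f x" and le: "infsum (\<lambda>x. ennreal (f x)) S \<le> ennreal C" and C: "0 \<le> C"
  shows "f summable_on S" "infsum f S \<le> C"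
proof -
  have b: "sum f G \<le> C" if G: "finite G" "G \<subseteq> S" for G
  proof -
    have "ennreal (sum f G) = (\<Sum>x\<in>G. ennreal (f x))" using f G by (subst sum_ennreal) auto
    also have "\<dots> \<le> infsum (\<lambda>x. ennreal (f x)) S"
      using G by (subst infsum_finite[symmetric], simp) (intro infsum_mono_neutral nonneg_summable_on_complete, auto)
    finally have "ennreal (sum f G) \<le> ennreal C" using le by simp
    then show ?thesis using C by simp
  qed
  then show s: "f summable_on S"
    by (intro nonneg_bdd_above_summable_on f) (auto intro!: bdd_aboveI2[of _ _ C])
  show "infsum f S \<le> C"
    using s b by (rule infsum_le_finite_sums)
qed

lemma summable_rows_of_SUP:
  fixes g :: "'a \<Rightarrow> 'b \<Rightarrow> real"
  assumes g: "\<And>j k. j \<in> S \<Longrightarrow> k \<in> T \<Longrightarrow> 0 \<le> g j k"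
    and fin: "(SUP j\<in>S. \<Sum>\<^sub>\<infinity>k\<in>T. ennreal (g j k)) < \<infinity>"
  obtains C where "\<And>j. j \<in> S \<Longrightarrow> g j summable_on T \<and> infsum (g j) T \<le> C"
proof -
  let ?C = "SUP j\<in>S. \<Sum>\<^sub>\<infinity>k\<in>T. ennreal (g j k)"
  have le: "(\<Sum>\<^sub>\<infinity>k\<in>T. ennreal (g j k)) \<le> ennreal (enn2real ?C)" if "j \<in> S" for j
    using fin SUP_upper[OF that, of "\<lambda>j. \<Sum>\<^sub>\<infinity>k\<in>T. ennreal (g j k)"] by simp
  show ?thesis
  proof (rule that[of "enn2real ?C"])
    fix j assume j: "j \<in> S"
    show "g j summable_on T \<and> infsum (g j) T \<le> enn2real ?C"
      using summable_of_infsum_ennreal[OF g[OF j] le[OF j] enn2real_nonneg] by blast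
  qed
qed

context borel_right_process
begin

text \<open>Identities between extended nonnegative numbers have to become real ones. Finiteness of
  the resolvent is inherited from \<open>U\<close>, which dominates it by the resolvent equation;
  the identity for the row sums is that equation summed over \<open>k\<close>.\<close>

lemma potential_kernel:
  assumes tr: "transient P X"
    and U: "\<And>j k. 1 \<le> j \<Longrightarrow> 1 \<le> k \<Longrightarrow> U j k = enn2real (potential_density P X j k)"
    and C: "\<And>j. 1 \<le> j \<Longrightarrow> U j summable_on {1..}" "\<And>j. 1 \<le> j \<Longrightarrow> infsum (U j) {1..} \<le> C"
  shows "potential_kernel {1..} U (\<lambda>r j k. r * enn2real (resolvent r j k)) C"
proof -
  define R where "R r j k = enn2real (resolvent r j k)" for r j k
  have UV: "ennreal (U j k) = potential_density P X j k" if "1 \<le> j" "1 \<le> k" for j k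
    using tr that by (simp add: U transient_def less_top)
  have U0: "0 \<le> U j k" if "1 \<le> j" "1 \<le> k" for j k using that by (simp add: U)
  have R0: "0 \<le> R r j k" for r j k by (simp add: R_def)
  have RR: "ennreal (R r j k) = resolvent r j k" if "0 < r" "1 \<le> j" "1 \<le> k" for r j k
  proof -
    have "resolvent r j k \<le> potential_density P X j k"
      using resolvent_equation[OF that(2,3,1)] by (metis le_iff_add)
    then show ?thesis using tr that unfolding R_def transient_def
      by (metis ennreal_enn2real infinity_ennreal_def le_less_trans)
  qed
  let ?I = "\<lambda>r j k. \<integral>\<^sup>+i. ennreal (r * R r j i * U i k) \<partial>count_space {1..}"
  have RU: "resolvent r j k + ?I r j k = ennreal (U j k)"
    if r: "0 < r" and j: "1 \<le> j" and k: "1 \<le> k" for r j k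
  proof -
    have "?I r j k =
        (\<integral>\<^sup>+i. ennreal r * (resolvent r j i * potential_density P X i k) \<partial>count_space {1..})"
      using r j k by (intro nn_integral_cong) (simp add: ennreal_mult R0 U0 RR UV mult.assoc)
    also have "\<dots> = ennreal r * (\<integral>\<^sup>+i. resolvent r j i * potential_density P X i k \<partial>count_space {1..})"
      by (intro nn_integral_cmult) auto
    finally show ?thesis using resolvent_equation[OF j k r] unfolding UV[OF j k] by simp
  qed
  have diff: "x = ennreal (b - a)" if "ennreal a + x = ennreal b" "0 \<le> a" for x a b
  proof -
    have "ennreal b - ennreal a = x" using that(1) by (metis ennreal_add_diff_cancel_left ennreal_neq_top infinity_ennreal_def)
    then show ?thesis using that(2) by (simp add: ennreal_minus)
  qed
  have nonneg_diff: "0 \<le> b - a" if "ennreal a + x = ennreal b" "0 \<le> b" for x a b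
    using that by (metis diff_ge_0_iff_ge ennreal_le_iff le_iff_add)
  have Rsum: "(R r j has_sum infsum (R r j) {1..}) {1..}" "infsum (R r j) {1..} \<le> 1 / r"
    "(\<integral>\<^sup>+k. ennreal (R r j k) \<partial>count_space {1..}) = ennreal (infsum (R r j) {1..})" if r: "0 < r" and j: "1 \<le> j" for r j
  proof -
    have le: "(\<integral>\<^sup>+k. ennreal (R r j k) \<partial>count_space {1..}) \<le> ennreal (1 / r)"
      using resolvent_row[OF j r] r j by (subst nn_integral_cong[where v = "resolvent r j"]) (auto simp: RR)
    define c where "c = enn2real (\<integral>\<^sup>+k. ennreal (R r j k) \<partial>count_space {1..})"
    have c: "(\<integral>\<^sup>+k. ennreal (R r j k) \<partial>count_space {1..}) = ennreal c"
      unfolding c_def using le_less_trans[OF le ennreal_less_top] by simp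
    then have h: "(R r j has_sum c) {1..}"
      by (intro has_sum_of_nn_integral_count_space) (auto simp: R0 c_def)
    then have i: "infsum (R r j) {1..} = c" by (rule infsumI)
    show "(R r j has_sum infsum (R r j) {1..}) {1..}" using h i by simp
    show "infsum (R r j) {1..} \<le> 1 / r"
      using le r unfolding c i by (simp add: c_def)
    show "(\<integral>\<^sup>+k. ennreal (R r j k) \<partial>count_space {1..}) = ennreal (infsum (R r j) {1..})" using c i by simp
  qed
  have Usum: "(\<integral>\<^sup>+k. ennreal (U j k) \<partial>count_space {1..}) = ennreal (infsum (U j) {1..})" if "1 \<le> j" for j
    using that C(1) by (intro nn_integral_count_space_of_summable U0) auto
  have u0: "0 \<le> infsum (U j) {1..}" if "1 \<le> j" for j
    by (intro infsum_nonneg U0) (use that in auto)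
  have "potential_kernel {1..} U (\<lambda>r j k. r * R r j k) C"
  proof
    fix r :: real and j :: nat assume r: "0 < r" and "j \<in> {1..}"
    then have j: "1 \<le> j" by simp
    show "(\<lambda>k. r * R r j k) summable_on {1..}"
      using Rsum(1)[OF r j] by (intro summable_on_cmult_right) (auto simp: summable_on_def)
    have q: "infsum (\<lambda>k. r * R r j k) {1..} = r * infsum (R r j) {1..}"
      using Rsum(1)[OF r j] by (intro infsumI has_sum_cmult_right)
    show "infsum (\<lambda>k. r * R r j k) {1..} \<le> 1"
      unfolding q using Rsum(2)[OF r j] r by (simp add: field_simps)
    show "((\<lambda>i. r * R r j i * U i k) has_sum (U j k - r * R r j k / r)) {1..}" if "k \<in> {1..}" for k
    proof (rule has_sum_of_nn_integral_count_space)
      have k: "1 \<le> k" using that by simp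
      have e: "ennreal (R r j k) + ?I r j k = ennreal (U j k)"
        using RU[OF r j k] unfolding RR[OF r j k] .
      show "0 \<le> U j k - r * R r j k / r" using nonneg_diff[OF e U0[OF j k]] r by simp
      show "?I r j k = ennreal (U j k - r * R r j k / r)"
        using diff[OF e R0] r by simp
    qed (use r R0 U0 that in auto)
    show "((\<lambda>i. r * R r j i * infsum (U i) {1..}) has_sum
        (infsum (U j) {1..} - infsum (\<lambda>k. r * R r j k) {1..} / r)) {1..}"
    proof (rule has_sum_of_nn_integral_count_space)
      have "ennreal (infsum (U j) {1..}) = (\<integral>\<^sup>+k. ennreal (R r j k) +
          ?I r j k \<partial>count_space {1..})"
        unfolding Usum[OF j, symmetric] using RU[OF r j] j r by (intro nn_integral_cong) (simp add: RR)
      also have "\<dots> = ennreal (infsum (R r j) {1..}) +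
          (\<integral>\<^sup>+k. ?I r j k \<partial>count_space {1..})"
        by (subst nn_integral_add) (auto simp: Rsum(3)[OF r j, unfolded One_nat_def])
      also have "(\<integral>\<^sup>+k. ?I r j k \<partial>count_space {1..}) =
          (\<integral>\<^sup>+i. \<integral>\<^sup>+k. ennreal (r * R r j i * U i k) \<partial>count_space {1..} \<partial>count_space {1..})"
        by (intro nn_integral_count_space_nn_integral) auto
      also have "\<dots> = (\<integral>\<^sup>+i. ennreal (r * R r j i * infsum (U i) {1..}) \<partial>count_space {1..})"
      proof (intro nn_integral_cong)
        fix i :: nat assume "i \<in> space (count_space {1..})"
        then have i: "1 \<le> i" by simp
        have "(\<integral>\<^sup>+k. ennreal (r * R r j i * U i k) \<partial>count_space {1..}) =
            (\<integral>\<^sup>+k. ennreal (r * R r j i) * ennreal (U i k) \<partial>count_space {1..})"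
          using r i by (intro nn_integral_cong) (simp add: ennreal_mult R0 U0)
        also have "\<dots> = ennreal (r * R r j i) * ennreal (infsum (U i) {1..})"
          by (subst nn_integral_cmult) (auto simp: Usum[OF i, unfolded One_nat_def])
        finally show "(\<integral>\<^sup>+k. ennreal (r * R r j i * U i k) \<partial>count_space {1..}) = ennreal (r * R r j i * infsum (U i) {1..})"
          using r R0 u0[OF i] by (simp only: ennreal_mult mult_nonneg_nonneg less_imp_le)
      qed
      finally have e: "ennreal (infsum (R r j) {1..}) + (\<integral>\<^sup>+i. ennreal (r * R r j i * infsum (U i) {1..}) \<partial>count_space {1..}) =
        ennreal (infsum (U j) {1..})" by simp
      have d: "infsum (U j) {1..} - infsum (\<lambda>k. r * R r j k) {1..} / r = infsum (U j) {1..} - infsum (R r j) {1..}"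
        unfolding q using r by simp
      show "0 \<le> infsum (U j) {1..} - infsum (\<lambda>k. r * R r j k) {1..} / r"
        unfolding d by (rule nonneg_diff[OF e u0[OF j]])
      show "(\<integral>\<^sup>+i. ennreal (r * R r j i * infsum (U i) {1..}) \<partial>count_space {1..}) =
          ennreal (infsum (U j) {1..} - infsum (\<lambda>k. r * R r j k) {1..} / r)"
        unfolding d by (rule diff[OF e]) (intro infsum_nonneg R0)
      show "0 \<le> r * R r j i * infsum (U i) {1..}" if "i \<in> {1..}" for i
        using that r R0 by (intro mult_nonneg_nonneg u0) auto
    qed
  next
    fix j k :: nat assume "j \<in> {1..}" "k \<in> {1..}"
    then show "(\<lambda>n. real n * R (real n) j k) \<longlonglongrightarrow> of_bool (j = k)"
      unfolding R_def by (intro resolvent_limit) auto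
  qed (use U0 C R0 in auto)
  then show ?thesis by (simp add: R_def)
qed

end

section \<open>Determinants\<close>

definition kdet :: "nat \<Rightarrow> (nat \<Rightarrow> nat \<Rightarrow> real) \<Rightarrow> real"
  where "kdet n B = Determinant.det (Matrix.mat n n (\<lambda>(p, q). B p q))"

lemma kdet_cong: "(\<And>p q. p < n \<Longrightarrow> q < n \<Longrightarrow> B p q = B' p q) \<Longrightarrow> kdet n B = kdet n B'"
  unfolding kdet_def by (rule arg_cong[of _ _ Determinant.det]) auto

lemma kdet_0: "kdet 0 B = 1"
  by (simp add: kdet_def)

lemma kdet_one: "kdet n (\<lambda>p q. of_bool (p = q)) = 1"
proof -
  have "Matrix.mat n n (\<lambda>(p, q). of_bool (p = q)) = (1\<^sub>m n :: real mat)" by (rule eq_matI) auto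
  then show ?thesis by (simp add: kdet_def)
qed

lemma kdet_mult: "kdet n (\<lambda>p q. \<Sum>l<n. B p l * C l q) = kdet n B * kdet n C"
proof -
  have "Matrix.mat n n (\<lambda>(p, q). \<Sum>l<n. B p l * C l q) =
      Matrix.mat n n (\<lambda>(p, q). B p q) * Matrix.mat n n (\<lambda>(p, q). C p q)"
    by (rule eq_matI) (auto simp: scalar_prod_def atLeast0LessThan)
  then show ?thesis unfolding kdet_def by (simp add: det_mult[of _ n])
qed

text \<open>Block elimination \<open>B = L R\<close>: \<open>L\<close> is unit upper triangular,
  with \<open>B p n / B n n\<close> in its last column, and \<open>R\<close> is block lower
  triangular with the Schur complement and the pivot on its diagonal.\<close>

lemma kdet_Schur_complement:
  assumes d: "B n n \<noteq> 0"
  shows "kdet (Suc n) B = B n n * kdet n (\<lambda>p q. B p q - B p n * B n q / B n n)"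
proof -
  define S where "S p q = B p q - B p n * B n q / B n n" for p q
  define L where "L p q = (if p = q then 1 else if q = n then B p n / B n n else 0)" for p q
  define R where "R p q = (if p < n then (if q < n then S p q else 0) else B n q)" for p q
  have "B p q = (\<Sum>l<Suc n. L p l * R l q)" if "p < Suc n" "q < Suc n" for p q
  proof (cases "p < n")
    case True
    then have "(\<Sum>l<Suc n. L p l * R l q) = (\<Sum>l<n. (if p = l then R l q else 0)) + L p n * R n q"
      by (simp only: sum.lessThan_Suc) (intro arg_cong2[of _ _ _ _ "(+)"] sum.cong, auto simp: L_def)
    also have "\<dots> = R p q + B p n / B n n * B n q" using True by (simp add: L_def R_def)
    also have "\<dots> = B p q"
      using True that d by (cases "q < n") (auto simp: R_def S_def less_Suc_eq)
    finally show ?thesis by simp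
  next
    case False
    then have p: "p = n" using that by simp
    have "(\<Sum>l<n. L n l * R l q) = 0" by (intro sum.neutral) (auto simp: L_def)
    then show ?thesis by (simp add: p L_def R_def)
  qed
  then have "kdet (Suc n) B = kdet (Suc n) L * kdet (Suc n) R"
    unfolding kdet_mult[symmetric] by (intro kdet_cong)
  moreover have "kdet (Suc n) L = 1"
  proof -
    have "upper_triangular (Matrix.mat (Suc n) (Suc n) (\<lambda>(p, q). L p q))"
      by (rule upper_triangularI) (auto simp: L_def)
    then have "kdet (Suc n) L = prod_list (diag_mat (Matrix.mat (Suc n) (Suc n) (\<lambda>(p, q). L p q)))"
      unfolding kdet_def by (rule det_upper_triangular[of _ "Suc n"]) simp
    also have "diag_mat (Matrix.mat (Suc n) (Suc n) (\<lambda>(p, q). L p q)) = map (\<lambda>_. 1) [0..<Suc n]"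
      unfolding diag_mat_def by (intro map_cong) (auto simp: L_def)
    also have "prod_list \<dots> = 1" by (simp only: prod_list.Cons map_replicate_const prod_list_replicate power_one)
    finally show ?thesis .
  qed
  moreover have "kdet (Suc n) R = kdet n S * B n n"
  proof -
    let ?A1 = "Matrix.mat n n (\<lambda>(p, q). S p q)" and ?A3 = "Matrix.mat 1 n (\<lambda>(p, q). B n q)"
      and ?A4 = "Matrix.mat 1 1 (\<lambda>(p, q). B n n)"
    have "Matrix.mat (Suc n) (Suc n) (\<lambda>(p, q). R p q) = four_block_mat ?A1 (0\<^sub>m n 1) ?A3 ?A4"
      by (rule eq_matI) (auto simp: R_def less_Suc_eq)
    then have "kdet (Suc n) R = Determinant.det ?A1 * Determinant.det ?A4"
      unfolding kdet_def by (simp only:) (rule det_four_block_mat_upper_right_zero_col[of _ n], auto)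
    also have "Determinant.det ?A4 = B n n" by (subst det_single) auto
    finally show ?thesis by (simp add: kdet_def)
  qed
  ultimately show ?thesis by (simp add: S_def[abs_def])
qed

text \<open>The block matrix with rows \<open>(1, - Y)\<close> and \<open>(X, 1)\<close> factors
  into block triangular matrices in two ways, one for each side.\<close>

lemma Sylvester_determinant:
  "kdet n (\<lambda>p q. of_bool (p = q) + (\<Sum>l<N. B p l * C l q)) =
   kdet N (\<lambda>k l. of_bool (k = l) + (\<Sum>p<n. C k p * B p l))"
proof -
  define X where "X = Matrix.mat n N (\<lambda>(p, l). B p l)"
  define Y where "Y = Matrix.mat N n (\<lambda>(l, q). C l q)"
  have X: "X \<in> carrier_mat n N" and Y: "Y \<in> carrier_mat N n" by (simp_all add: X_def Y_def)
  let ?M = "four_block_mat (1\<^sub>m N) (- Y) X (1\<^sub>m n)"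
  have XY: "X * Y \<in> carrier_mat n n" and YX: "Y * X \<in> carrier_mat N N" using X Y by auto
  have "?M = four_block_mat (1\<^sub>m N) (0\<^sub>m N n) X (1\<^sub>m n) * four_block_mat (1\<^sub>m N) (- Y) (0\<^sub>m n N) (1\<^sub>m n + X * Y)"
    using X Y XY
    by (subst mult_four_block_mat[of _ N N _ n _ n _ _ N _ n])
      (auto simp: scalar_prod_def intro!: cong_four_block_mat)
  then have 1: "Determinant.det ?M = Determinant.det (1\<^sub>m n + X * Y)"
    using X Y XY
    by (simp add: det_mult[of _ "N + n"] det_four_block_mat_upper_right_zero[of _ N _ n] det_four_block_mat_lower_left_zero[of _ N _ n])
  have "?M = four_block_mat (1\<^sub>m N) (- Y) (0\<^sub>m n N) (1\<^sub>m n) * four_block_mat (1\<^sub>m N + Y * X) (0\<^sub>m N n) X (1\<^sub>m n)"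
    using X Y YX
    by (subst mult_four_block_mat[of _ N N _ n _ n _ _ N _ n])
      (auto intro!: cong_four_block_mat)
  then have 2: "Determinant.det ?M = Determinant.det (1\<^sub>m N + Y * X)"
    using X Y YX
    by (simp add: det_mult[of _ "N + n"] det_four_block_mat_upper_right_zero[of _ N _ n] det_four_block_mat_lower_left_zero[of _ N _ n])
  have "kdet n (\<lambda>p q. of_bool (p = q) + (\<Sum>l<N. B p l * C l q)) = Determinant.det (1\<^sub>m n + X * Y)"
    unfolding kdet_def
    by (rule arg_cong[of _ _ Determinant.det]) (rule eq_matI, auto simp: X_def Y_def scalar_prod_def atLeast0LessThan)
  moreover have "kdet N (\<lambda>k l. of_bool (k = l) + (\<Sum>p<n. C k p * B p l)) = Determinant.det (1\<^sub>m N + Y * X)"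
    unfolding kdet_def
    by (rule arg_cong[of _ _ Determinant.det]) (rule eq_matI, auto simp: X_def Y_def scalar_prod_def atLeast0LessThan)
  ultimately show ?thesis using 1 2 by simp
qed

lemma det_permanental_eq:
  "Determinant.det (1\<^sub>m n + Matrix.mat n n (\<lambda>(p, q). K (i p) (i q)) * mat_diag n s) =
    kdet n (\<lambda>p q. of_bool (p = q) + K (i p) (i q) * s q)"
proof -
  have "Matrix.mat n n (\<lambda>(p, q). K (i p) (i q)) * mat_diag n s = Matrix.mat n n (\<lambda>(p, q). K (i p) (i q) * s q)"
    by (subst mat_diag_mult_right[of _ n]) auto
  then show ?thesis unfolding kdet_def
    by (intro arg_cong[of _ _ Determinant.det]) auto
qed

text \<open>Weights that vanish off the image of \<open>i\<close> remove the other indices from the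
  determinant, and the order of the selected ones is irrelevant. The selection is a 0-1 matrix,
  which Sylvester's identity moves to the other side. Arbitrary distinct indices are thus reduced to
  an initial segment.\<close>

lemma kdet_select:
  assumes i: "inj_on i {..<n}" "i ` {..<n} \<subseteq> {..<N}"
    and s': "\<And>p. p < n \<Longrightarrow> s' (i p) = s p" "\<And>l. l < N \<Longrightarrow> l \<notin> i ` {..<n} \<Longrightarrow> s' l = 0"
  shows "kdet n (\<lambda>p q. of_bool (p = q) + K (i p) (i q) * s q) = kdet N (\<lambda>k l. of_bool (k = l) + K k l * s' l)"
proof -
  have "kdet n (\<lambda>p q. of_bool (p = q) + K (i p) (i q) * s q) =
      kdet n (\<lambda>p q. of_bool (p = q) + (\<Sum>l<N. of_bool (i p = l) * (K l (i q) * s q)))"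
  proof (rule kdet_cong)
    fix p q assume "p < n"
    then have ip: "i p < N" using i(2) by auto
    have "(\<Sum>l<N. of_bool (i p = l) * (K l (i q) * s q)) = (\<Sum>l<N. if i p = l then K l (i q) * s q else 0)"
      by (intro sum.cong) auto
    then show "of_bool (p = q) + K (i p) (i q) * s q = of_bool (p = q) + (\<Sum>l<N. of_bool (i p = l) * (K l (i q) * s q))"
      using ip by simp
  qed
  also have "\<dots> = kdet N (\<lambda>k l. of_bool (k = l) + (\<Sum>p<n. K k (i p) * s p * of_bool (i p = l)))"
    by (rule Sylvester_determinant)
  also have "\<dots> = kdet N (\<lambda>k l. of_bool (k = l) + K k l * s' l)"
  proof (rule kdet_cong)
    fix k l assume l: "l < N"
    have "(\<Sum>p<n. K k (i p) * s p * of_bool (i p = l)) = K k l * s' l"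
    proof (cases "l \<in> i ` {..<n}")
      case True
      then obtain r where r: "r < n" "l = i r" by auto
      have "(\<Sum>p<n. K k (i p) * s p * of_bool (i p = l)) = (\<Sum>p<n. if p = r then K k (i p) * s p else 0)"
        using r inj_onD[OF i(1), of _ r] by (intro sum.cong) auto
      then show ?thesis using r s'(1) by simp
    next
      case False
      then have "(\<Sum>p<n. K k (i p) * s p * of_bool (i p = l)) = 0" by (intro sum.neutral) auto
      then show ?thesis using s'(2)[OF l False] by simp
    qed
    then show "of_bool (k = l) + (\<Sum>p<n. K k (i p) * s p * of_bool (i p = l)) = of_bool (k = l) + K k l * s' l"
      by simp
  qed
  finally show ?thesis .
qed

section \<open>Laplace transforms of measures on the orthant\<close>

text \<open>The sum of a sequence of measures, with the sum written as an integral over counting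
  measure so that limits and sums pass through it by the theorems for integrals.\<close>

definition sum_measure :: "'a measure \<Rightarrow> (nat \<Rightarrow> 'a measure) \<Rightarrow> 'a measure"
  where "sum_measure M \<mu> = measure_of (space M) (sets M) (\<lambda>A. \<integral>\<^sup>+k. emeasure (\<mu> k) A \<partial>count_space UNIV)"

lemma sets_sum_measure[simp, measurable_cong]: "sets (sum_measure M \<mu>) = sets M"
  and space_sum_measure[simp]: "space (sum_measure M \<mu>) = space M"
  by (simp_all add: sum_measure_def)

lemma emeasure_sum_measure:
  assumes \<mu>: "\<And>k. sets (\<mu> k) = sets M" and A: "A \<in> sets M"
  shows "emeasure (sum_measure M \<mu>) A = (\<integral>\<^sup>+k. emeasure (\<mu> k) A \<partial>count_space UNIV)"
proof (rule emeasure_measure_of[OF sum_measure_def])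
  show "countably_additive (sets (sum_measure M \<mu>)) (\<lambda>A. \<integral>\<^sup>+k. emeasure (\<mu> k) A \<partial>count_space UNIV)"
  proof (rule countably_additiveI)
    fix A :: "nat \<Rightarrow> _" assume A: "range A \<subseteq> sets (sum_measure M \<mu>)" "disjoint_family A"
    have "(\<Sum>i. \<integral>\<^sup>+k. emeasure (\<mu> k) (A i) \<partial>count_space UNIV) = (\<integral>\<^sup>+k. (\<Sum>i. emeasure (\<mu> k) (A i)) \<partial>count_space UNIV)"
      by (rule nn_integral_suminf[symmetric]) simp
    also have "\<dots> = (\<integral>\<^sup>+k. emeasure (\<mu> k) (\<Union>i. A i) \<partial>count_space UNIV)"
      using A by (intro nn_integral_cong suminf_emeasure) (auto simp: \<mu>)
    finally show "(\<Sum>i. \<integral>\<^sup>+k. emeasure (\<mu> k) (A i) \<partial>count_space UNIV) = (\<integral>\<^sup>+k. emeasure (\<mu> k) (\<Union>i. A i) \<partial>count_space UNIV)" .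
  qed
qed (use sets.space_closed A in \<open>auto simp: positive_def\<close>)

lemma nn_integral_sum_measure:
  assumes \<mu>: "\<And>k. sets (\<mu> k) = sets M" and f: "f \<in> borel_measurable M"
  shows "integral\<^sup>N (sum_measure M \<mu>) f = (\<integral>\<^sup>+k. integral\<^sup>N (\<mu> k) f \<partial>count_space UNIV)"
proof -
  have sp: "space (\<mu> k) = space M" for k using \<mu> by (rule sets_eq_imp_space_eq)
  note [measurable_cong] = \<mu>
  have m: "g \<in> borel_measurable (\<mu> k)" if "g \<in> borel_measurable M" for g :: "_ \<Rightarrow> ennreal" and k
    using that by simp
  from f show ?thesis
  proof (induction rule: borel_measurable_induct)
    case (cong f g)
    then show ?case
      by (simp cong: nn_integral_cong_simp add: sp)
  next
    case (set A)
    then show ?case by (simp add: emeasure_sum_measure[OF \<mu>] \<mu>)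
  next
    case (mult u c)
    then show ?case by (simp add: nn_integral_cmult m)
  next
    case (add u v)
    then show ?case by (simp add: nn_integral_add m)
  next
    case (seq U)
    have "integral\<^sup>N (sum_measure M \<mu>) (Sup (range U)) = (SUP i. integral\<^sup>N (sum_measure M \<mu>) (U i))"
      unfolding SUP_apply[abs_def] using seq by (intro nn_integral_monotone_convergence_SUP) auto
    also have "\<dots> = (SUP i. \<integral>\<^sup>+k. integral\<^sup>N (\<mu> k) (U i) \<partial>count_space UNIV)"
      using seq by simp
    also have "\<dots> = (\<integral>\<^sup>+k. (SUP i. integral\<^sup>N (\<mu> k) (U i)) \<partial>count_space UNIV)"
      using seq(3) by (intro nn_integral_monotone_convergence_SUP[symmetric])
        (auto simp: incseq_def le_fun_def intro!: nn_integral_mono)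
    also have "\<dots> = (\<integral>\<^sup>+k. integral\<^sup>N (\<mu> k) (Sup (range U)) \<partial>count_space UNIV)"
      unfolding SUP_apply[abs_def] using seq
      by (intro nn_integral_cong nn_integral_monotone_convergence_SUP[symmetric]) (auto simp: m)
    finally show ?case .
  qed
qed

abbreviation borel_fun :: "nat \<Rightarrow> (nat \<Rightarrow> real) measure"
  where "borel_fun n \<equiv> PiM {..<n} (\<lambda>_. borel)"

abbreviation nonneg_upto :: "nat \<Rightarrow> (nat \<Rightarrow> real) \<Rightarrow> bool"
  where "nonneg_upto n z \<equiv> \<forall>i<n. 0 \<le> z i"

definition laplace_kernel :: "nat \<Rightarrow> (nat \<Rightarrow> real) \<Rightarrow> (nat \<Rightarrow> real) \<Rightarrow> real"
  where "laplace_kernel n s z = exp (- (\<Sum>i<n. s i * z i))"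

lemma laplace_kernel_nonneg: "0 \<le> laplace_kernel n s z"
  by (simp add: laplace_kernel_def)

abbreviation laplace_integral :: "nat \<Rightarrow> (nat \<Rightarrow> real) measure \<Rightarrow> (nat \<Rightarrow> real) \<Rightarrow> ennreal"
  where "laplace_integral n \<mu> s \<equiv> \<integral>\<^sup>+z. ennreal (laplace_kernel n s z) \<partial>\<mu>"

text \<open>Nonnegativity of \<open>\<phi> s\<close> is part of the definition because
  \<open>ennreal\<close> would truncate a negative value to 0.\<close>

definition laplace_of :: "nat \<Rightarrow> (nat \<Rightarrow> real) measure \<Rightarrow> ((nat \<Rightarrow> real) \<Rightarrow> real) \<Rightarrow> bool"
  where "laplace_of n \<mu> \<phi> \<longleftrightarrow> finite_measure \<mu> \<and> sets \<mu> = sets (borel_fun n) \<and> (AE z in \<mu>. nonneg_upto n z) \<and>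
    (\<forall>s. nonneg_upto n s \<longrightarrow> 0 \<le> \<phi> s \<and> laplace_integral n \<mu> s = ennreal (\<phi> s))"

text \<open>The elimination only has to know that these functions are closed under products and
  convergent sums, so the measure is hidden.\<close>

definition laplace_transform :: "nat \<Rightarrow> ((nat \<Rightarrow> real) \<Rightarrow> real) \<Rightarrow> bool"
  where "laplace_transform n \<phi> \<longleftrightarrow> (\<exists>\<mu>. laplace_of n \<mu> \<phi>)"

lemma measurable_laplace_kernel[measurable]: "laplace_kernel n s \<in> borel_measurable (borel_fun n)"
  unfolding laplace_kernel_def by measurable

text \<open>Finiteness comes for free: the total mass is the value at \<open>s = 0\<close>.\<close>

lemma laplace_ofI:
  assumes sets: "sets \<mu> = sets (borel_fun n)" and "AE z in \<mu>. nonneg_upto n z"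
    and "\<And>s. nonneg_upto n s \<Longrightarrow> 0 \<le> \<phi> s"
    and l: "\<And>s. nonneg_upto n s \<Longrightarrow> laplace_integral n \<mu> s = ennreal (\<phi> s)"
  shows "laplace_of n \<mu> \<phi>"
proof -
  have "emeasure \<mu> (space \<mu>) = ennreal (\<phi> (\<lambda>_. 0))"
    using l[of "\<lambda>_. 0"] by (simp add: laplace_kernel_def)
  then have "finite_measure \<mu>" by (intro finite_measureI) simp
  with assms show ?thesis by (simp add: laplace_of_def)
qed

lemma laplace_transformD: "laplace_transform n \<phi> \<Longrightarrow> nonneg_upto n s \<Longrightarrow> 0 \<le> \<phi> s"
  by (auto simp: laplace_transform_def laplace_of_def)

lemma laplace_transform_cong:
  assumes "laplace_transform n \<phi>" "\<And>s. nonneg_upto n s \<Longrightarrow> \<phi> s = \<psi> s"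
  shows "laplace_transform n \<psi>"
  using assms by (auto simp: laplace_transform_def laplace_of_def)

lemma laplace_transform_const:
  assumes c: "0 \<le> c"
  shows "laplace_transform n (\<lambda>_. c)"
proof -
  let ?z = "\<lambda>i\<in>{..<n}. 0 :: real"
  let ?\<mu> = "density (return (borel_fun n) ?z) (\<lambda>_. ennreal c)"
  have z: "?z \<in> space (borel_fun n)" by (simp add: space_PiM)
  have "laplace_of n ?\<mu> (\<lambda>_. c)"
  proof (rule laplace_ofI)
    have "AE z in return (borel_fun n) ?z. nonneg_upto n z"
      using z by (subst AE_return) auto
    then show "AE z in ?\<mu>. nonneg_upto n z" by (subst AE_density) auto
    show "laplace_integral n ?\<mu> s = ennreal c" for s
      using z c by (subst nn_integral_density) (auto simp: nn_integral_return laplace_kernel_def)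
  qed (use c in auto)
  then show ?thesis by (auto simp: laplace_transform_def)
qed

text \<open>The transform of the sum of the measures; convergence at \<open>s = 0\<close> keeps its
  mass finite.\<close>

lemma laplace_transform_sums:
  assumes f: "\<And>k. laplace_transform n (f k)"
    and g: "\<And>s. nonneg_upto n s \<Longrightarrow> (\<lambda>k. f k s) sums g s"
  shows "laplace_transform n g"
proof -
  obtain \<mu> where \<mu>: "\<And>k. laplace_of n (\<mu> k) (f k)"
    using f unfolding laplace_transform_def by metis
  then have sets: "sets (\<mu> k) = sets (borel_fun n)" for k by (simp add: laplace_of_def)
  note int = nn_integral_sum_measure[of \<mu> "borel_fun n", OF sets]
  let ?\<mu> = "sum_measure (borel_fun n) \<mu>"
  have "laplace_of n ?\<mu> g"
  proof (rule laplace_ofI)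
    have m: "{z \<in> space (borel_fun n). \<not> nonneg_upto n z} \<in> sets (borel_fun n)" by measurable
    have "emeasure (\<mu> k) {z \<in> space (borel_fun n). \<not> nonneg_upto n z} = 0" for k
    proof -
      have "AE z in \<mu> k. nonneg_upto n z" using \<mu>[of k] by (simp add: laplace_of_def)
      then show ?thesis
        using m sets_eq_imp_space_eq[OF sets[of k]] by (subst (asm) AE_iff_measurable[OF _ refl]) (auto simp: sets)
    qed
    then have "emeasure ?\<mu> {z \<in> space (borel_fun n). \<not> nonneg_upto n z} = 0"
      using m by (subst emeasure_sum_measure[OF sets]) auto
    then show "AE z in ?\<mu>. nonneg_upto n z"
      using m by (subst AE_iff_measurable[OF _ refl]) auto
  next
    fix s assume s: "nonneg_upto n s"
    have 0: "0 \<le> f k s" for k using f s by (rule laplace_transformD)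
    show "0 \<le> g s" using sums_le[OF _ sums_zero g[OF s]] 0 by simp
    have "laplace_integral n ?\<mu> s = (\<integral>\<^sup>+k. ennreal (f k s) \<partial>count_space UNIV)"
      using \<mu> s by (subst int) (auto simp: laplace_of_def intro!: nn_integral_cong)
    also have "\<dots> = (\<Sum>k. ennreal (f k s))" by (rule nn_integral_count_space_nat)
    also have "\<dots> = ennreal (g s)"
      using g[OF s] 0 by (subst suminf_ennreal2) (auto simp: sums_iff)
    finally show "laplace_integral n ?\<mu> s = ennreal (g s)" .
  qed simp
  then show ?thesis by (auto simp: laplace_transform_def)
qed

lemma laplace_transform_add:
  assumes f: "laplace_transform n f" and g: "laplace_transform n g"
  shows "laplace_transform n (\<lambda>s. f s + g s)"
proof (rule laplace_transform_sums[of n "\<lambda>k. if k = 0 then f else if k = 1 then g else (\<lambda>_. 0)"])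
  show "laplace_transform n (if k = 0 then f else if k = 1 then g else (\<lambda>_. 0))" for k :: nat
    using f g by (simp add: laplace_transform_const)
  show "(\<lambda>k. (if k = 0 then f else if k = 1 then g else (\<lambda>_. 0)) s) sums (f s + g s)" for s
    using sums_finite[of "{0::nat, 1}" "\<lambda>k. (if k = 0 then f else if k = 1 then g else (\<lambda>_. 0)) s"] by simp
qed

lemma measurable_pointwise_add:
  assumes "sets \<mu> = sets (borel_fun n)" "sets \<nu> = sets (borel_fun n)"
  shows "(\<lambda>(x, y). \<lambda>i\<in>{..<n}. x i + y i :: real) \<in> \<mu> \<Otimes>\<^sub>M \<nu> \<rightarrow>\<^sub>M borel_fun n"
proof -
  note [measurable_cong] = assms
  show ?thesis
    by (auto simp: case_prod_beta intro!: measurable_restrict borel_measurable_add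
        measurable_compose[OF measurable_fst] measurable_compose[OF measurable_snd] measurable_component_singleton)
qed

text \<open>Convolution: the law of the sum of two independent vectors.\<close>

definition add_measure :: "nat \<Rightarrow> (nat \<Rightarrow> real) measure \<Rightarrow> (nat \<Rightarrow> real) measure \<Rightarrow> (nat \<Rightarrow> real) measure"
  where "add_measure n \<mu> \<nu> = distr (\<mu> \<Otimes>\<^sub>M \<nu>) (borel_fun n) (\<lambda>(x, y). \<lambda>i\<in>{..<n}. x i + y i)"

lemma laplace_of_add_measure:
  assumes \<mu>: "laplace_of n \<mu> f" and \<nu>: "laplace_of n \<nu> g"
  shows "laplace_of n (add_measure n \<mu> \<nu>) (\<lambda>s. f s * g s)"
proof (rule laplace_ofI)
  have sets: "sets \<mu> = sets (borel_fun n)" "sets \<nu> = sets (borel_fun n)"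
    using \<mu> \<nu> by (auto simp: laplace_of_def)
  note [measurable_cong] = sets
  interpret m: finite_measure \<mu> using \<mu> by (simp add: laplace_of_def)
  interpret n: finite_measure \<nu> using \<nu> by (simp add: laplace_of_def)
  interpret pair_sigma_finite \<mu> \<nu> ..
  note T = measurable_pointwise_add[OF sets]
  have ae: "AE x in \<mu>. nonneg_upto n x" "AE x in \<nu>. nonneg_upto n x"
    using \<mu> \<nu> by (auto simp: laplace_of_def)
  show "AE z in add_measure n \<mu> \<nu>. nonneg_upto n z"
    unfolding add_measure_def
  proof (subst AE_distr_iff[OF T])
    have "AE y in \<nu>. nonneg_upto n (case (x, y) of (x, y) \<Rightarrow> \<lambda>i\<in>{..<n}. x i + y i)" if "nonneg_upto n x" for x
      using ae(2) by (rule eventually_mono) (use that in auto)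
    then have "AE x in \<mu>. AE y in \<nu>. nonneg_upto n (case (x, y) of (x, y) \<Rightarrow> \<lambda>i\<in>{..<n}. x i + y i)"
      using ae(1) by (auto elim: eventually_mono)
    then show "AE x in \<mu> \<Otimes>\<^sub>M \<nu>. nonneg_upto n (case x of (x, y) \<Rightarrow> \<lambda>i\<in>{..<n}. x i + y i)"
      by (intro AE_pair_measure) (auto simp: case_prod_beta)
  qed auto
  fix s assume s: "nonneg_upto n s"
  show "0 \<le> f s * g s" using \<mu> \<nu> s by (simp add: laplace_of_def)
  have k: "laplace_kernel n s (\<lambda>i\<in>{..<n}. x i + y i) = laplace_kernel n s x * laplace_kernel n s y" for x y
  proof -
    have "(\<Sum>i<n. s i * (\<lambda>i\<in>{..<n}. x i + y i) i) = (\<Sum>i<n. s i * x i) + (\<Sum>i<n. s i * y i)"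
      by (simp add: distrib_left sum.distrib)
    then show ?thesis unfolding laplace_kernel_def by (simp only: minus_add_distrib exp_add)
  qed
  have "laplace_integral n (add_measure n \<mu> \<nu>) s =
      (\<integral>\<^sup>+(x, y). ennreal (laplace_kernel n s x) * ennreal (laplace_kernel n s y) \<partial>(\<mu> \<Otimes>\<^sub>M \<nu>))"
    unfolding add_measure_def
    by (subst nn_integral_distr[OF T], measurable)
      (auto simp: k ennreal_mult laplace_kernel_nonneg simp del: restrict_apply intro!: nn_integral_cong)
  also have "\<dots> = (\<integral>\<^sup>+x. \<integral>\<^sup>+y. ennreal (laplace_kernel n s x) * ennreal (laplace_kernel n s y) \<partial>\<nu> \<partial>\<mu>)"
    by (subst n.nn_integral_fst[symmetric]) auto
  also have "\<dots> = (\<integral>\<^sup>+x. ennreal (laplace_kernel n s x) \<partial>\<mu>) * (\<integral>\<^sup>+y. ennreal (laplace_kernel n s y) \<partial>\<nu>)"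
    by (simp add: nn_integral_cmult nn_integral_multc)
  also have "\<dots> = ennreal (f s * g s)"
    using \<mu> \<nu> s by (simp add: laplace_of_def ennreal_mult)
  finally show "laplace_integral n (add_measure n \<mu> \<nu>) s = ennreal (f s * g s)" .
qed (simp add: add_measure_def)

lemma laplace_transform_mult:
  "laplace_transform n f \<Longrightarrow> laplace_transform n g \<Longrightarrow> laplace_transform n (\<lambda>s. f s * g s)"
  unfolding laplace_transform_def by (metis laplace_of_add_measure)

lemma laplace_transform_power: "laplace_transform n f \<Longrightarrow> laplace_transform n (\<lambda>s. f s ^ k)"
  by (induction k) (auto simp: laplace_transform_const laplace_transform_mult)

text \<open>The density \<open>exp (- (a * x))\<close> on the half-line, placed on the
  \<open>i\<close>-th axis.\<close>

lemma laplace_transform_recip: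
  assumes a: "0 < a" and i: "i < n"
  shows "laplace_transform n (\<lambda>s. 1 / (a + s i))"
proof -
  let ?T = "\<lambda>x::real. \<lambda>j\<in>{..<n}. if j = i then x else 0"
  let ?D = "density lborel (\<lambda>x. ennreal (exp (- (a * x))) * indicator {0..} x)"
  let ?\<mu> = "distr ?D (borel_fun n) ?T"
  have T: "?T \<in> lborel \<rightarrow>\<^sub>M borel_fun n" by (intro measurable_restrict) auto
  have T': "?T \<in> ?D \<rightarrow>\<^sub>M borel_fun n" using T by simp
  have "laplace_of n ?\<mu> (\<lambda>s. 1 / (a + s i))"
  proof (rule laplace_ofI)
    show "AE z in ?\<mu>. nonneg_upto n z"
      by (subst AE_distr_iff[OF T'], measurable, subst AE_density) (auto split: split_indicator)
    fix s assume s: "nonneg_upto n s"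
    have as: "0 < a + s i" using a s i by (simp add: add_pos_nonneg)
    then show "0 \<le> 1 / (a + s i)" by simp
    have "(\<Sum>j<n. s j * ?T x j) = (\<Sum>j<n. if j = i then s i * x else 0)" for x
      by (intro sum.cong) auto
    then have k: "laplace_kernel n s (?T x) = exp (- (s i * x))" for x
      using i by (simp add: laplace_kernel_def)
    have "laplace_integral n ?\<mu> s =
        (\<integral>\<^sup>+x. ennreal (exp (- (a * x))) * indicator {0..} x * ennreal (exp (- (s i * x))) \<partial>lborel)"
      by (subst nn_integral_distr[OF T'], measurable, subst nn_integral_density) (auto simp: k simp del: restrict_apply)
    also have "\<dots> = (\<integral>\<^sup>+x. ennreal (exp (- ((a + s i) * x))) * indicator {0..} x \<partial>lborel)"
      by (intro nn_integral_cong)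
        (auto simp: ennreal_mult[symmetric] exp_add[symmetric] distrib_right split: split_indicator)
    also have "\<dots> = ennreal (1 / (a + s i))" by (rule nn_integral_exp_Ici[OF as])
    finally show "laplace_integral n ?\<mu> s = ennreal (1 / (a + s i))" .
  qed simp
  then show ?thesis by (auto simp: laplace_transform_def)
qed

text \<open>In the binomial series with exponent \<open>- \<alpha>\<close> and argument
  \<open>- y\<close> the signs cancel.\<close>

lemma laplace_transform_one_minus_powr:
  assumes y: "laplace_transform n y" and lt: "\<And>s. nonneg_upto n s \<Longrightarrow> y s < 1" and \<alpha>: "0 < \<alpha>"
  shows "laplace_transform n (\<lambda>s. (1 - y s) powr (- \<alpha>))"
proof (rule laplace_transform_sums[of n "\<lambda>k s. pochhammer \<alpha> k / fact k * y s ^ k"])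
  show "laplace_transform n (\<lambda>s. pochhammer \<alpha> k / fact k * y s ^ k)" for k
    using \<alpha> by (intro laplace_transform_mult laplace_transform_const laplace_transform_power y)
      (auto simp: pochhammer_nonneg)
  fix s assume s: "nonneg_upto n s"
  have "(\<lambda>k. (- \<alpha> gchoose k) * (- y s) ^ k) sums (1 + - y s) powr (- \<alpha>)"
    using lt[OF s] laplace_transformD[OF y s] by (intro gen_binomial_real) auto
  moreover have "(- \<alpha> gchoose k) * (- y s) ^ k = pochhammer \<alpha> k / fact k * y s ^ k" for k
    by (simp add: gbinomial_pochhammer power_minus[of "y s"])
  ultimately show "(\<lambda>k. pochhammer \<alpha> k / fact k * y s ^ k) sums (1 - y s) powr (- \<alpha>)" by simp
qed

text \<open>Eliminating the last index by a Schur complement preserves the form of the matrix: only the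
  subtracted entries \<open>b\<close> change, and they remain Laplace transforms. The pivot is \<open>(a + s) (1 - y)\<close>
  with a Laplace transform \<open>y < 1\<close>, and \<open>(1 - y) powr (- \<alpha>)\<close> is a power series in \<open>y\<close> with
  nonnegative coefficients.\<close>

lemma laplace_transform_Schur:
  fixes a x :: "nat \<Rightarrow> real" and b :: "nat \<Rightarrow> nat \<Rightarrow> (nat \<Rightarrow> real) \<Rightarrow> real"
  defines "M \<equiv> \<lambda>b s p q. (if p = q then a p + s p else 0) - b p q s"
  assumes "m \<le> n" and \<alpha>: "0 < \<alpha>"
    and "\<And>p q. p < m \<Longrightarrow> q < m \<Longrightarrow> laplace_transform n (b p q)"
    and "\<And>p. p < m \<Longrightarrow> 0 < a p" and "\<And>p. p < m \<Longrightarrow> 0 < x p"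
    and "\<And>p s. p < m \<Longrightarrow> nonneg_upto n s \<Longrightarrow> 0 < (\<Sum>q<m. M b s p q * x q)"
  shows "\<exists>\<phi>. laplace_transform n \<phi> \<and> (\<forall>s. nonneg_upto n s \<longrightarrow> 0 < kdet m (M b s) \<and>
    kdet m (M b s) powr (- \<alpha>) = (\<Prod>p<m. (a p + s p) powr (- \<alpha>)) * \<phi> s)"
  using assms(2,4-)
proof (induction m arbitrary: b)
  case 0
  show ?case by (rule exI[of _ "\<lambda>_. 1"]) (simp add: kdet_0 laplace_transform_const)
next
  case (Suc m)
  note LT = Suc.prems(2) and a = Suc.prems(3) and x = Suc.prems(4) and pos = Suc.prems(5)
  have mn: "m < n" using Suc.prems(1) by simp
  define y where "y s = b m m s * (1 / (a m + s m))" for s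
  have LTy: "laplace_transform n y"
    unfolding y_def using mn by (intro laplace_transform_mult LT laplace_transform_recip a) auto
  have b0: "0 \<le> b p q s" if "p \<le> m" "q \<le> m" "nonneg_upto n s" for p q s
    using laplace_transformD[OF LT that(3)] that by simp
  have as: "0 < a m + s m" if "nonneg_upto n s" for s
    using a[of m] that mn by (simp add: add_pos_nonneg)
  define d where "d s = a m + s m - b m m s" for s
  have d: "0 < d s" if s: "nonneg_upto n s" for s
  proof -
    \<comment> \<open>The positive vector \<open>x\<close> with positive image certifies the pivot:
      the off-diagonal entries contribute nothing positive, so \<open>d s * x m\<close> is at least
      the whole row sum.\<close>
    have "(\<Sum>q<Suc m. M b s m q * x q) = d s * x m - (\<Sum>q<m. b m q s * x q)"
      by (simp add: M_def d_def sum_negf[symmetric])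
    moreover have "0 \<le> (\<Sum>q<m. b m q s * x q)"
      using b0[OF _ _ s] x by (intro sum_nonneg mult_nonneg_nonneg) (auto intro: less_imp_le)
    ultimately have "0 < d s * x m" using pos[of m s] s by simp
    then show ?thesis using x[of m] by (simp add: zero_less_mult_iff)
  qed
  have dy: "d s = (a m + s m) * (1 - y s)" "y s < 1" if s: "nonneg_upto n s" for s
  proof -
    show e: "d s = (a m + s m) * (1 - y s)" using as[OF s] by (simp add: d_def y_def field_simps)
    show "y s < 1" using d[OF s] as[OF s] unfolding e by (simp add: zero_less_mult_iff)
  qed
  \<comment> \<open>Used with exponent \<open>\<alpha>\<close> for the determinant and with exponent
    1 for the reciprocal of the pivot.\<close>
  have powr: "laplace_transform n (\<lambda>s. (1 - y s) powr (- c))" if "0 < c" for c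
    using LTy dy(2) that by (rule laplace_transform_one_minus_powr)
  have LTd: "laplace_transform n (\<lambda>s. 1 / d s)"
  proof (rule laplace_transform_cong)
    show "laplace_transform n (\<lambda>s. 1 / (a m + s m) * (1 - y s) powr (- 1))"
      using mn by (intro laplace_transform_mult powr laplace_transform_recip a) auto
    show "1 / (a m + s m) * (1 - y s) powr (- 1) = 1 / d s" if "nonneg_upto n s" for s
      using dy[OF that] by (simp add: powr_minus divide_inverse)
  qed
  define b' where "b' p q s = b p q s + b p m s * b m q s * (1 / d s)" for p q s
  have M': "M b' s p q = M b s p q - M b s p m * M b s m q / M b s m m" if "p < m" "q < m" for p q s
    using that by (simp add: M_def b'_def d_def)
  obtain \<phi> where \<phi>: "laplace_transform n \<phi>" "\<And>s. nonneg_upto n s \<Longrightarrow> 0 < kdet m (M b' s) \<and>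
      kdet m (M b' s) powr (- \<alpha>) = (\<Prod>p<m. (a p + s p) powr (- \<alpha>)) * \<phi> s"
  proof -
    have "\<exists>\<phi>. laplace_transform n \<phi> \<and> (\<forall>s. nonneg_upto n s \<longrightarrow> 0 < kdet m (M b' s) \<and>
      kdet m (M b' s) powr (- \<alpha>) = (\<Prod>p<m. (a p + s p) powr (- \<alpha>)) * \<phi> s)"
    proof (rule Suc.IH)
      show "laplace_transform n (b' p q)" if "p < m" "q < m" for p q
        unfolding b'_def using that by (intro laplace_transform_add laplace_transform_mult LT LTd) auto
    next
      fix p s assume p: "p < m" and s: "nonneg_upto n s"
      let ?r = "\<lambda>p. \<Sum>q<Suc m. M b s p q * x q"
      have Mmm: "M b s m m = d s" by (simp add: M_def d_def)
      \<comment> \<open>Row \<open>p\<close> of the Schur complement applied to \<open>x\<close> is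
        row \<open>p\<close> of the old matrix plus a nonnegative multiple of its last row, so the
        condition on \<open>x\<close> survives the elimination.\<close>
      have "(\<Sum>q<m. M b' s p q * x q) = (\<Sum>q<m. M b s p q * x q - M b s p m / d s * (M b s m q * x q))"
        using p by (intro sum.cong) (simp_all add: M' Mmm algebra_simps)
      also have "\<dots> = (\<Sum>q<m. M b s p q * x q) - M b s p m / d s * (\<Sum>q<m. M b s m q * x q)"
        by (simp add: sum_subtractf sum_distrib_left)
      also have "\<dots> = ?r p + (- M b s p m / d s) * ?r m"
        using d[OF s] by (simp add: Mmm field_simps)
      finally have e: "(\<Sum>q<m. M b' s p q * x q) = ?r p + (- M b s p m / d s) * ?r m" .
      have "0 \<le> - M b s p m / d s"
        using b0[of p m s] p s d[OF s] by (simp add: M_def)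
      then show "0 < (\<Sum>q<m. M b' s p q * x q)"
        unfolding e using pos[of p s] pos[of m s] p s
        by (intro add_pos_nonneg mult_nonneg_nonneg) auto
    qed (use mn a x in auto)
    then show ?thesis using that by blast
  qed
  have det: "kdet (Suc m) (M b s) = d s * kdet m (M b' s)" if s: "nonneg_upto n s" for s
  proof -
    have Mmm: "M b s m m = d s" by (simp add: M_def d_def)
    have "kdet (Suc m) (M b s) = d s * kdet m (\<lambda>p q. M b s p q - M b s p m * M b s m q / M b s m m)"
      using kdet_Schur_complement[of "M b s" m] d[OF s] by (simp add: Mmm)
    also have "kdet m (\<lambda>p q. M b s p q - M b s p m * M b s m q / M b s m m) = kdet m (M b' s)"
      by (rule kdet_cong) (simp add: M')
    finally show ?thesis .
  qed
  show ?case
  proof (intro exI conjI allI impI)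
    show "laplace_transform n (\<lambda>s. (1 - y s) powr (- \<alpha>) * \<phi> s)"
      by (intro laplace_transform_mult powr \<alpha> \<phi>)
    fix s assume s: "nonneg_upto n s"
    show "0 < kdet (Suc m) (M b s)" using det[OF s] d[OF s] \<phi>(2)[OF s] by simp
    have "kdet (Suc m) (M b s) powr (- \<alpha>) = d s powr (- \<alpha>) * kdet m (M b' s) powr (- \<alpha>)"
      using det[OF s] d[OF s] \<phi>(2)[OF s] by (simp add: powr_mult)
    also have "d s powr (- \<alpha>) = (a m + s m) powr (- \<alpha>) * (1 - y s) powr (- \<alpha>)"
      using dy[OF s] as[OF s] by (simp add: powr_mult)
    also have "kdet m (M b' s) powr (- \<alpha>) = (\<Prod>p<m. (a p + s p) powr (- \<alpha>)) * \<phi> s"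
      using \<phi>(2)[OF s] by simp
    finally show "kdet (Suc m) (M b s) powr (- \<alpha>) =
        (\<Prod>p<Suc m. (a p + s p) powr (- \<alpha>)) * ((1 - y s) powr (- \<alpha>) * \<phi> s)"
      by simp
  qed
qed

section \<open>Gamma distributions\<close>

text \<open>Shape \<open>\<alpha>\<close> and rate \<open>a\<close>, that is, scale
  \<open>1 / a\<close>.\<close>

definition gamma_measure :: "real \<Rightarrow> real \<Rightarrow> real measure"
  where "gamma_measure \<alpha> a = density lborel
    (\<lambda>x. ennreal (a powr \<alpha> / Gamma \<alpha> * (x powr (\<alpha> - 1) * exp (- (a * x)))) * indicator {0..} x)"

lemma sets_gamma_measure[simp, measurable_cong]: "sets (gamma_measure \<alpha> a) = sets borel"
  and space_gamma_measure[simp]: "space (gamma_measure \<alpha> a) = UNIV"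
  by (simp_all add: gamma_measure_def)

lemma nn_integral_powr_exp:
  assumes \<alpha>: "0 < \<alpha>" and c: "0 < c"
  shows "(\<integral>\<^sup>+x. ennreal (x powr (\<alpha> - 1) * exp (- (c * x))) * indicator {0..} x \<partial>lborel) = ennreal (Gamma \<alpha> * c powr (- \<alpha>))"
proof -
  let ?I = "\<integral>\<^sup>+x. ennreal (x powr (\<alpha> - 1) * exp (- (c * x))) * indicator {0..} x \<partial>lborel"
  let ?K = "\<integral>\<^sup>+x. indicator {0..} (c * x) * ennreal ((c * x) powr (\<alpha> - 1) / exp (c * x)) \<partial>lborel"
  have "(\<integral>\<^sup>+x. indicator {0..} x * ennreal (x powr (\<alpha> - 1) / exp x) \<partial>lborel) = ennreal (Gamma \<alpha>)"
    by (subst mult.commute, rule nn_integral_has_integral_lebesgue'[OF _ Gamma_integral_real[OF \<alpha>]]) auto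
  moreover have "(\<integral>\<^sup>+x. indicator {0..} x * ennreal (x powr (\<alpha> - 1) / exp x) \<partial>lborel) =
     ennreal c * ?K"
    using c by (subst nn_integral_real_affine[where c = c and t = 0]) auto
  moreover have "?K =
      (\<integral>\<^sup>+x. ennreal (c powr (\<alpha> - 1)) * (ennreal (x powr (\<alpha> - 1) * exp (- (c * x))) * indicator {0..} x) \<partial>lborel)"
    using c by (intro nn_integral_cong)
      (auto simp: powr_mult exp_minus divide_inverse ennreal_mult[symmetric] mult_ac zero_le_mult_iff split: split_indicator)
  moreover have "\<dots> = ennreal (c powr (\<alpha> - 1)) * ?I"
    by (rule nn_integral_cmult) measurable
  ultimately have e: "ennreal (c powr \<alpha>) * ?I = ennreal (Gamma \<alpha>)"
    using c by (simp add: mult.assoc[symmetric] ennreal_mult[symmetric] powr_mult_base)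
  have "?I = ennreal (c powr (- \<alpha>)) * (ennreal (c powr \<alpha>) * ?I)"
    using c by (simp add: mult.assoc[symmetric] ennreal_mult[symmetric] powr_minus)
  then show ?thesis unfolding e using \<alpha> by (simp add: ennreal_mult[symmetric] mult.commute Gamma_real_pos less_imp_le)
qed

text \<open>Negative \<open>s\<close> above \<open>- a\<close> are included because the upper tail
  is estimated through an exponential moment.\<close>

lemma gamma_measure_laplace:
  assumes \<alpha>: "0 < \<alpha>" and a: "0 < a" and s: "- a < s"
  shows "(\<integral>\<^sup>+x. ennreal (exp (- (s * x))) \<partial>gamma_measure \<alpha> a) = ennreal ((a / (a + s)) powr \<alpha>)"
proof -
  have G: "0 < Gamma \<alpha>" using \<alpha> by (rule Gamma_real_pos)
  have "(\<integral>\<^sup>+x. ennreal (exp (- (s * x))) \<partial>gamma_measure \<alpha> a) =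
     (\<integral>\<^sup>+x. ennreal (a powr \<alpha> / Gamma \<alpha>) * (ennreal (x powr (\<alpha> - 1) * exp (- ((a + s) * x))) * indicator {0..} x) \<partial>lborel)"
    unfolding gamma_measure_def using G
    by (subst nn_integral_density)
      (auto intro!: nn_integral_cong simp: ennreal_mult[symmetric] distrib_right exp_diff exp_minus exp_add field_simps split: split_indicator)
  also have "\<dots> = ennreal (a powr \<alpha> / Gamma \<alpha>) * ennreal (Gamma \<alpha> * (a + s) powr (- \<alpha>))"
    using s \<alpha> by (subst nn_integral_cmult) (auto simp: nn_integral_powr_exp)
  also have "\<dots> = ennreal ((a / (a + s)) powr \<alpha>)"
    using G a s by (simp add: ennreal_mult[symmetric] powr_minus powr_divide field_simps)
  finally show ?thesis .
qed

lemma prob_space_gamma_measure: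
  assumes "0 < \<alpha>" "0 < a"
  shows "prob_space (gamma_measure \<alpha> a)"
  using gamma_measure_laplace[OF assms, of 0] assms by (intro prob_spaceI) simp

lemma AE_gamma_measure_nonneg: "AE x in gamma_measure \<alpha> a. 0 \<le> x"
  unfolding gamma_measure_def by (subst AE_density) (auto split: split_indicator)

text \<open>Markov's inequality for the exponential moment at \<open>(1 - \<delta>) * a\<close>,
  which is \<open>\<delta> powr (- \<alpha>)\<close>; the exponent loses only the factor
  \<open>1 - \<delta>\<close>.\<close>

lemma gamma_measure_upper_tail:
  assumes \<alpha>: "0 < \<alpha>" and a: "0 < a" and \<delta>: "0 < \<delta>" "\<delta> \<le> 1"
  shows "measure (gamma_measure \<alpha> a) {t<..} \<le> \<delta> powr (- \<alpha>) * exp (- ((1 - \<delta>) * (a * t)))"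
proof -
  interpret prob_space "gamma_measure \<alpha> a" by (rule prob_space_gamma_measure[OF \<alpha> a])
  let ?\<theta> = "(1 - \<delta>) * a"
  have "emeasure (gamma_measure \<alpha> a) {t<..} = (\<integral>\<^sup>+x. indicator {t<..} x \<partial>gamma_measure \<alpha> a)"
    by simp
  also have "\<dots> \<le> (\<integral>\<^sup>+x. ennreal (exp (- (?\<theta> * t))) * ennreal (exp (- (- ?\<theta> * x))) \<partial>gamma_measure \<alpha> a)"
  proof (intro nn_integral_mono)
    fix x
    have "1 \<le> exp (- (?\<theta> * t)) * exp (- (- ?\<theta> * x))" if "t < x"
      using that a \<delta> by (simp add: exp_add[symmetric] mult_left_mono)
    then show "indicator {t<..} x \<le> ennreal (exp (- (?\<theta> * t))) * ennreal (exp (- (- ?\<theta> * x)))"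
      by (auto simp: ennreal_mult[symmetric] ennreal_1[symmetric] simp del: ennreal_1 split: split_indicator)
  qed
  also have "\<dots> = ennreal (exp (- (?\<theta> * t))) * (\<integral>\<^sup>+x. ennreal (exp (- (- ?\<theta> * x))) \<partial>gamma_measure \<alpha> a)"
    by (rule nn_integral_cmult) measurable
  also have "\<dots> = ennreal (exp (- (?\<theta> * t))) * ennreal ((a / (a + - ?\<theta>)) powr \<alpha>)"
    using \<delta> a by (subst gamma_measure_laplace[OF \<alpha> a]) (auto simp: algebra_simps)
  also have "a / (a + - ?\<theta>) = 1 / \<delta>" using a \<delta> by (simp add: field_simps)
  also have "(1 / \<delta>) powr \<alpha> = \<delta> powr (- \<alpha>)" using \<delta> by (simp add: powr_divide powr_minus_divide)
  finally have "ennreal (measure (gamma_measure \<alpha> a) {t<..}) \<le> ennreal (\<delta> powr (- \<alpha>) * exp (- ((1 - \<delta>) * (a * t))))"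
    by (simp add: emeasure_eq_measure ennreal_mult[symmetric] mult_ac)
  then show ?thesis by (simp add: mult_ac)
qed

text \<open>The mass above \<open>t\<close> is at least that of the interval from \<open>t\<close>
  to \<open>t + 1 / a\<close>, where the exponential factor is at least
  \<open>exp (- (a * t) - 1)\<close>. The loss against \<open>exp (- (a * t))\<close> is linear in
  \<open>a * t\<close>, which does no harm at logarithmic thresholds.\<close>

lemma gamma_measure_lower_tail:
  assumes \<alpha>: "0 < \<alpha>" and a: "0 < a" and t: "1 \<le> a * t"
  shows "measure (gamma_measure \<alpha> a) {..t} \<le> 1 - exp (- (a * t) - 1) / ((a * t + 1) * Gamma \<alpha>)"
proof -
  let ?d = "\<lambda>x. ennreal (a powr \<alpha> / Gamma \<alpha> * (x powr (\<alpha> - 1) * exp (- (a * x)))) * indicator {0..} x"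
  interpret prob_space "gamma_measure \<alpha> a" by (rule prob_space_gamma_measure[OF \<alpha> a])
  have G: "0 < Gamma \<alpha>" using \<alpha> by (rule Gamma_real_pos)
  have "0 < a * t" using t by simp
  then have t0: "0 < t" using a by (simp add: zero_less_mult_iff)
  let ?c = "a / Gamma \<alpha> * (exp (- (a * t) - 1) / (a * t + 1))"
  have c: "0 \<le> ?c" using a G t by simp
  have "ennreal (exp (- (a * t) - 1) / ((a * t + 1) * Gamma \<alpha>)) = ennreal ?c * ennreal (1 / a)"
    using a G t by (simp add: ennreal_mult[symmetric] mult.commute)
  also have "\<dots> = (\<integral>\<^sup>+x. ennreal ?c * indicator {t<..t + 1 / a} x \<partial>lborel)"
    using a by (simp add: nn_integral_cmult_indicator)
  also have "\<dots> \<le> (\<integral>\<^sup>+x. ?d x * indicator {t<..} x \<partial>lborel)"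
  proof (intro nn_integral_mono)
    fix x
    show "ennreal ?c * indicator {t<..t + 1 / a} x \<le>
      ?d x * indicator {t<..} x"
    proof (cases "t < x \<and> x \<le> t + 1 / a")
      case True
      have ax: "a * x \<le> a * t + 1" using True a by (simp add: field_simps)
      have x1: "1 \<le> a * x" using t mult_left_mono[of t x a] True a by linarith
      \<comment> \<open>One bound for all shapes: as \<open>a * x \<ge> 1\<close> and
        \<open>\<alpha> > 0\<close>, the power \<open>\<alpha> - 1\<close> is at least the power
        \<open>- 1\<close>.\<close>
      have "1 / (a * t + 1) \<le> 1 / (a * x)" using ax x1 by (intro divide_left_mono) auto
      also have "\<dots> = (a * x) powr (- 1)" using x1 by (simp add: powr_minus divide_inverse)
      also have "\<dots> \<le> (a * x) powr (\<alpha> - 1)" using x1 \<alpha> by (intro powr_mono) auto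
      finally have "1 / (a * t + 1) * exp (- (a * t) - 1) \<le> (a * x) powr (\<alpha> - 1) * exp (- (a * x))"
        using ax by (intro mult_mono) auto
      then have "exp (- (a * t) - 1) / (a * t + 1) \<le> (a * x) powr (\<alpha> - 1) * exp (- (a * x))" by simp
      then have "?c \<le> a / Gamma \<alpha> * ((a * x) powr (\<alpha> - 1) * exp (- (a * x)))"
        using a G by (intro mult_left_mono) auto
      also have "\<dots> = a powr \<alpha> / Gamma \<alpha> * (x powr (\<alpha> - 1) * exp (- (a * x)))"
      proof -
        have "a powr \<alpha> = a * a powr (\<alpha> - 1)" using a by (simp add: powr_diff)
        then show ?thesis using a True t0 by (simp add: powr_mult)
      qed
      finally show ?thesis using True t0 by (auto simp: ennreal_leI)
    qed (auto split: split_indicator)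
  qed
  also have "\<dots> = emeasure (gamma_measure \<alpha> a) {t<..}"
    unfolding gamma_measure_def by (subst emeasure_density) auto
  finally have "exp (- (a * t) - 1) / ((a * t + 1) * Gamma \<alpha>) \<le> measure (gamma_measure \<alpha> a) {t<..}"
    by (simp add: emeasure_eq_measure)
  moreover have "measure (gamma_measure \<alpha> a) {..t} = 1 - measure (gamma_measure \<alpha> a) {t<..}"
    using prob_compl[of "{t<..}"] by (simp add: Compl_eq_Diff_UNIV[symmetric])
  ultimately show ?thesis by simp
qed

section \<open>Finite-dimensional permanental laws\<close>

abbreviation permanental_laplace :: "real \<Rightarrow> nat \<Rightarrow> (nat \<Rightarrow> nat \<Rightarrow> real) \<Rightarrow> (nat \<Rightarrow> real) \<Rightarrow> real"
  where "permanental_laplace \<alpha> n K \<equiv> \<lambda>s. kdet n (\<lambda>p q. of_bool (p = q) + K p q * s q) powr (- \<alpha>)"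

abbreviation gamma_dominated :: "real \<Rightarrow> nat \<Rightarrow> (nat \<Rightarrow> real) \<Rightarrow> (nat \<Rightarrow> real) measure \<Rightarrow> bool"
  where "gamma_dominated \<alpha> n a \<mu> \<equiv> \<forall>t. measure \<mu> {z \<in> space (borel_fun n). \<forall>p<n. z p \<le> t p} \<le>
    (\<Prod>p<n. measure (gamma_measure \<alpha> (a p)) {..t p})"

lemma prod_lessThan_upto_cong: "(\<And>p. p < n \<Longrightarrow> f p = g p) \<Longrightarrow> (\<Prod>p<n. f p) = (\<Prod>p<n. g p)"
  by (intro prod.cong) auto

text \<open>The law is that of \<open>\<Gamma> + Y\<close>, where the coordinates of \<open>\<Gamma>\<close> are independent gamma variables with rates
  \<open>A p p\<close> and \<open>Y\<close> is nonnegative and independent of \<open>\<Gamma>\<close>.\<close>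

lemma permanental_law:
  assumes inv: "inverse_kernels n K A"
    and off: "\<And>p q. p < n \<Longrightarrow> q < n \<Longrightarrow> p \<noteq> q \<Longrightarrow> A p q \<le> 0"
    and K: "\<And>p q. p < n \<Longrightarrow> q < n \<Longrightarrow> 0 \<le> K p q" "\<And>p. p < n \<Longrightarrow> 0 < K p p"
    and \<alpha>: "0 < \<alpha>"
  shows "\<exists>\<mu>. laplace_of n \<mu> (permanental_laplace \<alpha> n (\<lambda>p q. K p q)) \<and>
    (\<forall>p<n. 0 < A p p) \<and>
    gamma_dominated \<alpha> n (\<lambda>p. A p p) \<mu>"
proof -
  \<comment> \<open>The vector \<open>K 1\<close> is positive and \<open>A\<close> maps it to the
    constant 1. It is the certificate that the elimination asks for, and it forces the diagonal of
    \<open>A\<close> to be positive.\<close>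
  define x where "x p = (\<Sum>q<n. K p q)" for p
  have x: "0 < x p" if "p < n" for p
    unfolding x_def using K that by (intro sum_pos2[of _ p]) auto
  have Ax: "(\<Sum>q<n. A p q * x q) = 1" if p: "p < n" for p
  proof -
    have "(\<Sum>q<n. A p q * x q) = (\<Sum>m<n. \<Sum>q<n. A p q * K q m)"
      unfolding x_def sum_distrib_left by (rule sum.swap)
    also have "\<dots> = (\<Sum>m<n. of_bool (p = m))"
      by (intro sum.cong refl) (simp add: inverse_kernelsD(1)[OF inv p])
    finally show ?thesis using p by (simp add: of_bool_def)
  qed
  have App: "0 < A p p" if p: "p < n" for p
  proof -
    have "(\<Sum>q\<in>{..<n} - {p}. A p q * x q) \<le> 0"
      using off[OF p] x by (intro sum_nonpos mult_nonpos_nonneg) (auto intro: less_imp_le)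
    moreover have "(\<Sum>q<n. A p q * x q) = A p p * x p + (\<Sum>q\<in>{..<n} - {p}. A p q * x q)"
      using p by (intro sum.remove) auto
    ultimately have "0 < A p p * x p" using Ax[OF p] by simp
    then show ?thesis using x[OF p] by (simp add: zero_less_mult_iff)
  qed
  define b where "b p q s = (if p = q then 0 else - A p q)" for p q and s :: "nat \<Rightarrow> real"
  define M where "M s p q = (if p = q then A p p + s p else 0) - b p q s" for s p q
  have M: "M s p q = A p q + (if p = q then s p else 0)" for s p q
    by (simp add: M_def b_def)
  obtain \<phi> where \<phi>: "laplace_transform n \<phi>" "\<And>s. nonneg_upto n s \<Longrightarrow> 0 < kdet n (M s)"
    "\<And>s. nonneg_upto n s \<Longrightarrow> kdet n (M s) powr (- \<alpha>) = (\<Prod>p<n. (A p p + s p) powr (- \<alpha>)) * \<phi> s"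
  proof -
    have "0 < (\<Sum>q<n. M s p q * x q)" if p: "p < n" and s: "nonneg_upto n s" for p s
    proof -
      have "(\<Sum>q<n. M s p q * x q) = (\<Sum>q<n. A p q * x q) + (\<Sum>q<n. if p = q then s p * x q else 0)"
        unfolding sum.distrib[symmetric] by (intro sum.cong) (auto simp: M distrib_right)
      then have "(\<Sum>q<n. M s p q * x q) = 1 + s p * x p" using p by (simp add: Ax[OF p])
      then show ?thesis using s p x[OF p] by (simp add: add_pos_nonneg)
    qed
    moreover have "laplace_transform n (b p q)" if "p < n" "q < n" for p q
      using off[OF that] by (cases "p = q") (auto simp: b_def[abs_def] intro!: laplace_transform_const)
    ultimately have "\<exists>\<phi>. laplace_transform n \<phi> \<and> (\<forall>s. nonneg_upto n s \<longrightarrow> 0 < kdet n (M s) \<and>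
        kdet n (M s) powr (- \<alpha>) = (\<Prod>p<n. (A p p + s p) powr (- \<alpha>)) * \<phi> s)"
      using laplace_transform_Schur[OF order_refl \<alpha>, of n b "\<lambda>p. A p p" x] App x
      by (simp add: M_def[abs_def])
    then show ?thesis using that by blast
  qed
  let ?d = "\<lambda>s. kdet n (\<lambda>p q. of_bool (p = q) + K p q * s q)"
  \<comment> \<open>Since \<open>A (I + K S) = A + S\<close>, the required determinant is that of
    \<open>A + S\<close> divided by that of \<open>A\<close>.\<close>
  have Md: "kdet n (M s) = kdet n A * ?d s" for s
    unfolding kdet_mult[symmetric]
  proof (rule kdet_cong)
    fix p q assume pq: "p < n" "q < n"
    have "(\<Sum>l<n. A p l * (of_bool (l = q) + K l q * s q)) =
        (\<Sum>l<n. if l = q then A p l else 0) + (\<Sum>l<n. A p l * K l q) * s q"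
      unfolding sum_distrib_right sum.distrib[symmetric] by (intro sum.cong) (auto simp: distrib_left)
    also have "\<dots> = A p q + of_bool (p = q) * s q"
      using pq by (simp add: inverse_kernelsD(1)[OF inv pq])
    finally show "M s p q = (\<Sum>l<n. A p l * (of_bool (l = q) + K l q * s q))"
      by (simp add: M)
  qed
  have M0: "kdet n (M (\<lambda>_. 0)) = kdet n A" by (simp add: M[abs_def])
  have dA: "0 < kdet n A" using \<phi>(2)[of "\<lambda>_. 0"] by (simp add: M0)
  \<comment> \<open>Division by the value at 0 turns \<open>\<phi>\<close> into the transform of a
    probability measure, the law of \<open>Y\<close>.\<close>
  define c where "c = \<phi> (\<lambda>_. 0)"
  have c: "kdet n A powr (- \<alpha>) = (\<Prod>p<n. A p p powr (- \<alpha>)) * c"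
    using \<phi>(3)[of "\<lambda>_. 0"] by (simp add: M0 c_def)
  have pA: "0 < (\<Prod>p<n. A p p powr (- \<alpha>))"
    by (intro prod_pos) (use App in force)
  have "0 < kdet n A powr (- \<alpha>)" using dA by simp
  then have c0: "0 < c" using pA unfolding c by (simp only: zero_less_mult_pos)
  define \<psi> where "\<psi> s = 1 / c * \<phi> s" for s
  have "laplace_transform n \<psi>"
    unfolding \<psi>_def using c0 by (intro laplace_transform_mult laplace_transform_const \<phi>) auto
  then obtain \<nu> where \<nu>: "laplace_of n \<nu> \<psi>" by (auto simp: laplace_transform_def)
  have \<nu>_sets: "sets \<nu> = sets (borel_fun n)" using \<nu> by (simp add: laplace_of_def)
  have "emeasure \<nu> (space \<nu>) = 1"
    using \<nu> c0 unfolding laplace_of_def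
    by (auto dest!: spec[of _ "\<lambda>_. 0"] simp: laplace_kernel_def \<psi>_def c_def)
  then interpret \<nu>: prob_space \<nu> by (rule prob_spaceI)
  \<comment> \<open>The rate 1 at indices from \<open>n\<close> on is a default that makes every
    \<open>g p\<close> a probability measure.\<close>
  define g where "g p = gamma_measure \<alpha> (if p < n then A p p else 1)" for p
  have g_prob: "prob_space (g p)" for p
    unfolding g_def using App \<alpha> by (intro prob_space_gamma_measure) auto
  interpret PP: product_sigma_finite g
    by (rule product_sigma_finite.intro) (rule prob_space_imp_sigma_finite[OF g_prob])
  interpret PG: prob_space "PiM {..<n} g" by (rule prob_space_PiM) (rule g_prob)
  have G_sets: "sets (PiM {..<n} g) = sets (borel_fun n)"
    by (intro sets_PiM_cong) (auto simp: g_def)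
  have lG: "laplace_of n (PiM {..<n} g) (\<lambda>s. \<Prod>p<n. (A p p / (A p p + s p)) powr \<alpha>)"
  proof (rule laplace_ofI[OF G_sets])
    have "AE z in PiM {..<n} g. 0 \<le> z p" if "p < n" for p
    proof (rule AE_PiM_component)
      show "AE x in g p. 0 \<le> x" unfolding g_def by (rule AE_gamma_measure_nonneg)
    qed (use that g_prob in auto)
    then show "AE z in PiM {..<n} g. nonneg_upto n z"
      by (auto simp: AE_all_countable)
    fix s assume s: "nonneg_upto n s"
    show "0 \<le> (\<Prod>p<n. (A p p / (A p p + s p)) powr \<alpha>)" by (intro prod_nonneg) auto
    have "laplace_integral n (PiM {..<n} g) s =
        (\<integral>\<^sup>+z. (\<Prod>p<n. ennreal (exp (- (s p * z p)))) \<partial>PiM {..<n} g)"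
      by (intro nn_integral_cong) (simp add: laplace_kernel_def prod_ennreal exp_sum sum_negf[symmetric])
    also have "\<dots> = (\<Prod>p<n. \<integral>\<^sup>+x. ennreal (exp (- (s p * x))) \<partial>g p)"
      by (rule PP.product_nn_integral_prod) (auto simp: g_def)
    also have "\<dots> = (\<Prod>p<n. ennreal ((A p p / (A p p + s p)) powr \<alpha>))"
    proof (rule prod_lessThan_upto_cong)
      fix p assume p: "p < n"
      have "- A p p < s p" using App[OF p] s p by (meson less_le_trans neg_less_0_iff_less)
      then show "(\<integral>\<^sup>+x. ennreal (exp (- (s p * x))) \<partial>g p) = ennreal ((A p p / (A p p + s p)) powr \<alpha>)"
        using gamma_measure_laplace[OF \<alpha> App[OF p]] p by (simp add: g_def)
    qed
    finally show "laplace_integral n (PiM {..<n} g) s = ennreal (\<Prod>p<n. (A p p / (A p p + s p)) powr \<alpha>)"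
      by (simp add: prod_ennreal)
  qed
  define \<mu> where "\<mu> = add_measure n (PiM {..<n} g) \<nu>"
  have "laplace_of n \<mu> (\<lambda>s. (\<Prod>p<n. (A p p / (A p p + s p)) powr \<alpha>) * \<psi> s)"
    unfolding \<mu>_def by (rule laplace_of_add_measure[OF lG \<nu>])
  moreover have "(\<Prod>p<n. (A p p / (A p p + s p)) powr \<alpha>) * \<psi> s = ?d s powr (- \<alpha>)" if s: "nonneg_upto n s" for s
  proof -
    have "?d s powr (- \<alpha>) = (kdet n (M s) / kdet n A) powr (- \<alpha>)"
      using dA by (simp add: Md)
    also have "\<dots> = kdet n (M s) powr (- \<alpha>) / kdet n A powr (- \<alpha>)"
      using \<phi>(2)[OF s] dA by (simp add: powr_divide)
    also have "\<dots> = ((\<Prod>p<n. (A p p + s p) powr (- \<alpha>)) / (\<Prod>p<n. A p p powr (- \<alpha>))) * \<psi> s"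
      unfolding \<phi>(3)[OF s] c by (simp add: \<psi>_def)
    also have "(\<Prod>p<n. (A p p + s p) powr (- \<alpha>)) / (\<Prod>p<n. A p p powr (- \<alpha>)) = (\<Prod>p<n. (A p p / (A p p + s p)) powr \<alpha>)"
      unfolding prod_dividef[symmetric]
    proof (rule prod_lessThan_upto_cong)
      fix p assume p: "p < n"
      then have "0 < A p p + s p" using App[OF p] s by (simp add: add_pos_nonneg)
      then show "(A p p + s p) powr (- \<alpha>) / A p p powr (- \<alpha>) = (A p p / (A p p + s p)) powr \<alpha>"
        using App[OF p] by (simp add: powr_divide powr_minus_divide)
    qed
    finally show ?thesis by simp
  qed
  ultimately have l\<mu>: "laplace_of n \<mu> (\<lambda>s. ?d s powr (- \<alpha>))"
    by (auto simp: laplace_of_def)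
  \<comment> \<open>As \<open>Y\<close> is nonnegative, \<open>\<Gamma> + Y\<close> lies below
    \<open>t\<close> only if \<open>\<Gamma>\<close> does, and the coordinates of
    \<open>\<Gamma>\<close> are independent.\<close>
  have dom: "measure \<mu> {z \<in> space (borel_fun n). \<forall>p<n. z p \<le> t p} \<le>
      (\<Prod>p<n. measure (gamma_measure \<alpha> (A p p)) {..t p})" for t
  proof -
    interpret pair_prob_space "PiM {..<n} g" \<nu> ..
    note [measurable_cong] = G_sets \<nu>_sets
    note T = measurable_pointwise_add[OF G_sets \<nu>_sets]
    let ?S = "{z \<in> space (borel_fun n). \<forall>p<n. z p \<le> t p}"
    let ?M = "PiM {..<n} g \<Otimes>\<^sub>M \<nu>"
    let ?T = "(\<lambda>(x, y). \<lambda>i\<in>{..<n}. x i + y i) -` ?S \<inter> space (?M)"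
    have S: "?S \<in> sets (borel_fun n)" by measurable
    let ?B = "Pi\<^sub>E {..<n} (\<lambda>p. {..t p})"
    have B: "?B \<in> sets (PiM {..<n} g)" by (intro sets_PiM_I_finite) (auto simp: g_def)
    have ae: "AE y in \<nu>. nonneg_upto n y" using \<nu> by (simp add: laplace_of_def)
    have "AE xy in ?M. nonneg_upto n (snd xy)"
      by (rule AE_pair_measure) (use ae in auto)
    then have ae2: "AE xy in ?M.
        xy \<in> ?T \<longrightarrow> xy \<in> ?B \<times> space \<nu>"
    proof eventually_elim
      case (elim xy)
      show ?case
      proof
        assume a: "xy \<in> ?T"
        have "fst xy p \<le> t p" if "p < n" for p
        proof -
          have "fst xy p + snd xy p \<le> t p" using a that by (auto simp: case_prod_beta)
          moreover have "0 \<le> snd xy p" using elim that by auto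
          ultimately show ?thesis by simp
        qed
        then show "xy \<in> ?B \<times> space \<nu>"
          using a by (auto simp: space_pair_measure space_PiM PiE_iff mem_Times_iff)
      qed
    qed
    have "emeasure \<mu> ?S = emeasure (?M) ?T"
      unfolding \<mu>_def add_measure_def by (rule emeasure_distr[OF T S])
    also have "\<dots> \<le> emeasure (?M) (?B \<times> space \<nu>)"
      using ae2 B by (intro emeasure_mono_AE) auto
    also have "\<dots> = emeasure (PiM {..<n} g) ?B"
      using B by (simp add: \<nu>.emeasure_pair_measure_Times \<nu>.emeasure_space_1)
    also have "\<dots> = (\<Prod>p<n. emeasure (g p) {..t p})"
      by (rule PP.emeasure_PiM[OF finite_lessThan]) (auto simp: g_def)
    also have "\<dots> = (\<Prod>p<n. ennreal (measure (gamma_measure \<alpha> (A p p)) {..t p}))"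
    proof (rule prod_lessThan_upto_cong)
      fix p assume p: "p < n"
      interpret prob_space "gamma_measure \<alpha> (A p p)" by (rule prob_space_gamma_measure[OF \<alpha> App[OF p]])
      show "emeasure (g p) {..t p} = ennreal (prob {..t p})" using p by (simp add: g_def emeasure_eq_measure)
    qed
    finally have "emeasure \<mu> ?S \<le> ennreal (\<Prod>p<n. measure (gamma_measure \<alpha> (A p p)) {..t p})"
      by (simp add: prod_ennreal)
    moreover have "finite_measure \<mu>" using l\<mu> by (simp add: laplace_of_def)
    ultimately show ?thesis
      by (simp add: finite_measure.emeasure_eq_measure prod_nonneg)
  qed
  show ?thesis
    by (intro exI[of _ \<mu>] conjI allI impI l\<mu> App dom)
qed

section \<open>Uniqueness of Laplace transforms\<close>

text \<open>In the variable \<open>y = exp (- x)\<close> the hypothesis covers the powers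
  \<open>y powr s\<close>, hence polynomials, by Stone--Weierstrass continuous functions, and in the
  limit indicators of half-lines. The limits are dominated convergence on
  \<open>0 < y \<le> 1\<close>.\<close>

lemma laplace_unique_real:
  fixes \<mu> \<nu> :: "real measure"
  assumes fin: "finite_measure \<mu>" "finite_measure \<nu>"
    and sets: "sets \<mu> = sets borel" "sets \<nu> = sets borel"
    and pos: "AE x in \<mu>. 0 \<le> x" "AE x in \<nu>. 0 \<le> x"
    and laplace: "\<And>s. 0 < s \<Longrightarrow> integral\<^sup>L \<mu> (\<lambda>x. exp (- (s * x))) = integral\<^sup>L \<nu> (\<lambda>x. exp (- (s * x)))"
  shows "\<mu> = \<nu>"
proof -
  interpret m: finite_measure \<mu> by fact
  interpret n: finite_measure \<nu> by fact
  note [measurable_cong] = sets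
  have sp: "space \<mu> = UNIV" "space \<nu> = UNIV"
    using sets[THEN sets_eq_imp_space_eq] by simp_all
  define E :: "(real \<Rightarrow> real) \<Rightarrow> bool"
    where "E f \<longleftrightarrow> integral\<^sup>L \<mu> (\<lambda>x. f (exp (- x))) = integral\<^sup>L \<nu> (\<lambda>x. f (exp (- x)))" for f
  have int: "integrable \<rho> (\<lambda>x. f (exp (- x)))"
    if "\<rho> = \<mu> \<or> \<rho> = \<nu>" and [measurable]: "f \<in> borel_measurable borel"
      and b: "\<And>y. 0 \<le> y \<Longrightarrow> y \<le> 1 \<Longrightarrow> \<bar>f y\<bar> \<le> B" for f :: "real \<Rightarrow> real" and B \<rho>
  proof -
    have [measurable_cong]: "sets \<rho> = sets borel" using that(1) sets by auto
    interpret finite_measure \<rho> using that(1) fin by auto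
    have "AE x in \<rho>. 0 \<le> x" using that(1) pos by auto
    then show ?thesis by (intro integrable_const_bound[of _ B]) (auto intro!: b elim!: eventually_mono)
  qed
  have lim: "(\<lambda>k. integral\<^sup>L \<rho> (\<lambda>x. f k (exp (- x)))) \<longlonglongrightarrow> integral\<^sup>L \<rho> (\<lambda>x. g (exp (- x)))"
    if "\<rho> = \<mu> \<or> \<rho> = \<nu>" and [measurable]: "\<And>k. f k \<in> borel_measurable borel" "g \<in> borel_measurable borel"
      and b: "\<And>k y. 0 < y \<Longrightarrow> y \<le> 1 \<Longrightarrow> \<bar>f k y\<bar> \<le> B"
      and l: "\<And>y. 0 < y \<Longrightarrow> y \<le> 1 \<Longrightarrow> (\<lambda>k. f k y) \<longlonglongrightarrow> g y" for f :: "nat \<Rightarrow> real \<Rightarrow> real" and g :: "real \<Rightarrow> real" and B \<rho>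
  proof -
    have [measurable_cong]: "sets \<rho> = sets borel" using that(1) sets by auto
    interpret finite_measure \<rho> using that(1) fin by auto
    have ae: "AE x in \<rho>. 0 \<le> x" using that(1) pos by auto
    show ?thesis
      by (rule integral_dominated_convergence[where w = "\<lambda>_. B"])
        (use ae in \<open>auto intro!: b l elim!: eventually_mono\<close>)
  qed
  have E_lim: "E g"
    if "\<And>k. f k \<in> borel_measurable borel" "g \<in> borel_measurable borel"
      "\<And>k y. 0 < y \<Longrightarrow> y \<le> 1 \<Longrightarrow> \<bar>f k y\<bar> \<le> B"
      "\<And>y. 0 < y \<Longrightarrow> y \<le> 1 \<Longrightarrow> (\<lambda>k. f k y) \<longlonglongrightarrow> g y" "\<And>k. E (f k)" for f :: "nat \<Rightarrow> real \<Rightarrow> real" and g :: "real \<Rightarrow> real" and B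
    using LIMSEQ_unique[OF lim[of \<mu> f g B] lim[of \<nu> f g B, folded that(5)[unfolded E_def]]] that
    by (simp add: E_def)
  have powr: "E (\<lambda>y. y powr s)" if "0 < s" for s
    using laplace[OF that] by (simp add: E_def powr_def)
  \<comment> \<open>The hypothesis is silent at \<open>s = 0\<close>; equality of the total masses
    is the limit of \<open>y powr s\<close> as \<open>s\<close> decreases to 0.\<close>
  have E_1: "E (\<lambda>_. 1)"
  proof (rule E_lim)
    fix y :: real assume y: "0 < y" "y \<le> 1"
    show "\<bar>y powr (1 / real (Suc k))\<bar> \<le> 1" for k using y by (simp add: powr_le1)
    have "(\<lambda>k. y powr (1 / real (Suc k))) \<longlonglongrightarrow> y powr 0"
      using y by (intro tendsto_powr tendsto_const LIMSEQ_inverse_real_of_nat[unfolded inverse_eq_divide]) auto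
    then show "(\<lambda>k. y powr (1 / real (Suc k))) \<longlonglongrightarrow> 1" using y by simp
  qed (auto intro!: powr)
  have E_power: "E (\<lambda>y. y ^ k)" for k
  proof (cases "k = 0")
    case False
    then show ?thesis using powr[of "real k"] by (simp add: E_def powr_realpow)
  qed (use E_1 in simp)
  have E_poly: "E (\<lambda>y. \<Sum>i\<le>d. a i * y ^ i)" for a and d :: nat
  proof -
    have i: "integrable \<rho> (\<lambda>x. exp (- x) ^ k)" if "\<rho> = \<mu> \<or> \<rho> = \<nu>" for k \<rho>
      using that by (rule int[where B = 1]) (auto simp: power_le_one)
    show ?thesis using E_power unfolding E_def by (simp add: i)
  qed
  have E_cont: "E f" if c: "continuous_on UNIV f" for f :: "real \<Rightarrow> real"
  proof -
    have "\<exists>g. real_polynomial_function g \<and> (\<forall>y\<in>{0..1}. \<bar>f y - g y\<bar> < 1 / real (Suc k))" for k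
      using Stone_Weierstrass_real_polynomial_function[of "{0..1}" f "1 / real (Suc k)"] c
      by (metis compact_Icc continuous_on_subset of_nat_0_less_iff subset_UNIV zero_less_Suc zero_less_divide_1_iff)
    then obtain g where g: "\<And>k. real_polynomial_function (g k)" "\<And>k y. y \<in> {0..1} \<Longrightarrow> \<bar>f y - g k y\<bar> < 1 / real (Suc k)"
      by metis
    obtain B where B: "\<And>y. y \<in> {0..1} \<Longrightarrow> \<bar>f y\<bar> \<le> B"
      using compact_imp_bounded[OF compact_continuous_image[of "{0..1}" f]] c
      unfolding bounded_iff by (metis continuous_on_subset subset_UNIV compact_Icc image_eqI real_norm_def)
    show ?thesis
    proof (rule E_lim)
      show "E (g k)" for k
        using g(1)[of k] E_poly by (auto simp: real_polynomial_function_iff_sum)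
      show "g k \<in> borel_measurable borel" for k
        using g(1)[of k] by (auto simp: real_polynomial_function_iff_sum)
      show "f \<in> borel_measurable borel" by (rule borel_measurable_continuous_onI[OF c])
      fix y :: real assume y: "0 < y" "y \<le> 1"
      have "1 / real (Suc k) \<le> 1" for k by (simp add: field_simps)
      then have "\<bar>f y - g k y\<bar> < 1" for k
        using g(2)[of y k] y by (meson atLeastAtMost_iff less_imp_le less_le_trans)
      then show "\<bar>g k y\<bar> \<le> B + 1" for k
        using B[of y] y by (smt (verit) atLeastAtMost_iff)
      have "(\<lambda>k. 1 / real (Suc k)) \<longlonglongrightarrow> 0" by (rule LIMSEQ_inverse_real_of_nat[unfolded inverse_eq_divide])
      then have "(\<lambda>k. f y - g k y) \<longlonglongrightarrow> 0"
        by (rule tendsto_0_le[where K = 1]) (use g(2)[of y] y in \<open>auto simp: less_imp_le\<close>)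
      then have "(\<lambda>k. f y - (f y - g k y)) \<longlonglongrightarrow> f y - 0" by (intro tendsto_intros)
      then show "(\<lambda>k. g k y) \<longlonglongrightarrow> f y" by simp
    qed
  qed
  have E_ind: "E (indicator {..<c})" for c :: real
  proof (rule E_lim[where f = "\<lambda>k y. min 1 (max 0 (real k * (c - y)))" and B = 1])
    fix y :: real
    show "E (\<lambda>y. min 1 (max 0 (real k * (c - y))))" for k
      by (intro E_cont continuous_intros)
    show "\<bar>min 1 (max 0 (real k * (c - y)))\<bar> \<le> 1" for k by simp
    show "(\<lambda>k. min 1 (max 0 (real k * (c - y)))) \<longlonglongrightarrow> indicator {..<c} y"
    proof (cases "y < c")
      case True
      then have "filterlim (\<lambda>k. real k * (c - y)) at_top sequentially"
        by (intro filterlim_at_top_mult_tendsto_pos[OF tendsto_const] filterlim_real_sequentially) auto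
      then have "eventually (\<lambda>k. 1 \<le> real k * (c - y)) sequentially"
        by (simp add: filterlim_at_top)
      then have "eventually (\<lambda>k. min 1 (max 0 (real k * (c - y))) = indicator {..<c} y) sequentially"
        by eventually_elim (use True in auto)
      then show ?thesis by (rule tendsto_eventually)
    next
      case False
      then have "real k * (c - y) \<le> 0" for k by (simp add: mult_nonneg_nonpos)
      then show ?thesis using False by (simp add: max.absorb1)
    qed
  qed auto
  show ?thesis
  proof (rule measure_eqI_lessThan[OF sets])
    show "emeasure \<mu> {x<..} < \<infinity>" for x by (simp add: m.emeasure_eq_measure)
    have e: "indicator {..<exp (- x)} (exp (- z)) = (indicator {x<..} z :: real)" for x z :: real
      by (simp add: indicator_def)
    have "measure \<mu> {x<..} = measure \<nu> {x<..}" for x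
      using E_ind[of "exp (- x)"] unfolding E_def e by (simp add: sp)
    then show "emeasure \<mu> {x<..} = emeasure \<nu> {x<..}" for x
      by (simp add: m.emeasure_eq_measure n.emeasure_eq_measure)
  qed
qed

text \<open>One coordinate at a time, the factor \<open>exp (- (s i * z i))\<close> is replaced by an indicator function.\<close>

lemma laplace_unique_PiM:
  fixes \<mu> \<nu> :: "('i \<Rightarrow> real) measure"
  assumes I: "finite I"
    and fin: "finite_measure \<mu>" "finite_measure \<nu>"
    and sets: "sets \<mu> = sets (PiM I (\<lambda>_. borel))" "sets \<nu> = sets (PiM I (\<lambda>_. borel))"
    and pos: "AE z in \<mu>. \<forall>i\<in>I. 0 \<le> z i" "AE z in \<nu>. \<forall>i\<in>I. 0 \<le> z i"
    and laplace: "\<And>s. (\<And>i. i \<in> I \<Longrightarrow> 0 < s i) \<Longrightarrow>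
      integral\<^sup>L \<mu> (\<lambda>z. exp (- (\<Sum>i\<in>I. s i * z i))) = integral\<^sup>L \<nu> (\<lambda>z. exp (- (\<Sum>i\<in>I. s i * z i)))"
  shows "\<mu> = \<nu>"
proof -
  note [measurable_cong] = sets
  have main: "integral\<^sup>L \<mu> (\<lambda>z. (\<Prod>i\<in>J. indicator (A i) (z i)) * exp (- (\<Sum>i\<in>I - J. s i * z i))) =
    integral\<^sup>L \<nu> (\<lambda>z. (\<Prod>i\<in>J. indicator (A i) (z i)) * exp (- (\<Sum>i\<in>I - J. s i * z i)))"
    if "J \<subseteq> I" "\<And>i. A i \<in> sets borel" "\<And>i. i \<in> I \<Longrightarrow> 0 < s i" for J s and A :: "'i \<Rightarrow> real set"
    using finite_subset[OF that(1) I] that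
  proof (induction J arbitrary: s rule: finite_induct)
    case empty
    then show ?case using laplace[of s] by simp
  next
    case (insert m J)
    define g where "g z = (\<Prod>i\<in>J. indicator (A i) (z i)) * exp (- (\<Sum>i\<in>I - insert m J. s i * z i))" for z :: "'i \<Rightarrow> real"
    have mI: "m \<in> I" using insert by auto
    have J: "J \<subseteq> I" using insert by auto
    note [measurable] = insert(5)
    have [measurable]: "(\<lambda>z. z i) \<in> borel_measurable (PiM I (\<lambda>_. borel))" if "i \<in> I" for i
      using that by (rule measurable_component_singleton)
    have [measurable]: "g \<in> borel_measurable (PiM I (\<lambda>_. borel))"
      unfolding g_def using J
      by (intro borel_measurable_times borel_measurable_prod borel_measurable_exp borel_measurable_uminus
          borel_measurable_sum borel_measurable_const measurable_compose[OF measurable_component_singleton borel_measurable_indicator] insert(5)) auto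
    have g0: "0 \<le> g z" for z by (simp add: g_def prod_nonneg)
    have g1: "g z \<le> 1" if "\<forall>i\<in>I. 0 \<le> z i" for z
    proof -
      have "0 \<le> (\<Sum>i\<in>I - insert m J. s i * z i)"
        using that insert(6) by (intro sum_nonneg mult_nonneg_nonneg) (auto intro: less_imp_le)
      moreover have "(\<Prod>i\<in>J. indicat_real (A i) (z i)) \<le> 1" by (intro prod_le_1) auto
      ultimately show ?thesis unfolding g_def by (intro mult_le_one) auto
    qed
    \<comment> \<open>The law of the \<open>m\<close>-th coordinate under the density
      \<open>g\<close>, which carries the indicators already obtained and the exponentials still
      left. By the induction hypothesis \<open>D \<mu>\<close> and \<open>D \<nu>\<close> have the
      same Laplace transform.\<close>
    define D where "D \<rho> = distr (density \<rho> (\<lambda>z. ennreal (g z))) borel (\<lambda>z. z m)" for \<rho> :: "('i \<Rightarrow> real) measure"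
    have D_int: "integral\<^sup>L (D \<rho>) f = integral\<^sup>L \<rho> (\<lambda>z. g z * f (z m))"
      if "sets \<rho> = sets (PiM I (\<lambda>_. borel))" "f \<in> borel_measurable borel" for \<rho> and f :: "real \<Rightarrow> real"
    proof -
      note [measurable_cong] = that(1) and [measurable] = that(2) mI
      show ?thesis unfolding D_def
        using g0 mI by (subst integral_distr, simp, simp, subst integral_real_density) auto
    qed
    have D: "finite_measure (D \<rho>)" "AE x in D \<rho>. 0 \<le> x"
      if "finite_measure \<rho>" and ae: "AE z in \<rho>. \<forall>i\<in>I. 0 \<le> z i" and s: "sets \<rho> = sets (PiM I (\<lambda>_. borel))" for \<rho>
    proof -
      interpret finite_measure \<rho> by fact
      note [measurable_cong] = s and [measurable] = mI
      have sp: "space \<rho> = space (PiM I (\<lambda>_. borel))" using s by (rule sets_eq_imp_space_eq)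
      have "(\<integral>\<^sup>+z. ennreal (g z) \<partial>\<rho>) \<le> (\<integral>\<^sup>+z. 1 \<partial>\<rho>)"
        using ae by (intro nn_integral_mono_AE) (auto elim!: eventually_mono simp: g1)
      also have "\<dots> < \<infinity>" by (simp add: emeasure_eq_measure)
      finally show "finite_measure (D \<rho>)" unfolding D_def
        by (intro finite_measureI) (simp add: emeasure_distr emeasure_density sp[symmetric] less_top cong: nn_integral_cong_simp)
      show "AE x in D \<rho>. 0 \<le> x"
        unfolding D_def using ae mI
        by (subst AE_distr_iff) (auto simp: AE_density elim!: eventually_mono)
    qed
    have D_sets: "sets (D \<rho>) = sets borel" for \<rho> by (simp add: D_def)
    have "D \<mu> = D \<nu>"
    proof (rule laplace_unique_real)
      fix t :: real assume t: "0 < t"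
      define s' where "s' = s(m := t)"
      have e: "g z * exp (- (t * z m)) =
          (\<Prod>i\<in>J. indicator (A i) (z i)) * exp (- (\<Sum>i\<in>I - J. s' i * z i))" for z
      proof -
        have IJ: "I - J = insert m (I - insert m J)" using mI insert(2) by auto
        have "(\<Sum>i\<in>I - J. s' i * z i) = s' m * z m + (\<Sum>i\<in>I - insert m J. s' i * z i)"
          unfolding IJ by (rule sum.insert) (use I in auto)
        also have "s' m = t" by (simp add: s'_def)
        also have "(\<Sum>i\<in>I - insert m J. s' i * z i) = (\<Sum>i\<in>I - insert m J. s i * z i)"
          by (intro sum.cong) (auto simp: s'_def)
        finally show ?thesis unfolding g_def by (simp only: minus_add_distrib exp_add mult.assoc mult.commute[of "exp (- (t * z m))"])
      qed
      have De: "integral\<^sup>L (D \<rho>) (\<lambda>x. exp (- (t * x))) =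
          integral\<^sup>L \<rho> (\<lambda>z. (\<Prod>i\<in>J. indicator (A i) (z i)) * exp (- (\<Sum>i\<in>I - J. s' i * z i)))"
        if "sets \<rho> = sets (PiM I (\<lambda>_. borel))" for \<rho>
        unfolding e[symmetric] by (rule D_int[OF that]) measurable
      have "0 < s' i" if "i \<in> I" for i using insert(6)[OF that] t by (simp add: s'_def)
      then show "integral\<^sup>L (D \<mu>) (\<lambda>x. exp (- (t * x))) = integral\<^sup>L (D \<nu>) (\<lambda>x. exp (- (t * x)))"
        unfolding De[OF sets(1)] De[OF sets(2)] by (rule insert(3)[OF J insert(5)])
    qed (rule D[OF fin(1) pos(1) sets(1)] D[OF fin(2) pos(2) sets(2)] D_sets)+
    then have "integral\<^sup>L (D \<mu>) (indicator (A m)) = integral\<^sup>L (D \<nu>) (indicator (A m) :: real \<Rightarrow> real)"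
      by simp
    then show ?case
      unfolding D_int[OF sets(1) borel_measurable_indicator[OF insert(5)]] D_int[OF sets(2) borel_measurable_indicator[OF insert(5)]] g_def
      using insert(1,2) by (simp add: ac_simps)
  qed
  show ?thesis
  proof (rule measure_eqI_PiM_finite[OF I sets])
    fix A :: "'i \<Rightarrow> real set" assume A: "\<And>i. i \<in> I \<Longrightarrow> A i \<in> sets borel"
    \<comment> \<open>\<open>main\<close> expects a Borel set at every index; the empty set is a
      default outside \<open>I\<close>.\<close>
    define A' where "A' i = (if i \<in> I then A i else {})" for i
    have A': "A' i \<in> sets borel" for i using A by (auto simp: A'_def)
    have m: "Pi\<^sub>E I A \<in> sets (PiM I (\<lambda>_. borel))" using A I by (intro sets_PiM_I_finite) auto
    have ind: "(\<Prod>i\<in>I. indicator (A' i) (z i)) = indicat_real (Pi\<^sub>E I A) z" if zs: "z \<in> space (PiM I (\<lambda>_. borel))" for z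
    proof (cases "z \<in> Pi\<^sub>E I A")
      case True
      then show ?thesis by (auto simp: A'_def PiE_iff intro!: prod.neutral)
    next
      case False
      then obtain i where "i \<in> I" "z i \<notin> A i" using zs by (auto simp: space_PiM PiE_def Pi_iff)
      then show ?thesis using False I by (auto simp: A'_def intro!: prod_zero bexI[of _ i])
    qed
    have eq: "integral\<^sup>L \<rho> (\<lambda>z. (\<Prod>i\<in>I. indicator (A' i) (z i)) * exp (- (\<Sum>i\<in>I - I. 1 * z i))) = measure \<rho> (Pi\<^sub>E I A)"
      if s: "sets \<rho> = sets (PiM I (\<lambda>_. borel))" for \<rho> :: "('i \<Rightarrow> real) measure"
    proof -
      have sp: "space \<rho> = space (PiM I (\<lambda>_. borel))" using s by (rule sets_eq_imp_space_eq)
      have "integral\<^sup>L \<rho> (\<lambda>z. (\<Prod>i\<in>I. indicator (A' i) (z i)) * exp (- (\<Sum>i\<in>I - I. 1 * z i))) = integral\<^sup>L \<rho> (indicat_real (Pi\<^sub>E I A))"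
        by (intro Bochner_Integration.integral_cong) (simp_all add: ind sp)
      also have "\<dots> = measure \<rho> (Pi\<^sub>E I A)"
        using sets.Int_space_eq2[of "Pi\<^sub>E I A" \<rho>] m s by simp
      finally show ?thesis .
    qed
    have "measure \<mu> (Pi\<^sub>E I A) = measure \<nu> (Pi\<^sub>E I A)"
      using main[of I A' "\<lambda>_. 1"] A' eq[OF sets(1)] eq[OF sets(2)] by simp
    then show "emeasure \<mu> (Pi\<^sub>E I A) = emeasure \<nu> (Pi\<^sub>E I A)"
      by (simp add: finite_measure.emeasure_eq_measure fin)
  next
    show "range (\<lambda>_::nat. space (PiM I (\<lambda>_. borel))) \<subseteq> prod_algebra I (\<lambda>_. borel)"
      using I by (auto simp: space_PiM intro!: prod_algebraI_finite)
  qed (simp_all add: finite_measure.emeasure_eq_measure fin)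
qed

section \<open>Existence of permanental sequences\<close>

lemma laplace_of_integral:
  assumes "laplace_of n \<mu> \<phi>" "nonneg_upto n s"
  shows "integral\<^sup>L \<mu> (laplace_kernel n s) = \<phi> s"
proof -
  have sets: "sets \<mu> = sets (borel_fun n)" using assms by (simp add: laplace_of_def)
  note [measurable_cong] = sets
  show ?thesis
    using assms by (subst integral_eq_nn_integral) (auto simp: laplace_of_def laplace_kernel_nonneg)
qed

lemma laplace_of_unique:
  assumes \<mu>: "laplace_of n \<mu> \<phi>"
    and \<nu>: "finite_measure \<nu>" "sets \<nu> = sets (borel_fun n)" "AE z in \<nu>. nonneg_upto n z"
    and l: "\<And>s. \<forall>i<n. 0 < s i \<Longrightarrow> integral\<^sup>L \<nu> (laplace_kernel n s) = \<phi> s"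
  shows "\<nu> = \<mu>"
proof (rule laplace_unique_PiM[of "{..<n}"])
  fix s :: "nat \<Rightarrow> real" assume s: "\<And>i. i \<in> {..<n} \<Longrightarrow> 0 < s i"
  then show "integral\<^sup>L \<nu> (\<lambda>z. exp (- (\<Sum>i<n. s i * z i))) = integral\<^sup>L \<mu> (\<lambda>z. exp (- (\<Sum>i<n. s i * z i)))"
    using l[of s] laplace_of_integral[OF \<mu>, of s] by (simp add: laplace_kernel_def[abs_def] less_imp_le)
qed (use \<mu> \<nu> in \<open>auto simp: laplace_of_def\<close>)

text \<open>Carries bounds proved for the constructed law \<open>\<mu>\<close> to every permanental
  sequence with this kernel, on whatever probability space.\<close>

lemma permanental_marginal:
  assumes Z: "permanental_sequence M \<alpha> V Z"
    and i: "inj_on i {..<n}" "i ` {..<n} \<subseteq> {1..}"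
    and \<mu>: "laplace_of n \<mu> (permanental_laplace \<alpha> n (\<lambda>p q. V (i p) (i q)))"
  shows "distr M (borel_fun n) (\<lambda>w. \<lambda>p\<in>{..<n}. Z (i p) w) = \<mu>"
proof (rule laplace_of_unique[OF \<mu>])
  let ?Y = "\<lambda>w. \<lambda>p\<in>{..<n}. Z (i p) w"
  let ?D = "distr M (borel_fun n) ?Y"
  interpret prob_space M using Z by (simp add: permanental_sequence_def)
  have Zm: "Z (i p) \<in> borel_measurable M" "\<forall>w\<in>space M. 0 \<le> Z (i p) w" if "p < n" for p
    using Z i(2) that by (auto simp: permanental_sequence_def image_subset_iff)
  have T: "?Y \<in> M \<rightarrow>\<^sub>M borel_fun n"
    using Zm by (intro measurable_restrict) auto
  interpret D: prob_space "?D"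
    by (rule prob_space_distr[OF T])
  show "finite_measure (?D)" by (rule D.finite_measure_axioms)
  show "AE z in ?D. nonneg_upto n z"
    by (subst AE_distr_iff[OF T]) (use Zm in auto)
  fix s :: "nat \<Rightarrow> real" assume s: "\<forall>p<n. 0 < s p"
  have "integral\<^sup>L (?D) (laplace_kernel n s) =
      integral\<^sup>L M (\<lambda>w. exp (- (\<Sum>p<n. s p * Z (i p) w)))"
    by (subst integral_distr[OF T]) (auto simp: laplace_kernel_def)
  also have "\<dots> = kdet n (\<lambda>p q. of_bool (p = q) + V (i p) (i q) * s q) powr (- \<alpha>)"
    using Z i s unfolding permanental_sequence_def det_permanental_eq by blast
  finally show "integral\<^sup>L (?D) (laplace_kernel n s) =
    kdet n (\<lambda>p q. of_bool (p = q) + V (i p) (i q) * s q) powr (- \<alpha>)" .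
qed simp

text \<open>The laws of the initial segments are consistent: a marginal is identified by its
  transform, and setting the last weights to 0 removes the last indices from the determinant.
  Position \<open>p\<close> stands for the state \<open>Suc p\<close>.\<close>

lemma permanental_sequence_exists:
  fixes V :: "nat \<Rightarrow> nat \<Rightarrow> real"
  assumes \<mu>: "\<And>N. laplace_of N (\<mu> N)
    (permanental_laplace \<alpha> N (\<lambda>p q. V (Suc p) (Suc q)))"
  shows "\<exists>(M :: (nat \<Rightarrow> real) measure) Z. permanental_sequence M \<alpha> V Z"
proof -
  define D where "D N s = kdet N (\<lambda>p q. of_bool (p = q) + V (Suc p) (Suc q) * s q)" for N and s :: "nat \<Rightarrow> real"
  note \<mu>' = \<mu>[folded D_def]
  have sets: "sets (\<mu> N) = sets (borel_fun N)" for N using \<mu>[of N] by (simp add: laplace_of_def)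
  note [measurable_cong] = sets
  have space: "space (\<mu> N) = space (borel_fun N)" for N by (rule sets_eq_imp_space_eq[OF sets])
  have ae: "AE z in \<mu> N. nonneg_upto N z" for N using \<mu>[of N] by (simp add: laplace_of_def)
  have prob: "prob_space (\<mu> N)" for N
  proof (rule prob_spaceI)
    have "D N (\<lambda>_. 0) = 1" by (simp add: D_def kdet_one)
    then show "emeasure (\<mu> N) (space (\<mu> N)) = 1"
      using \<mu>'[of N] by (auto simp: laplace_of_def laplace_kernel_def dest!: spec[of _ "\<lambda>_. 0"])
  qed
  have res: "(\<lambda>z. restrict z J) \<in> PiM I (\<lambda>_. borel) \<rightarrow>\<^sub>M PiM J (\<lambda>_. borel)" if "J \<subseteq> I"
    for J I :: "nat set" using that by (rule measurable_restrict_subset)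
  have res_\<mu>: "(\<lambda>z. restrict z J) \<in> \<mu> N \<rightarrow>\<^sub>M PiM J (\<lambda>_. borel)" if "J \<subseteq> {..<N}" for J N
    using res[OF that] unfolding measurable_cong_sets[OF sets refl] .
  have cons: "distr (\<mu> N') (borel_fun N) (\<lambda>z. restrict z {..<N}) = \<mu> N" if NN: "N \<le> N'" for N N'
  proof (rule laplace_of_unique[OF \<mu>'])
    let ?R = "\<lambda>z::nat \<Rightarrow> real. restrict z {..<N}"
    let ?d = "distr (\<mu> N') (borel_fun N) ?R"
    interpret prob_space "\<mu> N'" by (rule prob)
    have T: "?R \<in> \<mu> N' \<rightarrow>\<^sub>M borel_fun N"
      using res[of "{..<N}" "{..<N'}"] NN by simp
    interpret d: prob_space "?d" by (rule prob_space_distr[OF T])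
    show "finite_measure (?d)" by (rule d.finite_measure_axioms)
    show "AE z in ?d. nonneg_upto N z"
      by (subst AE_distr_iff[OF T]) (use ae[of N'] NN in \<open>auto elim!: eventually_mono\<close>)
    fix s :: "nat \<Rightarrow> real" assume s: "\<forall>i<N. 0 < s i"
    define s' where "s' l = (if l < N then s l else 0)" for l
    have "laplace_kernel N s (restrict z {..<N}) = laplace_kernel N' s' z" for z
    proof -
      have "(\<Sum>l<N'. s' l * z l) = (\<Sum>l<N. s' l * z l)"
        using NN by (intro sum.mono_neutral_right) (auto simp: s'_def)
      then show ?thesis by (simp add: laplace_kernel_def s'_def)
    qed
    then have "integral\<^sup>L (?d) (laplace_kernel N s) =
        integral\<^sup>L (\<mu> N') (laplace_kernel N' s')"
      by (subst integral_distr[OF T]) auto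
    also have "\<dots> = D N' s' powr (- \<alpha>)"
      using s by (intro laplace_of_integral[OF \<mu>']) (auto simp: s'_def intro: less_imp_le)
    also have "D N' s' = D N s"
      unfolding D_def
      by (rule kdet_select[of "\<lambda>p. p" N N' s' s "\<lambda>p q. V (Suc p) (Suc q)", symmetric])
        (use NN in \<open>auto simp: s'_def\<close>)
    finally show "integral\<^sup>L (?d) (laplace_kernel N s) = D N s powr (- \<alpha>)" .
  qed simp
  \<comment> \<open>A strict bound for the indices in \<open>J\<close>; inserting 0 takes care of
    the empty set.\<close>
  define b :: "nat set \<Rightarrow> nat" where "b J = Suc (Max (insert 0 J))" for J
  have b: "J \<subseteq> {..<b J}" if "finite J" for J
    using that by (auto simp: b_def less_Suc_eq_le)
  define P where "P J = distr (\<mu> (b J)) (PiM J (\<lambda>_. borel)) (\<lambda>z. restrict z J)" for J :: "nat set"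
  have P_eq: "P J = distr (\<mu> N) (PiM J (\<lambda>_. borel)) (\<lambda>z. restrict z J)" if J: "finite J" "b J \<le> N" for J N
  proof -
    have J': "J \<subseteq> {..<b J}" by (rule b[OF J(1)])
    have "P J = distr (distr (\<mu> N) (borel_fun (b J)) (\<lambda>z. restrict z {..<b J})) (PiM J (\<lambda>_. borel)) (\<lambda>z. restrict z J)"
      unfolding P_def cons[OF J(2)] ..
    also have "\<dots> = distr (\<mu> N) (PiM J (\<lambda>_. borel)) ((\<lambda>z. restrict z J) \<circ> (\<lambda>z. restrict z {..<b J}))"
      using res[of "{..<b J}" "{..<N}"] J by (intro distr_distr res J') auto
    also have "(\<lambda>z. restrict z J) \<circ> (\<lambda>z. restrict z {..<b J}) = (\<lambda>z. restrict z J)"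
      using J' by (auto simp: fun_eq_iff)
    finally show ?thesis .
  qed
  have P_prob: "prob_space (P J)" if "finite J" for J
  proof -
    interpret prob_space "\<mu> (b J)" by (rule prob)
    show ?thesis unfolding P_def by (intro prob_space_distr res_\<mu> b that)
  qed
  interpret polish_projective UNIV P
  proof (intro polish_projective.intro projective_family.intro)
    fix J H :: "nat set" assume JH: "J \<subseteq> H" "finite H"
    have "b J \<le> b H" using JH by (auto simp: b_def intro!: Max_mono)
    moreover have "finite J" using JH finite_subset by blast
    ultimately have "P J = distr (\<mu> (b H)) (PiM J (\<lambda>_. borel)) (\<lambda>z. restrict z J)" by (intro P_eq)
    also have "(\<lambda>z. restrict z J) = (\<lambda>z. restrict z J) \<circ> (\<lambda>z::nat \<Rightarrow> real. restrict z H)"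
      using JH by (auto simp: fun_eq_iff)
    also have "distr (\<mu> (b H)) (PiM J (\<lambda>_. borel)) \<dots> = distr (P H) (PiM J (\<lambda>_. borel)) (\<lambda>z. restrict z J)"
      unfolding P_def by (intro distr_distr[symmetric] res res_\<mu> b JH)
    finally show "P J = distr (P H) (PiM J (\<lambda>_. borel)) (\<lambda>z. restrict z J)" .
  qed (rule P_prob)
  have res_lim: "(\<lambda>z. restrict z J) \<in> lim \<rightarrow>\<^sub>M PiM J (\<lambda>_. borel)" for J
    by (subst measurable_cong_sets[OF sets_lim refl]) (rule res, simp)
  have lim: "distr lim (borel_fun N) (\<lambda>z. restrict z {..<N}) = \<mu> N" for N
  proof -
    have "P {..<N} = distr (\<mu> (b {..<N})) (borel_fun N) (\<lambda>z. restrict z {..<N})" by (simp add: P_def)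
    also have "\<dots> = \<mu> N" using b[of "{..<N}"] by (intro cons) (auto simp: lessThan_subset_iff)
    finally have PN: "P {..<N} = \<mu> N" .
    show ?thesis
    proof (rule measure_eqI)
      fix X assume "X \<in> sets (distr lim (borel_fun N) (\<lambda>z. restrict z {..<N}))"
      then have X: "X \<in> sets (borel_fun N)" by simp
      have "emeasure (distr lim (borel_fun N) (\<lambda>z. restrict z {..<N})) X = emeasure lim (emb UNIV {..<N} X)"
        by (subst emeasure_distr[OF res_lim X]) (simp add: prod_emb_def space_PiM)
      also have "\<dots> = emeasure (\<mu> N) X"
        using emeasure_lim_emb[of "{..<N}" X] X by (simp add: PN)
      finally show "emeasure (distr lim (borel_fun N) (\<lambda>z. restrict z {..<N})) X = emeasure (\<mu> N) X" .
    qed (simp add: sets)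
  qed
  \<comment> \<open>Under \<open>lim\<close> the coordinates are nonnegative only almost surely;
    \<open>max 0\<close> makes them so at every point. The shift by 1 undoes
    \<open>Suc p\<close>.\<close>
  define Z :: "nat \<Rightarrow> (nat \<Rightarrow> real) \<Rightarrow> real" where "Z j w = max 0 (w (j - 1))" for j w
  have "permanental_sequence lim \<alpha> V Z"
    unfolding permanental_sequence_def det_permanental_eq
  proof (intro conjI allI impI ballI)
    show "prob_space lim" by (rule P.prob_space_axioms)
    have "(\<lambda>w. w (j - 1)) \<in> lim \<rightarrow>\<^sub>M borel" for j
      by (subst measurable_cong_sets[OF sets_lim refl]) (rule measurable_component_singleton, simp)
    then show "Z j \<in> borel_measurable lim" for j
      unfolding Z_def by (intro borel_measurable_max) auto
    show "0 \<le> Z j w" for j w by (simp add: Z_def)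
    fix n and i :: "nat \<Rightarrow> nat" and s :: "nat \<Rightarrow> real"
    assume h: "inj_on i {..<n} \<and> i ` {..<n} \<subseteq> {1..} \<and> (\<forall>m<n. 0 < s m)"
    define i' where "i' m = i m - 1" for m
    have i1: "1 \<le> i m" if "m < n" for m using h that by (auto simp: image_subset_iff)
    have i': "Suc (i' m) = i m" if "m < n" for m using i1[OF that] by (simp add: i'_def)
    have inj: "inj_on i' {..<n}"
    proof (rule inj_onI)
      fix m l assume "m \<in> {..<n}" "l \<in> {..<n}" "i' m = i' l"
      moreover from this have "i m = i l" using i'[of m] i'[of l] by simp
      ultimately show "m = l" using h by (auto dest: inj_onD)
    qed
    define N where "N = b (i' ` {..<n})"
    have sub: "i' ` {..<n} \<subseteq> {..<N}" unfolding N_def by (rule b) simp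
    define s' where "s' l = (if l \<in> i' ` {..<n} then s (inv_into {..<n} i' l) else 0)" for l
    have s': "s' (i' m) = s m" if "m < n" for m
      using inj that by (simp add: s'_def)
    have sum: "(\<Sum>l<N. s' l * z l) = (\<Sum>m<n. s m * z (i' m))" for z :: "nat \<Rightarrow> real"
    proof -
      have "(\<Sum>l<N. s' l * z l) = (\<Sum>l\<in>i' ` {..<n}. s' l * z l)"
        using sub by (intro sum.mono_neutral_right) (auto simp: s'_def)
      also have "\<dots> = (\<Sum>m<n. s m * z (i' m))" using inj by (simp add: sum.reindex s')
      finally show ?thesis .
    qed
    have T: "(\<lambda>z. restrict z {..<N}) \<in> lim \<rightarrow>\<^sub>M borel_fun N" by (rule res_lim)
    have aeN: "AE w in lim. nonneg_upto N (restrict w {..<N})"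
      by (rule AE_distrD[OF T]) (unfold lim, rule ae)
    have "integral\<^sup>L lim (\<lambda>w. exp (- (\<Sum>m<n. s m * Z (i m) w))) = integral\<^sup>L lim (\<lambda>w. laplace_kernel N s' (restrict w {..<N}))"
    proof (rule integral_cong_AE)
      show "AE w in lim. exp (- (\<Sum>m<n. s m * Z (i m) w)) = laplace_kernel N s' (restrict w {..<N})"
        using aeN
      proof eventually_elim
        case (elim w)
        have "Z (i m) w = w (i' m)" if "m < n" for m
        proof -
          have "i' m < N" using sub that by auto
          then have "0 \<le> w (i' m)" using elim by auto
          then show ?thesis by (simp add: Z_def i'_def)
        qed
        then have "(\<Sum>m<n. s m * Z (i m) w) = (\<Sum>m<n. s m * w (i' m))" by simp
        also have "\<dots> = (\<Sum>l<N. s' l * restrict w {..<N} l)" by (simp add: sum[symmetric])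
        finally show ?case by (simp only: laplace_kernel_def)
      qed
      show "(\<lambda>w. exp (- (\<Sum>m<n. s m * Z (i m) w))) \<in> borel_measurable lim"
        using \<open>\<And>j. Z j \<in> borel_measurable lim\<close> by measurable
      show "(\<lambda>w. laplace_kernel N s' (restrict w {..<N})) \<in> borel_measurable lim"
        by (rule measurable_compose[OF T measurable_laplace_kernel])
    qed
    also have "\<dots> = integral\<^sup>L (distr lim (borel_fun N) (\<lambda>z. restrict z {..<N})) (laplace_kernel N s')"
      by (rule integral_distr[OF T measurable_laplace_kernel, symmetric])
    also have "\<dots> = D N s' powr (- \<alpha>)"
      unfolding lim using h inj by (intro laplace_of_integral[OF \<mu>']) (auto simp: s'_def less_imp_le)
    also have "D N s' = kdet n (\<lambda>p q. of_bool (p = q) + V (Suc (i' p)) (Suc (i' q)) * s q)"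
      unfolding D_def
      by (rule kdet_select[of i' n N s' s "\<lambda>p q. V (Suc p) (Suc q)", symmetric])
        (use inj sub s' in \<open>auto simp: s'_def\<close>)
    also have "\<dots> = kdet n (\<lambda>p q. of_bool (p = q) + V (i p) (i q) * s q)"
      by (rule kdet_cong) (simp add: i')
    finally show "integral\<^sup>L lim (\<lambda>w. exp (- (\<Sum>m<n. s m * Z (i m) w))) =
      kdet n (\<lambda>p q. of_bool (p = q) + V (i p) (i q) * s q) powr (- \<alpha>)" .
  qed
  then show ?thesis by blast
qed

section \<open>The upper bound\<close>

lemma kdet_1: "kdet (Suc 0) B = B 0 0"
  unfolding kdet_def by (subst det_single) auto

lemma permanental_sequence_gamma:
  assumes Z: "permanental_sequence M \<alpha> V Z" and j: "1 \<le> j" and V: "0 < V j j" and \<alpha>: "0 < \<alpha>"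
  shows "distr M borel (Z j) = gamma_measure \<alpha> (1 / V j j)"
proof (rule laplace_unique_real)
  interpret prob_space M using Z by (simp add: permanental_sequence_def)
  have Zm: "Z j \<in> borel_measurable M" "\<forall>w\<in>space M. 0 \<le> Z j w"
    using Z j by (auto simp: permanental_sequence_def)
  interpret G: prob_space "gamma_measure \<alpha> (1 / V j j)" using \<alpha> V by (intro prob_space_gamma_measure) auto
  interpret D: prob_space "distr M borel (Z j)" by (rule prob_space_distr[OF Zm(1)])
  show "finite_measure (distr M borel (Z j))" "finite_measure (gamma_measure \<alpha> (1 / V j j))" by unfold_locales
  show "AE x in distr M borel (Z j). 0 \<le> x"
    by (subst AE_distr_iff[OF Zm(1)]) (use Zm in auto)
  fix s :: real assume s: "0 < s"
  have "integral\<^sup>L M (\<lambda>w. exp (- (\<Sum>m<Suc 0. s * Z j w))) =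
      kdet (Suc 0) (\<lambda>p q. of_bool (p = q) + V j j * s) powr (- \<alpha>)"
    using Z s j unfolding permanental_sequence_def det_permanental_eq
    by (elim conjE) (drule spec[of _ "Suc 0"], drule spec[of _ "\<lambda>_. j"], drule spec[of _ "\<lambda>_. s"], auto simp: inj_on_def)
  then have "integral\<^sup>L (distr M borel (Z j)) (\<lambda>x. exp (- (s * x))) = (1 + V j j * s) powr (- \<alpha>)"
    using Zm by (subst integral_distr) (auto simp: kdet_1)
  also have "\<dots> = ((1 / V j j) / (1 / V j j + s)) powr \<alpha>"
  proof -
    have "(1 / V j j) / (1 / V j j + s) = 1 / (1 + V j j * s)" using V s by (simp add: field_simps)
    moreover have "0 < 1 + V j j * s" using V s by (simp add: add_pos_pos)
    ultimately show ?thesis by (simp add: powr_divide powr_minus_divide)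
  qed
  also have "\<dots> = integral\<^sup>L (gamma_measure \<alpha> (1 / V j j)) (\<lambda>x. exp (- (s * x)))"
    using gamma_measure_laplace[OF \<alpha>, of "1 / V j j" s] V s
    by (subst integral_eq_nn_integral) (auto simp: less_trans[of _ 0])
  finally show "integral\<^sup>L (distr M borel (Z j)) (\<lambda>x. exp (- (s * x))) =
      integral\<^sup>L (gamma_measure \<alpha> (1 / V j j)) (\<lambda>x. exp (- (s * x)))" .
qed (use AE_gamma_measure_nonneg in auto)

lemma permanental_sequence_upper:
  assumes Z: "permanental_sequence M \<alpha> V Z" and V: "\<And>j. 1 \<le> j \<Longrightarrow> 0 < V j j" and \<alpha>: "0 < \<alpha>"
    and e: "0 < e"
  shows "AE w in M. eventually (\<lambda>n. Z n w \<le> (1 + e) * V n n * ln (real n)) sequentially"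
proof -
  interpret prob_space M using Z by (simp add: permanental_sequence_def)
  have Zm: "Z j \<in> borel_measurable M" if "1 \<le> j" for j
    using Z that by (auto simp: permanental_sequence_def)
  define t where "t n = (1 + e) * V n n * ln (real n)" for n
  define E where "E n = {w \<in> space M. t (Suc n) < Z (Suc n) w}" for n
  \<comment> \<open>Chosen so that the exponent \<open>(1 - \<delta>) * (1 + e)\<close> is
    \<open>1 + e / 2\<close>, which exceeds 1 and makes the tails summable.\<close>
  define \<delta> where "\<delta> = e / (2 * (1 + e))"
  have \<delta>: "0 < \<delta>" "\<delta> \<le> 1" "(1 - \<delta>) * (1 + e) = 1 + e / 2"
    using e by (auto simp: \<delta>_def field_simps)
  have E: "E n \<in> sets M" for n unfolding E_def using Zm[of "Suc n"] by measurable
  have le: "prob (E n) \<le> \<delta> powr (- \<alpha>) * real (Suc n) powr (- (1 + e / 2))" for n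
  proof -
    let ?v = "V (Suc n) (Suc n)"
    have v: "0 < ?v" by (rule V) simp
    have "prob (E n) = measure (distr M borel (Z (Suc n))) {t (Suc n)<..}"
      using Zm[of "Suc n"] by (subst measure_distr) (auto simp: E_def vimage_def intro!: arg_cong[of _ _ prob])
    also have "\<dots> = measure (gamma_measure \<alpha> (1 / ?v)) {t (Suc n)<..}"
      by (subst permanental_sequence_gamma[OF Z _ v \<alpha>]) auto
    also have "\<dots> \<le> \<delta> powr (- \<alpha>) * exp (- ((1 - \<delta>) * (1 / ?v * t (Suc n))))"
      using v by (intro gamma_measure_upper_tail \<alpha> \<delta>) auto
    also have "(1 - \<delta>) * (1 / ?v * t (Suc n)) = (1 - \<delta>) * (1 + e) * ln (real (Suc n))"
      using v by (simp add: t_def del: of_nat_Suc)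
    also have "\<dots> = (1 + e / 2) * ln (real (Suc n))" by (simp only: \<delta>(3))
    also have "exp (- ((1 + e / 2) * ln (real (Suc n)))) = real (Suc n) powr (- (1 + e / 2))"
      by (simp add: powr_def algebra_simps del: of_nat_Suc)
    finally show ?thesis .
  qed
  have "summable (\<lambda>n. prob (E n))"
  proof (rule summable_comparison_test')
    have "summable (\<lambda>n. real n powr (- (1 + e / 2)))" using e by (simp add: summable_real_powr_iff)
    then have "summable (\<lambda>n. real (Suc n) powr (- (1 + e / 2)))" by (subst summable_Suc_iff)
    then show "summable (\<lambda>n. \<delta> powr (- \<alpha>) * real (Suc n) powr (- (1 + e / 2)))" by (rule summable_mult)
    show "norm (prob (E n)) \<le> \<delta> powr (- \<alpha>) * real (Suc n) powr (- (1 + e / 2))" for n using le[of n] by simp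
  qed
  then have "AE w in M. eventually (\<lambda>n. w \<in> space M - E n) sequentially"
    by (intro borel_cantelli_AE1 E) (simp_all add: emeasure_eq_measure)
  then show ?thesis
  proof eventually_elim
    case (elim w)
    then have "eventually (\<lambda>n. Z (Suc n) w \<le> t (Suc n)) sequentially"
      by eventually_elim (auto simp: E_def not_less)
    then have "eventually (\<lambda>n. Z n w \<le> t n) sequentially"
      using eventually_sequentially_Suc[of "\<lambda>n. Z n w \<le> t n"] by simp
    then show ?case by (simp add: t_def)
  qed
qed

section \<open>The lower bound\<close>

text \<open>For an independent set of largest size, every other vertex is adjacent to a member, so
  the closed neighbourhoods of the members, each of size at most \<open>Suc d\<close>, cover
  \<open>V\<close>.\<close>

lemma ex_independent_set:
  assumes "finite V" and deg: "\<And>v. v \<in> V \<Longrightarrow> card {u \<in> V. u \<noteq> v \<and> adj v u} \<le> d"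
    and sym: "\<And>u v. adj u v \<Longrightarrow> adj v u"
  obtains F where "F \<subseteq> V" "\<And>u v. u \<in> F \<Longrightarrow> v \<in> F \<Longrightarrow> u \<noteq> v \<Longrightarrow> \<not> adj u v" "card V \<le> Suc d * card F"
proof -
  define I where "I = {F. F \<subseteq> V \<and> (\<forall>u\<in>F. \<forall>v\<in>F. u \<noteq> v \<longrightarrow> \<not> adj u v)}"
  have "finite I" "I \<noteq> {}" using assms(1) by (auto simp: I_def)
  then have "Max (card ` I) \<in> card ` I" by (intro Max_in) auto
  then obtain F where F: "F \<in> I" "card F = Max (card ` I)" by auto
  have max: "card F' \<le> card F" if "F' \<in> I" for F'
    unfolding F(2) using that \<open>finite I\<close> by (intro Max_ge) auto
  have FV: "F \<subseteq> V" "finite F" using F(1) assms(1) finite_subset by (auto simp: I_def)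
  have "V \<subseteq> (\<Union>u\<in>F. insert u {w \<in> V. w \<noteq> u \<and> adj u w})"
  proof
    fix v assume v: "v \<in> V"
    show "v \<in> (\<Union>u\<in>F. insert u {w \<in> V. w \<noteq> u \<and> adj u w})"
    proof (rule ccontr)
      assume n: "v \<notin> (\<Union>u\<in>F. insert u {w \<in> V. w \<noteq> u \<and> adj u w})"
      then have vF: "v \<notin> F" by auto
      have "insert v F \<in> I"
        using F(1) v n vF sym by (auto simp: I_def)
      then show False using max[of "insert v F"] vF FV by simp
    qed
  qed
  then have "card V \<le> card (\<Union>u\<in>F. insert u {w \<in> V. w \<noteq> u \<and> adj u w})"
    using FV assms(1) by (intro card_mono) auto
  also have "\<dots> \<le> (\<Sum>u\<in>F. card (insert u {w \<in> V. w \<noteq> u \<and> adj u w}))"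
    using FV by (intro card_UN_le)
  also have "\<dots> \<le> (\<Sum>u\<in>F. Suc d)"
    using FV deg assms(1) by (intro sum_mono) (auto simp: card_insert_if)
  also have "\<dots> = Suc d * card F" by simp
  finally show ?thesis using F(1) by (intro that[of F]) (auto simp: I_def)
qed

section \<open>Potentials with a rank-one perturbation\<close>

abbreviation rank_one_inverses :: "nat \<Rightarrow> (nat \<Rightarrow> nat \<Rightarrow> real) \<Rightarrow> (nat \<Rightarrow> real) \<Rightarrow>
    (nat \<Rightarrow> nat \<Rightarrow> real) \<Rightarrow> (nat \<Rightarrow> nat \<Rightarrow> real) \<Rightarrow> bool"
  where "rank_one_inverses n K f A A' \<equiv> inverse_kernels n K A \<and>
    (\<forall>p<n. \<forall>q<n. p \<noteq> q \<longrightarrow> A p q \<le> 0) \<and> (\<forall>p<n. 0 \<le> (\<Sum>q<n. A p q)) \<and>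
    inverse_kernels n (\<lambda>p q. K p q + f q) A' \<and> (\<forall>p<n. \<forall>q<n. A' p q \<le> A p q)"

text \<open>What the limit theorem uses of the process, with the potential theory condensed into the
  two inverses on every finite section.\<close>

locale rank_one_potential =
  fixes U :: "nat \<Rightarrow> nat \<Rightarrow> real" and f :: "nat \<Rightarrow> real" and C \<delta> :: real
  assumes U_pos: "1 \<le> j \<Longrightarrow> 1 \<le> k \<Longrightarrow> 0 < U j k"
    and row: "1 \<le> j \<Longrightarrow> U j summable_on {1..}" "1 \<le> j \<Longrightarrow> infsum (U j) {1..} \<le> C"
    and col: "1 \<le> k \<Longrightarrow> (\<lambda>j. U j k) summable_on {1..}" "1 \<le> k \<Longrightarrow> infsum (\<lambda>j. U j k) {1..} \<le> C"
    and diag: "1 \<le> j \<Longrightarrow> \<delta> \<le> U j j" and \<delta>: "0 < \<delta>"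
    and f_nonneg: "1 \<le> k \<Longrightarrow> 0 \<le> f k"
    and f_tendsto: "f \<longlonglongrightarrow> 0"
    and inverse: "inj_on i {..<n} \<Longrightarrow> i ` {..<n} \<subseteq> {1..} \<Longrightarrow> \<exists>A A'.
      rank_one_inverses n (\<lambda>p q. U (i p) (i q)) (\<lambda>q. f (i q)) A A'"
begin

abbreviation "V \<equiv> \<lambda>j k. U j k + f k"

lemma V_pos: "1 \<le> j \<Longrightarrow> 1 \<le> k \<Longrightarrow> 0 < V j k"
  using U_pos f_nonneg by (simp add: add_pos_nonneg)

lemma marginal_law:
  assumes i: "inj_on i {..<n}" "i ` {..<n} \<subseteq> {1..}" and \<alpha>: "0 < \<alpha>"
  shows "\<exists>\<mu> A A'. laplace_of n \<mu> (permanental_laplace \<alpha> n (\<lambda>p q. V (i p) (i q))) \<and>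
    inverse_kernels n (\<lambda>p q. U (i p) (i q)) A \<and> (\<forall>p<n. \<forall>q<n. p \<noteq> q \<longrightarrow> A p q \<le> 0) \<and>
    (\<forall>p<n. 0 \<le> (\<Sum>q<n. A p q)) \<and> (\<forall>p<n. 0 < A' p p) \<and> (\<forall>p<n. A' p p \<le> A p p) \<and>
    gamma_dominated \<alpha> n (\<lambda>p. A' p p) \<mu>"
proof -
  have i1: "1 \<le> i p" if "p < n" for p using i(2) that by auto
  obtain A A' where h: "inverse_kernels n (\<lambda>p q. U (i p) (i q)) A"
      "\<forall>p<n. \<forall>q<n. p \<noteq> q \<longrightarrow> A p q \<le> 0" "\<forall>p<n. 0 \<le> (\<Sum>q<n. A p q)"
      "inverse_kernels n (\<lambda>p q. V (i p) (i q)) A'" "\<forall>p<n. \<forall>q<n. A' p q \<le> A p q"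
    using inverse[OF i] by (elim exE conjE) (rule that)
  have off: "A' p q \<le> 0" if "p < n" "q < n" "p \<noteq> q" for p q
    using h(2,5) that by (meson order_trans)
  have "\<exists>\<mu>. laplace_of n \<mu> (permanental_laplace \<alpha> n (\<lambda>p q. V (i p) (i q))) \<and>
    (\<forall>p<n. 0 < A' p p) \<and> gamma_dominated \<alpha> n (\<lambda>p. A' p p) \<mu>"
  proof (rule permanental_law[OF h(4) _ _ _ \<alpha>])
    show "A' p q \<le> 0" if "p < n" "q < n" "p \<noteq> q" for p q by (rule off[OF that])
    show "0 \<le> V (i p) (i q)" if "p < n" "q < n" for p q
      using V_pos[OF i1[OF that(1)] i1[OF that(2)]] by (rule less_imp_le)
    show "0 < V (i p) (i p)" if "p < n" for p by (rule V_pos[OF i1[OF that] i1[OF that]])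
  qed
  then obtain \<mu> where \<mu>: "laplace_of n \<mu> (permanental_laplace \<alpha> n (\<lambda>p q. V (i p) (i q)))"
    "\<forall>p<n. 0 < A' p p"
    "gamma_dominated \<alpha> n (\<lambda>p. A' p p) \<mu>"
    by (elim exE conjE) (rule that)
  show ?thesis
    by (intro exI[of _ \<mu>] exI[of _ A] exI[of _ A'] conjI \<mu> h(1-3)) (use h(5) in simp)
qed

lemma permanental_exists:
  assumes \<alpha>: "0 < \<alpha>"
  shows "\<exists>(M :: (nat \<Rightarrow> real) measure) Z. permanental_sequence M \<alpha> V Z"
proof -
  have "\<exists>\<mu>. laplace_of N \<mu> (permanental_laplace \<alpha> N (\<lambda>p q. V (Suc p) (Suc q)))" for N
  proof -
    have "inj_on Suc {..<N}" "Suc ` {..<N} \<subseteq> {1..}" by auto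
    from marginal_law[OF this \<alpha>] show ?thesis by (elim exE conjE) (rule exI)
  qed
  then have "\<exists>\<mu>. \<forall>N. laplace_of N (\<mu> N) (permanental_laplace \<alpha> N (\<lambda>p q. V (Suc p) (Suc q)))"
    by (intro choice allI)
  then show ?thesis by (elim exE) (rule permanental_sequence_exists, erule spec)
qed

lemma card_large_entries:
  assumes g: "g summable_on {1..}" "infsum g {1..} \<le> C" "\<And>k. 1 \<le> k \<Longrightarrow> 0 \<le> g k" and \<eta>: "0 < \<eta>"
    and G: "finite G" "G \<subseteq> {1..}" "\<And>k. k \<in> G \<Longrightarrow> \<eta> < g k"
  shows "real (card G) \<le> C / \<eta>"
proof -
  have "real (card G) * \<eta> = (\<Sum>k\<in>G. \<eta>)" by simp
  also have "\<dots> \<le> sum g G" using G by (intro sum_mono) (auto intro: less_imp_le)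
  also have "\<dots> \<le> infsum g {1..}" using G g by (intro finite_sum_le_infsum) auto
  finally show ?thesis using g(2) \<eta> by (simp add: field_simps)
qed

lemma ex_separated_set:
  assumes \<eta>: "0 < \<eta>"
  obtains D :: nat where "\<And>S. finite S \<Longrightarrow> S \<subseteq> {1..} \<Longrightarrow>
    \<exists>F\<subseteq>S. (\<forall>u\<in>F. \<forall>v\<in>F. u \<noteq> v \<longrightarrow> U u v \<le> \<eta>) \<and> card S \<le> Suc D * card F"
proof
  \<comment> \<open>The bounds on row and column sums allow at most \<open>C / \<eta>\<close>
    entries above \<open>\<eta>\<close> in each row and in each column. This degree bound does not
    depend on \<open>S\<close>, so a fixed fraction of every \<open>S\<close> survives.\<close>
  define D where "D = 2 * nat \<lfloor>C / \<eta>\<rfloor>"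
  fix S :: "nat set" assume S: "finite S" "S \<subseteq> {1..}"
  let ?adj = "\<lambda>u v. \<eta> < U u v \<or> \<eta> < U v u"
  have deg: "card {u \<in> S. u \<noteq> v \<and> ?adj v u} \<le> D" if v: "v \<in> S" for v
  proof -
    have v1: "1 \<le> v" using v S by auto
    have "real (card {u \<in> S. \<eta> < U v u}) \<le> C / \<eta>" "real (card {u \<in> S. \<eta> < U u v}) \<le> C / \<eta>"
      using S
      by (intro card_large_entries[OF row(1)[OF v1] row(2)[OF v1] less_imp_le[OF U_pos] \<eta>]
          card_large_entries[OF col(1)[OF v1] col(2)[OF v1] less_imp_le[OF U_pos] \<eta>]; use v1 in auto)+
    then have le: "card {u \<in> S. \<eta> < U v u} \<le> nat \<lfloor>C / \<eta>\<rfloor>" "card {u \<in> S. \<eta> < U u v} \<le> nat \<lfloor>C / \<eta>\<rfloor>"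
      by (simp_all add: le_nat_floor)
    have "card {u \<in> S. u \<noteq> v \<and> ?adj v u} \<le> card ({u \<in> S. \<eta> < U v u} \<union> {u \<in> S. \<eta> < U u v})"
      using S by (intro card_mono) auto
    also have "\<dots> \<le> card {u \<in> S. \<eta> < U v u} + card {u \<in> S. \<eta> < U u v}" by (rule card_Un_le)
    finally show ?thesis using le by (simp add: D_def)
  qed
  obtain F where F: "F \<subseteq> S" "\<And>u v. u \<in> F \<Longrightarrow> v \<in> F \<Longrightarrow> u \<noteq> v \<Longrightarrow> \<not> ?adj u v" "card S \<le> Suc D * card F"
    by (rule ex_independent_set[of S ?adj D, OF S(1) deg]) auto
  show "\<exists>F\<subseteq>S. (\<forall>u\<in>F. \<forall>v\<in>F. u \<noteq> v \<longrightarrow> U u v \<le> \<eta>) \<and> card S \<le> Suc D * card F"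
    by (rule exI[of _ F]) (use F in \<open>force simp: not_less\<close>)
qed

text \<open>The diagonal entry at \<open>p\<close> of \<open>A U = I\<close>, with the off-diagonal row sum of \<open>- A\<close> at most \<open>A p p\<close>.\<close>

lemma inverse_diagonal_bound:
  assumes inv: "inverse_kernels n (\<lambda>p q. U (i p) (i q)) A"
    and off: "\<And>q. q < n \<Longrightarrow> p \<noteq> q \<Longrightarrow> A p q \<le> 0" and row: "0 \<le> (\<Sum>q<n. A p q)" and p: "p < n"
    and small: "\<And>q. q < n \<Longrightarrow> q \<noteq> p \<Longrightarrow> U (i q) (i p) \<le> \<eta>" and \<eta>: "0 \<le> \<eta>"
  shows "A p p * (U (i p) (i p) - \<eta>) \<le> 1"
proof -
  let ?R = "{..<n} - {p}"
  have "1 = (\<Sum>l<n. A p l * U (i l) (i p))" using inverse_kernelsD(1)[OF inv p p] by simp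
  also have "\<dots> = A p p * U (i p) (i p) + (\<Sum>l\<in>?R. A p l * U (i l) (i p))"
    using p by (intro sum.remove) auto
  finally have e: "1 = A p p * U (i p) (i p) + (\<Sum>l\<in>?R. A p l * U (i l) (i p))" .
  have "(\<Sum>l\<in>?R. A p l * \<eta>) \<le> (\<Sum>l\<in>?R. A p l * U (i l) (i p))"
    using off small by (intro sum_mono mult_left_mono_neg) auto
  moreover have "(\<Sum>q<n. A p q) = A p p + (\<Sum>l\<in>?R. A p l)" using p by (intro sum.remove) auto
  then have "- A p p \<le> (\<Sum>l\<in>?R. A p l)" using row by simp
  then have "\<eta> * - A p p \<le> \<eta> * (\<Sum>l\<in>?R. A p l)" using \<eta> by (rule mult_left_mono)
  then have "\<eta> * - A p p \<le> (\<Sum>l\<in>?R. A p l * \<eta>)" by (simp add: sum_distrib_left mult.commute)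
  ultimately show ?thesis using e by (simp add: algebra_simps)
qed

text \<open>For the state \<open>j\<close> at position \<open>p\<close>,
  \<open>A' p p \<le> A p p \<le> 1 / (U j j - \<eta>)\<close>, and
  \<open>U j j \<ge> \<delta>\<close> turns the loss \<open>\<eta>\<close> into the factor
  \<open>1 - \<eta> / \<delta>\<close>. Hence the threshold \<open>\<theta> * U j j\<close> is at
  most \<open>x / A' p p\<close>, where the tail bound depends only on \<open>x\<close> and
  \<open>\<alpha>\<close>.\<close>

lemma lower_probability:
  assumes Z: "permanental_sequence M \<alpha> V Z" and \<alpha>: "0 < \<alpha>"
    and F: "finite F" "F \<subseteq> {1..}" and sep: "\<And>u v. u \<in> F \<Longrightarrow> v \<in> F \<Longrightarrow> u \<noteq> v \<Longrightarrow> U u v \<le> \<eta>"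
    and \<eta>: "0 \<le> \<eta>" "\<eta> < \<delta>" and x: "1 \<le> x" and \<theta>: "\<theta> \<le> (1 - \<eta> / \<delta>) * x"
  shows "measure M {w \<in> space M. \<forall>j\<in>F. Z j w \<le> \<theta> * U j j} \<le>
    (1 - exp (- x - 1) / ((x + 1) * Gamma \<alpha>)) ^ card F"
proof -
  define n where "n = card F"
  obtain i where i: "bij_betw i {..<n} F"
    using ex_bij_betw_nat_finite[OF F(1)] by (auto simp: n_def atLeast0LessThan)
  have inj: "inj_on i {..<n}" and iF: "i ` {..<n} = F" using i by (auto simp: bij_betw_def)
  have i1: "1 \<le> i p" and iF': "i p \<in> F" if "p < n" for p using iF F that by auto
  obtain \<mu> A A' where \<mu>: "laplace_of n \<mu> (permanental_laplace \<alpha> n (\<lambda>p q. V (i p) (i q)))"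
    and A1: "inverse_kernels n (\<lambda>p q. U (i p) (i q)) A" and h: "\<forall>p<n. \<forall>q<n. p \<noteq> q \<longrightarrow> A p q \<le> 0"
    "\<forall>p<n. 0 \<le> (\<Sum>q<n. A p q)" "\<forall>p<n. 0 < A' p p" "\<forall>p<n. A' p p \<le> A p p"
    "gamma_dominated \<alpha> n (\<lambda>p. A' p p) \<mu>"
    using marginal_law[OF inj _ \<alpha>, unfolded iF, OF F(2)] by (elim exE conjE) (rule that)
  have A': "0 < A' p p" "A' p p \<le> A p p" if "p < n" for p using h(3,4) that by simp_all
  define t where "t p = \<theta> * U (i p) (i p)" for p
  have law: "distr M (borel_fun n) (\<lambda>w. \<lambda>p\<in>{..<n}. Z (i p) w) = \<mu>"
    by (rule permanental_marginal[OF Z inj _ \<mu>]) (use iF F in auto)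
  have T: "(\<lambda>w. \<lambda>p\<in>{..<n}. Z (i p) w) \<in> M \<rightarrow>\<^sub>M borel_fun n"
    using Z i1 by (intro measurable_restrict) (auto simp: permanental_sequence_def)
  have \<mu>M: "measure \<mu> {z \<in> space (borel_fun n). \<forall>p<n. z p \<le> t p} =
      measure M {w \<in> space M. \<forall>j\<in>F. Z j w \<le> \<theta> * U j j}"
    unfolding law[symmetric]
  proof (subst measure_distr[OF T])
    show "{z \<in> space (borel_fun n). \<forall>p<n. z p \<le> t p} \<in> sets (borel_fun n)" by measurable
    show "measure M ((\<lambda>w. \<lambda>p\<in>{..<n}. Z (i p) w) -` {z \<in> space (borel_fun n). \<forall>p<n. z p \<le> t p} \<inter> space M) =
        measure M {w \<in> space M. \<forall>j\<in>F. Z j w \<le> \<theta> * U j j}"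
      by (rule arg_cong[of _ _ "measure M"]) (auto simp: space_PiM iF[symmetric] t_def)
  qed
  note \<mu>M[symmetric]
  also note h(5)[rule_format, of t]
  also have "(\<Prod>p<n. measure (gamma_measure \<alpha> (A' p p)) {..t p}) \<le>
      (\<Prod>p<n. 1 - exp (- x - 1) / ((x + 1) * Gamma \<alpha>))"
  proof (rule prod_mono, rule conjI)
    fix p assume "p \<in> {..<n}"
    then have p: "p < n" by simp
    interpret G: prob_space "gamma_measure \<alpha> (A' p p)" by (rule prob_space_gamma_measure[OF \<alpha> A'(1)[OF p]])
    have U: "\<delta> \<le> U (i p) (i p)" by (rule diag[OF i1[OF p]])
    have "A p p * (U (i p) (i p) - \<eta>) \<le> 1"
    proof (rule inverse_diagonal_bound[OF A1 _ h(2)[rule_format, OF p] p _ \<eta>(1)])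
      show "U (i q) (i p) \<le> \<eta>" if "q < n" "q \<noteq> p" for q
        using that p inj by (intro sep iF') (auto dest: inj_onD)
    qed (use h(1) p in auto)
    moreover have "A' p p * (U (i p) (i p) - \<eta>) \<le> A p p * (U (i p) (i p) - \<eta>)"
      using A'(2)[OF p] U \<eta> by (intro mult_right_mono) auto
    moreover have "(1 - \<eta> / \<delta>) * U (i p) (i p) \<le> U (i p) (i p) - \<eta>"
      using mult_left_mono[OF U \<eta>(1)] \<delta> by (simp add: field_simps)
    then have "A' p p * ((1 - \<eta> / \<delta>) * U (i p) (i p)) \<le> A' p p * (U (i p) (i p) - \<eta>)"
      using A'(1)[OF p] by (intro mult_left_mono) auto
    ultimately have le: "A' p p * ((1 - \<eta> / \<delta>) * U (i p) (i p)) \<le> 1" by linarith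
    have "A' p p * t p \<le> A' p p * ((1 - \<eta> / \<delta>) * x * U (i p) (i p))"
      unfolding t_def using \<theta> U \<delta> A'(1)[OF p] by (intro mult_left_mono mult_right_mono) auto
    also have "\<dots> = x * (A' p p * ((1 - \<eta> / \<delta>) * U (i p) (i p)))" by simp
    also have "\<dots> \<le> x * 1" using le x by (intro mult_left_mono) auto
    finally have "t p \<le> x / A' p p" using A'(1)[OF p] by (simp add: field_simps)
    then have "measure (gamma_measure \<alpha> (A' p p)) {..t p} \<le> measure (gamma_measure \<alpha> (A' p p)) {..x / A' p p}"
      by (intro G.finite_measure_mono) auto
    also have "\<dots> \<le> 1 - exp (- (A' p p * (x / A' p p)) - 1) / ((A' p p * (x / A' p p) + 1) * Gamma \<alpha>)"
      using A'(1)[OF p] x by (intro gamma_measure_lower_tail \<alpha>) auto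
    also have "A' p p * (x / A' p p) = x" using A'(1)[OF p] by simp
    finally show "measure (gamma_measure \<alpha> (A' p p)) {..t p} \<le> 1 - exp (- x - 1) / ((x + 1) * Gamma \<alpha>)" .
  qed simp
  also have "\<dots> = (1 - exp (- x - 1) / ((x + 1) * Gamma \<alpha>)) ^ card F" by (simp add: n_def)
  finally show ?thesis .
qed

text \<open>The event \<open>B\<close> of no exceedance from \<open>k\<close> on lies, for each
  \<open>N\<close>, in the event that a separated set of indices in \<open>{k..<N}\<close> stays
  below the level for \<open>N\<close>. The latter has probability at most
  \<open>exp (- (c N * ((N - k) / Suc D)))\<close>, and \<open>c N\<close> is of order
  \<open>N powr (- b) / ln N\<close> with \<open>b < 1\<close>, so the bound tends to 0.\<close>

lemma permanental_lower_null:
  assumes Z: "permanental_sequence M \<alpha> V Z" and \<alpha>: "0 < \<alpha>" and \<theta>: "0 < \<theta>" "\<theta> < 1" and k: "1 \<le> k"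
  shows "AE w in M. \<exists>n\<ge>k. \<theta> * U n n * ln (real n) < Z n w"
proof -
  interpret prob_space M using Z by (simp add: permanental_sequence_def)
  have Zm: "Z j \<in> borel_measurable M" if "1 \<le> j" for j
    using Z that by (auto simp: permanental_sequence_def)
  have ms: "{w \<in> space M. Z j w \<le> c} \<in> sets M" if "1 \<le> j" for j c
    using Zm[OF that] by measurable
  \<comment> \<open>The gap between \<open>\<theta>\<close> and 1 is split in two:
    \<open>\<eta>\<close> makes \<open>1 - \<eta> / \<delta>\<close> the mean of
    \<open>\<theta>\<close> and 1, and \<open>b\<close> is the remaining factor of
    \<open>\<theta>\<close>, still below 1.\<close>
  define b where "b = 2 * \<theta> / (1 + \<theta>)"
  have b: "0 < b" "b < 1" using \<theta> by (auto simp: b_def field_simps)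
  define \<eta> where "\<eta> = \<delta> * (1 - \<theta>) / 2"
  have \<eta>: "0 < \<eta>" "\<eta> < \<delta>"
  proof -
    have "\<delta> * ((1 - \<theta>) / 2) < \<delta> * 1" using \<theta> \<delta> by (intro mult_strict_left_mono) auto
    then show "\<eta> < \<delta>" by (simp add: \<eta>_def)
  qed (use \<theta> \<delta> in \<open>simp add: \<eta>_def\<close>)
  have e: "1 - \<eta> / \<delta> = (1 + \<theta>) / 2" using \<delta> by (simp add: \<eta>_def field_simps)
  have \<eta>b: "\<theta> = (1 - \<eta> / \<delta>) * b" unfolding e b_def using \<theta> by simp
  obtain D where D: "\<And>S. finite S \<Longrightarrow> S \<subseteq> {1..} \<Longrightarrow>
    \<exists>F\<subseteq>S. (\<forall>u\<in>F. \<forall>v\<in>F. u \<noteq> v \<longrightarrow> U u v \<le> \<eta>) \<and> card S \<le> Suc D * card F"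
    using ex_separated_set[OF \<eta>(1)] by blast
  define B where "B = {w \<in> space M. \<forall>n\<in>{k..}. Z n w \<le> \<theta> * U n n * ln (real n)}"
  have Bs: "B \<in> sets M"
  proof -
    have "{w \<in> space M. k \<le> n \<longrightarrow> Z n w \<le> \<theta> * U n n * ln (real n)} \<in> sets M" for n
      using ms[of n "\<theta> * U n n * ln (real n)"] k by (cases "k \<le> n") simp_all
    then have "{w \<in> space M. \<forall>n. k \<le> n \<longrightarrow> Z n w \<le> \<theta> * U n n * ln (real n)} \<in> sets M"
      by (rule sets.sets_Collect_countable_All)
    then show ?thesis unfolding B_def Ball_def atLeast_iff .
  qed
  define c where "c N = exp (- (b * ln (real N)) - 1) / ((b * ln (real N) + 1) * Gamma \<alpha>)" for N :: nat
  have G: "0 < Gamma \<alpha>" using \<alpha> by (rule Gamma_real_pos)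
  have le: "prob B \<le> exp (- (c N * ((real N - real k) / real (Suc D))))"
    if N: "k < N" "1 \<le> b * ln (real N)" for N
  proof -
    have "{k..<N} \<subseteq> {1..}" using k by auto
    then obtain F where F: "F \<subseteq> {k..<N}" "\<And>u v. u \<in> F \<Longrightarrow> v \<in> F \<Longrightarrow> u \<noteq> v \<Longrightarrow> U u v \<le> \<eta>"
      "card {k..<N} \<le> Suc D * card F"
      using D[of "{k..<N}"] by auto
    have Ff: "finite F" "F \<subseteq> {1..}" using F(1) k finite_subset by auto
    have c0: "0 \<le> c N" using N G by (simp add: c_def)
    \<comment> \<open>The tail bound at rate 1 serves to show \<open>c N \<le> 1\<close>, its left
      side being nonnegative.\<close>
    have "measure (gamma_measure \<alpha> 1) {..b * ln (real N)} \<le> 1 - c N"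
      using gamma_measure_lower_tail[OF \<alpha>, of 1 "b * ln (real N)"] N by (simp add: c_def)
    then have c1: "c N \<le> 1"
      using measure_nonneg[of "gamma_measure \<alpha> 1" "{..b * ln (real N)}"] by linarith
    have lnN: "ln (real j) \<le> ln (real N)" if "j \<in> F" for j using that F(1) k by (intro ln_mono) auto
    have "prob B \<le> prob {w \<in> space M. \<forall>j\<in>F. Z j w \<le> (\<theta> * ln (real N)) * U j j}"
    proof (rule finite_measure_mono)
      show "B \<subseteq> {w \<in> space M. \<forall>j\<in>F. Z j w \<le> (\<theta> * ln (real N)) * U j j}"
      proof safe
        fix w j assume w: "w \<in> B" and j: "j \<in> F"
        have "Z j w \<le> \<theta> * U j j * ln (real j)" using w j F(1) by (auto simp: B_def)
        also have "\<dots> \<le> \<theta> * U j j * ln (real N)"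
          using lnN[OF j] \<theta> U_pos[of j j] Ff j by (intro mult_left_mono) (auto intro: less_imp_le)
        finally show "Z j w \<le> (\<theta> * ln (real N)) * U j j" by (simp add: mult_ac)
      qed (auto simp: B_def)
      have "{w \<in> space M. Z j w \<le> (\<theta> * ln (real N)) * U j j} \<in> sets M" if "j \<in> F" for j
        using Ff that by (intro ms) auto
      then show "{w \<in> space M. \<forall>j\<in>F. Z j w \<le> (\<theta> * ln (real N)) * U j j} \<in> sets M"
        using Ff(1) by (intro sets.sets_Collect_finite_All) auto
    qed
    also have "\<dots> \<le> (1 - exp (- (b * ln (real N)) - 1) / ((b * ln (real N) + 1) * Gamma \<alpha>)) ^ card F"
      using \<eta> N F(2) by (intro lower_probability[OF Z \<alpha> Ff, where \<eta> = \<eta>]) (auto simp: \<eta>b)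
    also have "\<dots> = (1 - c N) ^ card F" by (simp add: c_def)
    also have "\<dots> \<le> exp (- c N) ^ card F"
      using c1 exp_ge_add_one_self[of "- c N"] by (intro power_mono) auto
    also have "\<dots> = exp (- (c N * real (card F)))" by (simp add: exp_of_nat_mult[symmetric] mult.commute)
    also have "\<dots> \<le> exp (- (c N * ((real N - real k) / real (Suc D))))"
    proof -
      have "real (card {k..<N}) \<le> real (Suc D * card F)" using F(3) by (simp only: of_nat_le_iff)
      then have "(real N - real k) / real (Suc D) \<le> real (card F)"
        using N by (simp add: field_simps of_nat_diff)
      then have "c N * ((real N - real k) / real (Suc D)) \<le> c N * real (card F)"
        using c0 by (rule mult_left_mono)
      then show ?thesis by simp
    qed
    finally show ?thesis .
  qed
  have "(\<lambda>N. exp (- (c N * ((real N - real k) / real (Suc D))))) \<longlonglongrightarrow> 0"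
  proof -
    define g d where "g = Gamma \<alpha>" and "d = real (Suc D)"
    have "0 < g" "0 < d" using G by (auto simp: g_def d_def)
    then have "((\<lambda>N. exp (- (exp (- (b * ln N) - 1) / ((b * ln N + 1) * g) * ((N - real k) / d)))) \<longlongrightarrow> 0) at_top"
      using b by real_asymp
    then show ?thesis
      unfolding c_def g_def d_def by (rule filterlim_compose[OF _ filterlim_real_sequentially])
  qed
  moreover have "eventually (\<lambda>N. prob B \<le> exp (- (c N * ((real N - real k) / real (Suc D))))) sequentially"
  proof -
    have "filterlim (\<lambda>N::nat. b * ln (real N)) at_top sequentially" using b by real_asymp
    then have "eventually (\<lambda>N. 1 \<le> b * ln (real N)) sequentially" by (simp add: filterlim_at_top)
    then show ?thesis using eventually_gt_at_top[of k] by eventually_elim (rule le)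
  qed
  ultimately have "prob B \<le> 0" by (intro tendsto_lowerbound[where F = sequentially]) auto
  then have "prob B = 0" using measure_nonneg[of M B] by simp
  then have "AE w in M. w \<notin> B" using Bs by (simp add: prob_eq_0)
  then show ?thesis
    using AE_space by eventually_elim (auto simp: B_def not_le)
qed

end

section \<open>From almost sure inequalities to the limsup\<close>

context rank_one_potential
begin

lemma limsup_ge_1:
  assumes "\<And>m k. 1 \<le> k \<Longrightarrow> \<exists>n\<ge>k. (1 - 1 / real (m + 2)) * U n n * ln (real n) < z n"
  shows "1 \<le> limsup (\<lambda>n. ereal (z n / (U n n * ln (real n))))"
proof -
  have ge: "ereal (1 - 1 / real (m + 2)) \<le> limsup (\<lambda>n. ereal (z n / (U n n * ln (real n))))" for m
    unfolding limsup_INF_SUP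
  proof (rule INF_greatest)
    fix k :: nat
    \<comment> \<open>From 2 on the logarithm is positive and may be divided by.\<close>
    have "1 \<le> max k 2" by simp
    from assms[OF this, of m] obtain n where n: "max k 2 \<le> n" "(1 - 1 / real (m + 2)) * U n n * ln (real n) < z n"
      by blast
    have "0 < U n n * ln (real n)" using n(1) by (intro mult_pos_pos U_pos ln_gt_zero) auto
    then have "1 - 1 / real (m + 2) \<le> z n / (U n n * ln (real n))"
      using n(2) by (simp add: pos_le_divide_eq mult.assoc del: of_nat_add)
    then show "ereal (1 - 1 / real (m + 2)) \<le> (SUP n\<in>{k..}. ereal (z n / (U n n * ln (real n))))"
      using n(1) by (intro SUP_upper2[of n]) auto
  qed
  have "(\<lambda>m. 1 - 1 / real (m + 2)) \<longlonglongrightarrow> 1" by real_asymp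
  then have "(\<lambda>m. ereal (1 - 1 / real (m + 2))) \<longlonglongrightarrow> ereal 1" by simp
  then have "ereal 1 \<le> limsup (\<lambda>n. ereal (z n / (U n n * ln (real n))))"
    by (rule LIMSEQ_le_const2) (use ge in auto)
  then show ?thesis by (simp add: one_ereal_def)
qed

lemma limsup_le_1:
  assumes "\<And>m. eventually (\<lambda>n. z n \<le> (1 + 1 / real (Suc m)) * V n n * ln (real n)) sequentially"
  shows "limsup (\<lambda>n. ereal (z n / (U n n * ln (real n)))) \<le> 1"
proof -
  \<comment> \<open>One factor comes from the upper bound, the other from \<open>f n\<close>, which
    is eventually at most \<open>U n n / Suc m\<close> because the diagonal is bounded below by
    \<open>\<delta>\<close>.\<close>
  have le: "limsup (\<lambda>n. ereal (z n / (U n n * ln (real n)))) \<le> ereal ((1 + 1 / real (Suc m)) ^ 2)" for m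
  proof (rule Limsup_bounded)
    have "0 < \<delta> / real (Suc m)" using \<delta> by simp
    then have f: "eventually (\<lambda>n. f n < \<delta> / real (Suc m)) sequentially"
      using f_tendsto by (intro order_tendstoD(2))
    show "eventually (\<lambda>n. ereal (z n / (U n n * ln (real n))) \<le> ereal ((1 + 1 / real (Suc m)) ^ 2)) sequentially"
      using assms[of m] f eventually_ge_at_top[of 2]
    proof eventually_elim
      case (elim n)
      have L: "0 < ln (real n)" using elim by simp
      have Un: "0 < U n n" "\<delta> \<le> U n n" using elim by (auto intro: U_pos diag)
      have "f n \<le> \<delta> * (1 / real (Suc m))" using elim(2) by simp
      also have "\<dots> \<le> U n n * (1 / real (Suc m))" using Un by (intro mult_right_mono) auto
      finally have "V n n \<le> (1 + 1 / real (Suc m)) * U n n" by (simp add: algebra_simps del: of_nat_Suc)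
      then have "(1 + 1 / real (Suc m)) * V n n * ln (real n) \<le>
          (1 + 1 / real (Suc m)) * ((1 + 1 / real (Suc m)) * U n n) * ln (real n)"
        using L by (intro mult_right_mono mult_left_mono) auto
      then have "z n \<le> (1 + 1 / real (Suc m)) ^ 2 * (U n n * ln (real n))"
        using elim(1) by (simp only: power2_eq_square mult.assoc order_trans)
      then show ?case using L Un by (simp add: pos_divide_le_eq)
    qed
  qed
  have "(\<lambda>m. (1 + 1 / real (Suc m)) ^ 2) \<longlonglongrightarrow> 1" by real_asymp
  then have "(\<lambda>m. ereal ((1 + 1 / real (Suc m)) ^ 2)) \<longlonglongrightarrow> ereal 1" by simp
  then have "limsup (\<lambda>n. ereal (z n / (U n n * ln (real n)))) \<le> ereal 1"
    by (rule LIMSEQ_le_const) (use le in auto)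
  then show ?thesis by (simp add: one_ereal_def)
qed

lemma permanental_limsup:
  assumes Z: "permanental_sequence M \<alpha> V Z" and \<alpha>: "0 < \<alpha>"
  shows "AE w in M. limsup (\<lambda>n. ereal (Z n w / (U n n * ln (real n)))) = 1"
proof -
  have "AE w in M. eventually (\<lambda>n. Z n w \<le> (1 + 1 / real (Suc m)) * V n n * ln (real n)) sequentially" for m
    by (rule permanental_sequence_upper[OF Z V_pos \<alpha>]) auto
  then have "AE w in M. \<forall>m. eventually (\<lambda>n. Z n w \<le> (1 + 1 / real (Suc m)) * V n n * ln (real n)) sequentially"
    unfolding AE_all_countable by (intro allI)
  moreover have "AE w in M. \<exists>n\<ge>Suc k. (1 - 1 / real (m + 2)) * U n n * ln (real n) < Z n w" for m k :: nat
    by (rule permanental_lower_null[OF Z \<alpha>]) (auto simp: field_simps)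
  then have "AE w in M. \<forall>m k. \<exists>n\<ge>Suc k. (1 - 1 / real (m + 2)) * U n n * ln (real n) < Z n w"
    unfolding AE_all_countable by (intro allI)
  ultimately show ?thesis
  proof eventually_elim
    case (elim w)
    have "limsup (\<lambda>n. ereal (Z n w / (U n n * ln (real n)))) \<le> 1"
      by (rule limsup_le_1) (rule elim(1)[rule_format])
    moreover have "1 \<le> limsup (\<lambda>n. ereal (Z n w / (U n n * ln (real n))))"
    proof (rule limsup_ge_1)
      fix m k :: nat assume "1 \<le> k"
      then obtain k' where "k = Suc k'" by (cases k) auto
      then show "\<exists>n\<ge>k. (1 - 1 / real (m + 2)) * U n n * ln (real n) < Z n w"
        using elim(2)[rule_format, of k' m] by simp
    qed
    ultimately show ?case by (rule antisym)
  qed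
qed

end

text \<open>On the section, \<open>f A\<close> is the combination with weights \<open>h j\<close>,
  over all states \<open>j\<close>, of the vectors \<open>U j A\<close>, which are nonnegative also
  for \<open>j\<close> outside the section. The representation of \<open>f\<close> through
  \<open>h\<close> enters here.\<close>

lemma (in potential_kernel) rank_one_inverse_exists:
  assumes i: "inj_on i {..<n}" "i ` {..<n} \<subseteq> S"
    and h: "\<And>j. j \<in> S \<Longrightarrow> 0 \<le> h j" and f: "\<And>k. k \<in> S \<Longrightarrow> ((\<lambda>j. h j * U j k) has_sum f k) S"
  shows "\<exists>A A'. rank_one_inverses n (\<lambda>p q. U (i p) (i q)) (\<lambda>q. f (i q)) A A'"
proof (rule potential_inverse[OF i])
  fix A assume A: "inverse_kernels n (\<lambda>p q. U (i p) (i q)) A"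
    and off: "\<And>p q. p < n \<Longrightarrow> q < n \<Longrightarrow> p \<noteq> q \<Longrightarrow> A p q \<le> 0"
    and row: "\<And>p. p < n \<Longrightarrow> 0 \<le> (\<Sum>q<n. A p q)"
    and swept: "\<And>j q. j \<in> S \<Longrightarrow> q < n \<Longrightarrow> 0 \<le> (\<Sum>l<n. U j (i l) * A l q)"
  have fA: "0 \<le> (\<Sum>l<n. f (i l) * A l q)" if q: "q < n" for q
  proof (rule has_sum_nonneg)
    show "((\<lambda>j. \<Sum>l<n. h j * U j (i l) * A l q) has_sum (\<Sum>l<n. f (i l) * A l q)) S"
      using i(2) by (intro has_sum_sum has_sum_cmult_left f) auto
    show "0 \<le> (\<Sum>l<n. h j * U j (i l) * A l q)" if "j \<in> S" for j
      using mult_nonneg_nonneg[OF h[OF that] swept[OF that q]] by (simp add: sum_distrib_left mult.assoc)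
  qed
  show ?thesis
  proof (rule rank_one_inverse[of n "\<lambda>p q. U (i p) (i q)" A "\<lambda>q. f (i q)", OF A])
    fix A' assume "inverse_kernels n (\<lambda>p q. U (i p) (i q) + f (i q)) A'"
      "\<And>p q. p < n \<Longrightarrow> q < n \<Longrightarrow> A' p q \<le> A p q"
    then show ?thesis using A off row by (intro exI[of _ A] exI[of _ A']) simp
  qed (rule row fA, assumption)+
qed

text \<open>After an exchange of sums, every partial sum of \<open>f\<close> is at most
  \<open>C\<close> times the sum of \<open>h\<close>, so \<open>f\<close> is summable.\<close>

lemma excessive_tendsto_0:
  fixes U :: "nat \<Rightarrow> nat \<Rightarrow> real" and f h :: "nat \<Rightarrow> real"
  assumes U: "\<And>j k. 1 \<le> j \<Longrightarrow> 1 \<le> k \<Longrightarrow> 0 \<le> U j k" "\<And>j. 1 \<le> j \<Longrightarrow> U j summable_on {1..}"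
      "\<And>j. 1 \<le> j \<Longrightarrow> infsum (U j) {1..} \<le> C"
    and h: "\<And>j. 1 \<le> j \<Longrightarrow> 0 \<le> h j" "h summable_on {1..}"
    and f: "\<And>k. 1 \<le> k \<Longrightarrow> ((\<lambda>j. h j * U j k) has_sum f k) {1..}"
  shows "f \<longlonglongrightarrow> 0"
proof -
  have f0: "0 \<le> f k" if "1 \<le> k" for k
    using f[OF that] by (rule has_sum_nonneg) (use h U that in auto)
  have "(\<Sum>k<n. f (Suc k)) \<le> infsum h {1..} * C" for n
  proof (rule has_sum_mono)
    show "((\<lambda>j. \<Sum>k<n. h j * U j (Suc k)) has_sum (\<Sum>k<n. f (Suc k))) {1..}"
      by (intro has_sum_sum f) auto
    show "((\<lambda>j. h j * C) has_sum (infsum h {1..} * C)) {1..}"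
      using h(2) by (intro has_sum_cmult_left has_sum_infsum)
    fix j :: nat assume "j \<in> {1..}"
    then have j: "1 \<le> j" by simp
    have "(\<Sum>k<n. U j (Suc k)) = sum (U j) (Suc ` {..<n})" by (simp add: sum.reindex)
    also have "\<dots> \<le> infsum (U j) {1..}" using U(1)[OF j] U(2)[OF j] by (intro finite_sum_le_infsum) auto
    also have "\<dots> \<le> C" by (rule U(3)[OF j])
    finally have "h j * (\<Sum>k<n. U j (Suc k)) \<le> h j * C" using h(1)[OF j] by (rule mult_left_mono)
    then show "(\<Sum>k<n. h j * U j (Suc k)) \<le> h j * C" by (simp add: sum_distrib_left)
  qed
  then have "summable (\<lambda>k. f (Suc k))"
    using f0 by (intro summableI_nonneg_bounded) auto
  then have "(\<lambda>k. f (Suc k)) \<longlonglongrightarrow> 0" by (rule summable_LIMSEQ_zero)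
  then show ?thesis by (rule LIMSEQ_imp_Suc)
qed

text \<open>Existence and asymptotics are separate conjuncts, so that the \<open>limsup\<close> is
  settled for every realization of the kernel, on any probability space.\<close>

theorem theorem1p4:
  fixes \<Omega> :: "'w set" and F :: "ennreal \<Rightarrow> 'w measure"
    and P :: "nat \<Rightarrow> 'w measure" and X :: "real \<Rightarrow> 'w \<Rightarrow> nat"
    and U :: "nat \<Rightarrow> nat \<Rightarrow> real" and f h :: "nat \<Rightarrow> real" and \<alpha> :: real
  assumes "borel_right_process \<Omega> F P X"
    and "transient P X"
    and "\<And>j k. 1 \<le> j \<Longrightarrow> 1 \<le> k \<Longrightarrow> U j k = enn2real (potential_density P X j k)"
    and "\<And>j k. 1 \<le> j \<Longrightarrow> 1 \<le> k \<Longrightarrow> 0 < U j k"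
    and "0 < (INF j\<in>{1..}. U j j)"
    and "(SUP j\<in>{1..}. \<Sum>\<^sub>\<infinity>k\<in>{1..}. ennreal (U j k)) < \<infinity>"
    and "(SUP k\<in>{1..}. \<Sum>\<^sub>\<infinity>j\<in>{1..}. ennreal (U j k)) < \<infinity>"
    and "bounded (f ` {1..})"
    and "\<And>j. 1 \<le> j \<Longrightarrow> 0 \<le> h j"
    and "h summable_on {1..}"
    and "\<And>k. 1 \<le> k \<Longrightarrow> ((\<lambda>j. h j * U j k) has_sum f k) {1..}"
    and "0 < \<alpha>"
  shows "(\<exists>(M :: (nat \<Rightarrow> real) measure) Z. permanental_sequence M \<alpha> (\<lambda>j k. U j k + f k) Z) \<and>
    (\<forall>(M :: 'b measure) Z. permanental_sequence M \<alpha> (\<lambda>j k. U j k + f k) Z \<longrightarrow>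
      (AE \<omega> in M. limsup (\<lambda>n. ereal (Z n \<omega> / (U n n * ln (real n)))) = 1))"
proof -
  interpret borel_right_process \<Omega> F P X by fact
  have U0: "0 \<le> U j k" if "1 \<le> j" "1 \<le> k" for j k using assms(4)[OF that] by simp
  obtain Cr where Cr: "\<And>j. j \<in> {1..} \<Longrightarrow> U j summable_on {1..} \<and> infsum (U j) {1..} \<le> Cr"
    using summable_rows_of_SUP[OF _ assms(6)] U0 by auto
  obtain Cc where Cc: "\<And>k. k \<in> {1..} \<Longrightarrow> (\<lambda>j. U j k) summable_on {1..} \<and> infsum (\<lambda>j. U j k) {1..} \<le> Cc"
    using summable_rows_of_SUP[OF _ assms(7)] U0 by auto
  define C where "C = max Cr Cc"
  have row: "U j summable_on {1..}" "infsum (U j) {1..} \<le> C" if "1 \<le> j" for j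
    using Cr[of j] that by (auto simp: C_def)
  have col: "(\<lambda>j. U j k) summable_on {1..}" "infsum (\<lambda>j. U j k) {1..} \<le> C" if "1 \<le> k" for k
    using Cc[of k] that by (auto simp: C_def)
  interpret potential_kernel "{1..}" U "\<lambda>r j k. r * enn2real (resolvent r j k)" C
    by (rule potential_kernel[OF assms(2,3) row])
  interpret rank_one_potential U f C "INF j\<in>{1..}. U j j"
  proof
    show "(INF j\<in>{1..}. U j j) \<le> U j j" if "1 \<le> j" for j
      by (rule cINF_lower) (use that U0 in \<open>auto intro!: bdd_belowI2[of _ 0]\<close>)
    show "0 \<le> f k" if "1 \<le> k" for k
      using assms(11)[OF that] by (rule has_sum_nonneg) (use assms(9) U0 that in auto)
    show "f \<longlonglongrightarrow> 0" by (rule excessive_tendsto_0[OF U0 row assms(9,10,11)])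
    show "\<exists>A A'. rank_one_inverses n (\<lambda>p q. U (i p) (i q)) (\<lambda>q. f (i q)) A A'"
      if "inj_on i {..<n}" "i ` {..<n} \<subseteq> {1..}" for i n
      using that by (rule rank_one_inverse_exists[where h = h]) (use assms(9,11) in auto)
  qed (fact assms(4) row col assms(5))+
  show ?thesis using permanental_exists permanental_limsup assms(12) by blast
qed

end
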